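(* Let $m\ge1$ and $\mathfrak{g}_m=\mathfrak{sl}(2)\ltimes V(m)$, $\mathfrak{r}=V(m)$. Let $V=V(a_0)\oplus\cdots\oplus V(a_\ell)$ and $W=V(b_0)\oplus\cdots\oplus V(b_{\ell'})$ be the socle decompositions of two uniserial $\mathfrak{g}_m$-modules of type $Z$, and for $t\ge0$ let $S_t=\big(\bigoplus_{i+j=t}V(a_i)\otimes V(b_j)\big)^{\mathfrak{r}}$. Then $\mathrm{soc}(V\otimes W)=\mathrm{soc}(V)\otimes\mathrm{soc}(W)\oplus\bigoplus_{t=1}^{\min\{\ell,\ell'\}}S_t$, where, as $\mathfrak{sl}(2)$-modules, for $1\le t\le\min\{\ell,\ell'\}$: (i) If $V=Z(a_0,\ell)$ and $W=Z(b_0,\ell')$, then $S_t\cong V(a_0+b_0+mt)$, and hence $\mathrm{soc}(V\otimes W)\cong\bigoplus_{k=0}^{\min\{a_0,b_0\}}V(a_0+b_0-2k)\oplus\bigoplus_{t=1}^{\min\{\ell,\ell'\}}V(a_0+b_0+mt)$. (ii) If $V=Z(a_0,\ell)$ and $W=Z(b_{\ell'},\ell')^*$ (so $b_t=b_0-tm$), then $S_t=0$ if $a_0>b_t$ and $S_t\cong V(b_0-a_0-tm)$ if $a_0\le b_t$; hence $\mathrm{soc}(V\otimes W)\cong\bigoplus_{k=0}^{b_0}V(a_0-b_0+2k)$ if $a_0>b_0$, and $\mathrm{soc}(V\otimes W)\cong\bigoplus_{k=0}^{a_0}V(b_0-a_0+2k)\oplus\bigoplus_{t=1}^{T}V(b_0-a_0-tm)$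 if $a_0\le b_0$, where $T=\min\{\ell,\ell',\lfloor\frac{b_0-a_0}{m}\rfloor\}$. (iii) If $V=Z(a_\ell,\ell)^*$ and $W=Z(b_{\ell'},\ell')^*$, then $S_t=0$ for all $t\ge1$, and hence $\mathrm{soc}(V\otimes W)\cong\bigoplus_{k=0}^{\min\{a_0,b_0\}}V(|a_0-b_0|+2k)$. In particular, $\mathrm{soc}(V\otimes W)$ is multiplicity free as an $\mathfrak{sl}(2)$-module.
   Context: $\mathbb{F}$ is a field of characteristic zero; all modules are finite dimensional. $V(a)$ denotes the irreducible $\mathfrak{sl}(2)$-module of highest weight $a\ge0$. $\mathfrak{g}_m=\mathfrak{sl}(2)\ltimes V(m)$, where $\mathfrak{r}=V(m)$ is an abelian ideal with the adjoint $\mathfrak{sl}(2)$-action being that of $V(m)$. For integers $\alpha,\ell\ge0$, $Z(\alpha,\ell)$ is the uniserial $\mathfrak{g}_m$-module which as an $\mathfrak{sl}(2)$-module is $V(\alpha)\oplus V(\alpha+m)\oplus\cdots\oplus V(\alpha+\ell m)$, with $\mathfrak{r}V(\alpha)=0$ and with $\mathfrak{r}$ acting on $V(\alpha+im)$ ($1\le i\le\ell$) via a nonzero $\mathfrak{sl}(2)$-equivariant map $V(m)\otimes V(\alpha+im)\to V(\alpha+(i-1)m)$ (unique up to a scalar; the isomorphism class does not depend on the nonzero scalars chosen). Its socle decomposition is $V(\alpha)\oplus V(\alpha+m)\oplus\cdots\oplus V(\alpha+\ell m)$ in this order, and the socle decomposition of the dual $Z(\alpha,\ell)^*$ is $V(\alpha+\ell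 m)\oplus V(\alpha+(\ell-1)m)\oplus\cdots\oplus V(\alpha)$. Modules isomorphic to some $Z(\alpha,\ell)$ or $Z(\alpha,\ell)^*$ are said to be of type $Z$. In general, a socle decomposition of a uniserial module $V$ of composition length $\ell+1$ is a decomposition $V=V(a_0)\oplus\cdots\oplus V(a_\ell)$ into irreducible $\mathfrak{sl}(2)$-submodules with $\mathrm{soc}^k(V)=V(a_0)\oplus\cdots\oplus V(a_{k-1})$ for all $k$; $\mathrm{soc}$ denotes the socle (sum of irreducible submodules) and $U^{\mathfrak{r}}$ the vectors killed by $\mathfrak{r}$. *)

theory Defs
  imports Main
begin

text \<open>All modules are finite dimensional and are represented in coordinates:
  a module with index set I has as underlying space the functions
  (functions from the index type to the field) vanishing outside the finite set I.\<close>

definition vecs :: "'i set \<Rightarrow> ('i \<Rightarrow> 'a::zero) set" where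
  "vecs I = {v. \<forall>i. i \<notin> I \<longrightarrow> v i = 0}"

definition vadd :: "('i \<Rightarrow> 'a::plus) \<Rightarrow> ('i \<Rightarrow> 'a) \<Rightarrow> ('i \<Rightarrow> 'a)" where
  "vadd u v = (\<lambda>i. u i + v i)"

definition vsub :: "('i \<Rightarrow> 'a::minus) \<Rightarrow> ('i \<Rightarrow> 'a) \<Rightarrow> ('i \<Rightarrow> 'a)" where
  "vsub u v = (\<lambda>i. u i - v i)"

definition vsmul :: "'a::times \<Rightarrow> ('i \<Rightarrow> 'a) \<Rightarrow> ('i \<Rightarrow> 'a)" where
  "vsmul c v = (\<lambda>i. c * v i)"

definition vzero :: "'i \<Rightarrow> 'a::zero" where
  "vzero = (\<lambda>i. 0)"

definition vsum :: "('k \<Rightarrow> 'i \<Rightarrow> 'a::comm_monoid_add) \<Rightarrow> 'k set \<Rightarrow> ('i \<Rightarrow> 'a)" where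
  "vsum w A = (\<lambda>i. \<Sum>k\<in>A. w k i)"

definition subspace_of :: "('i \<Rightarrow> 'a::field) set \<Rightarrow> bool" where
  "subspace_of S \<longleftrightarrow> vzero \<in> S \<and> (\<forall>u\<in>S. \<forall>v\<in>S. vadd u v \<in> S) \<and> (\<forall>c. \<forall>v\<in>S. vsmul c v \<in> S)"

definition lin_on :: "('i \<Rightarrow> 'a::field) set \<Rightarrow> (('i \<Rightarrow> 'a) \<Rightarrow> ('j \<Rightarrow> 'a)) \<Rightarrow> bool" where
  "lin_on D f \<longleftrightarrow> (\<forall>u\<in>D. \<forall>v\<in>D. f (vadd u v) = vadd (f u) (f v)) \<and>
                  (\<forall>c. \<forall>v\<in>D. f (vsmul c v) = vsmul c (f v))"

definition is_dsum :: "('i \<Rightarrow> 'a::field) set \<Rightarrow> (nat \<Rightarrow> ('i \<Rightarrow> 'a) set) \<Rightarrow> nat \<Rightarrow> bool" where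
  "is_dsum Y A L \<longleftrightarrow>
     Y = {vsum w {..L} | w. \<forall>t\<le>L. w t \<in> A t} \<and>
     (\<forall>w. (\<forall>t\<le>L. w t \<in> A t) \<and> vsum w {..L} = vzero \<longrightarrow> (\<forall>t\<le>L. w t = vzero))"

text \<open>Basis of g_m: e, f, h of sl(2), and x_0, ..., x_m of r = V(m).
  Brackets: [h,e]=2e, [h,f]=-2f, [e,f]=h, [h,x_k]=(m-2k)x_k, [f,x_k]=x_(k+1) (0 if k=m),
  [e,x_k]=k(m-k+1)x_(k-1) (0 if k=0), [x_j,x_k]=0.  This is the standard
  basis of V(m) with f v_k = v_(k+1), e v_k = k(m-k+1) v_(k-1), h v_k = (m-2k) v_k.\<close>

datatype gmb = E | F | H | X nat

definition valid_gmb :: "nat \<Rightarrow> gmb \<Rightarrow> bool" where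
  "valid_gmb m b = (case b of X k \<Rightarrow> k \<le> m | _ \<Rightarrow> True)"

type_synonym ('a, 'i) gmod = "'i set \<times> (gmb \<Rightarrow> ('i \<Rightarrow> 'a) \<Rightarrow> ('i \<Rightarrow> 'a))"

definition car :: "('a, 'i) gmod \<Rightarrow> 'i set" where "car M = fst M"
definition act :: "('a, 'i) gmod \<Rightarrow> gmb \<Rightarrow> ('i \<Rightarrow> 'a) \<Rightarrow> ('i \<Rightarrow> 'a)" where "act M = snd M"

definition comm :: "('a::field, 'i) gmod \<Rightarrow> gmb \<Rightarrow> gmb \<Rightarrow> ('i \<Rightarrow> 'a) \<Rightarrow> ('i \<Rightarrow> 'a)" where
  "comm M b c v = vsub (act M b (act M c v)) (act M c (act M b v))"

definition gm_module :: "nat \<Rightarrow> ('a::field, 'i) gmod \<Rightarrow> bool" where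
  "gm_module m M \<longleftrightarrow>
     finite (car M) \<and>
     (\<forall>b. valid_gmb m b \<longrightarrow> (\<forall>v\<in>vecs (car M). act M b v \<in> vecs (car M)) \<and> lin_on (vecs (car M)) (act M b)) \<and>
     (\<forall>v\<in>vecs (car M).
        comm M H E v = vsmul 2 (act M E v) \<and>
        comm M H F v = vsmul (-2) (act M F v) \<and>
        comm M E F v = act M H v \<and>
        (\<forall>k\<le>m. comm M H (X k) v = vsmul (of_int (int m - 2 * int k)) (act M (X k) v)) \<and>
        (\<forall>k\<le>m. comm M F (X k) v = (if k < m then act M (X (Suc k)) v else vzero)) \<and>
        (\<forall>k\<le>m. comm M E (X k) v =
              (if 0 < k then vsmul (of_nat (k * (m - k + 1))) (act M (X (k - 1)) v) else vzero)) \<and>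
        (\<forall>j\<le>m. \<forall>k\<le>m. comm M (X j) (X k) v = vzero))"

text \<open>Tensor product of g_m-modules: x(v \<otimes> w) = xv \<otimes> w + v \<otimes> xw.\<close>
definition tens :: "('a::field, 'i) gmod \<Rightarrow> ('a, 'j) gmod \<Rightarrow> ('a, 'i \<times> 'j) gmod" where
  "tens M N = (car M \<times> car N,
     \<lambda>b w (i, j). act M b (\<lambda>i'. w (i', j)) i + act N b (\<lambda>j'. w (i, j')) j)"

definition tens_sub :: "('i \<Rightarrow> 'a::field) set \<Rightarrow> ('j \<Rightarrow> 'a) set \<Rightarrow> ('i \<times> 'j \<Rightarrow> 'a) set" where
  "tens_sub U U' = {w. \<exists>(n::nat) u u'. (\<forall>k<n. u k \<in> U \<and> u' k \<in> U') \<and>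
                         w = (\<lambda>(p, q). \<Sum>k<n. u k p * u' k q)}"

definition submod :: "nat \<Rightarrow> ('a::field, 'i) gmod \<Rightarrow> ('i \<Rightarrow> 'a) set \<Rightarrow> bool" where
  "submod m M S \<longleftrightarrow> S \<subseteq> vecs (car M) \<and> subspace_of S \<and>
     (\<forall>b. valid_gmb m b \<longrightarrow> (\<forall>v\<in>S. act M b v \<in> S))"

definition irred_submod :: "nat \<Rightarrow> ('a::field, 'i) gmod \<Rightarrow> ('i \<Rightarrow> 'a) set \<Rightarrow> bool" where
  "irred_submod m M S \<longleftrightarrow> submod m M S \<and> S \<noteq> {vzero} \<and>
     (\<forall>S'. submod m M S' \<and> S' \<subseteq> S \<longrightarrow> S' = {vzero} \<or> S' = S)"

definition socle :: "nat \<Rightarrow> ('a::field, 'i) gmod \<Rightarrow> ('i \<Rightarrow> 'a) set" where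
  "socle m M = {vsum w {..<(n::nat)} | w n. \<forall>j<n. \<exists>S. irred_submod m M S \<and> w j \<in> S}"

definition r_inv :: "nat \<Rightarrow> ('a::field, 'i) gmod \<Rightarrow> ('i \<Rightarrow> 'a) set \<Rightarrow> ('i \<Rightarrow> 'a) set" where
  "r_inv m M S = {v\<in>S. \<forall>k\<le>m. act M (X k) v = vzero}"

text \<open>V(c) has basis v_0, ..., v_c with h v_k = (c-2k) v_k, f v_k = v_(k+1) (v_(c+1)=0),
  e v_k = k(c-k+1) v_(k-1).  Below, the actions in coordinates.\<close>
definition Vact :: "nat \<Rightarrow> gmb \<Rightarrow> (nat \<Rightarrow> 'a::field) \<Rightarrow> (nat \<Rightarrow> 'a)" where
  "Vact c b v = (case b of
      H \<Rightarrow> (\<lambda>k. if k \<le> c then of_int (int c - 2 * int k) * v k else 0)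
    | F \<Rightarrow> (\<lambda>k. if 0 < k \<and> k \<le> c then v (k - 1) else 0)
    | E \<Rightarrow> (\<lambda>k. if k < c then of_nat ((k + 1) * (c - k)) * v (k + 1) else 0)
    | X _ \<Rightarrow> (\<lambda>k. 0))"

text \<open>The sl(2)-module V(cs!0) \<oplus> ... \<oplus> V(cs!(n-1)), coordinates indexed by (j,k).\<close>
definition ds_vecs :: "nat list \<Rightarrow> (nat \<times> nat \<Rightarrow> 'a::zero) set" where
  "ds_vecs cs = vecs {(j, k). j < length cs \<and> k \<le> cs ! j}"

definition ds_act :: "nat list \<Rightarrow> gmb \<Rightarrow> (nat \<times> nat \<Rightarrow> 'a::field) \<Rightarrow> (nat \<times> nat \<Rightarrow> 'a)" where
  "ds_act cs b v = (\<lambda>(j, k). if j < length cs then Vact (cs ! j) b (\<lambda>k'. v (j, k')) k else 0)"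

definition sl2_hom :: "nat list \<Rightarrow> ('a::field, 'i) gmod \<Rightarrow> ((nat \<times> nat \<Rightarrow> 'a) \<Rightarrow> ('i \<Rightarrow> 'a)) \<Rightarrow> bool" where
  "sl2_hom cs M \<phi> \<longleftrightarrow> lin_on (ds_vecs cs) \<phi> \<and> \<phi> ` ds_vecs cs \<subseteq> vecs (car M) \<and>
     (\<forall>b\<in>{E, F, H}. \<forall>v\<in>ds_vecs cs. \<phi> (ds_act cs b v) = act M b (\<phi> v))"

definition sl2_iso_onto :: "nat list \<Rightarrow> ('a::field, 'i) gmod \<Rightarrow> ('i \<Rightarrow> 'a) set \<Rightarrow> bool" where
  "sl2_iso_onto cs M S \<longleftrightarrow>
     (\<exists>\<phi>. sl2_hom cs M \<phi> \<and> inj_on \<phi> (ds_vecs cs) \<and> \<phi> ` ds_vecs cs = S)"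

definition sl2_mult_free :: "('a::field, 'i) gmod \<Rightarrow> ('i \<Rightarrow> 'a) set \<Rightarrow> bool" where
  "sl2_mult_free M S \<longleftrightarrow>
     (\<forall>c. \<not> (\<exists>\<phi>. sl2_hom [c, c] M \<phi> \<and> inj_on \<phi> (ds_vecs [c, c]) \<and> \<phi> ` ds_vecs [c, c] \<subseteq> S))"

definition zweight :: "bool \<Rightarrow> nat \<Rightarrow> nat \<Rightarrow> nat \<Rightarrow> nat" where
  "zweight up a0 m i = (if up then a0 + i * m else a0 - i * m)"

text \<open>zmod m M U a0 l up: M is a g_m-module and U 0, ..., U l is a decomposition of M
  into sl(2)-submodules with U i \<cong> V(a_i), r U 0 = 0, and r acting on U i via a nonzero
  map into U (i-1).  If up, a_i = a0 + i m, i.e. M \<cong> Z(a0,l) with socle decomposition U;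
  if not up, a_i = a0 - i m (a0 \<ge> l m), i.e. M \<cong> Z(a_l,l)^* with socle decomposition U.\<close>
definition zmod :: "nat \<Rightarrow> ('a::field, 'i) gmod \<Rightarrow> (nat \<Rightarrow> ('i \<Rightarrow> 'a) set) \<Rightarrow> nat \<Rightarrow> nat \<Rightarrow> bool \<Rightarrow> bool" where
  "zmod m M U a0 l up \<longleftrightarrow>
     gm_module m M \<and> (up \<or> l * m \<le> a0) \<and>
     (\<forall>i\<le>l. sl2_iso_onto [zweight up a0 m i] M (U i)) \<and>
     is_dsum (vecs (car M)) U l \<and>
     (\<forall>k\<le>m. \<forall>u\<in>U 0. act M (X k) u = vzero) \<and>
     (\<forall>i. 1 \<le> i \<and> i \<le> l \<longrightarrow>
        (\<forall>k\<le>m. \<forall>u\<in>U i. act M (X k) u \<in> U (i - 1)) \<and>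
        (\<exists>k\<le>m. \<exists>u\<in>U i. act M (X k) u \<noteq> vzero))"

definition Sdef :: "nat \<Rightarrow> ('a::field, 'i) gmod \<Rightarrow> ('a, 'j) gmod \<Rightarrow> (nat \<Rightarrow> ('i \<Rightarrow> 'a) set) \<Rightarrow>
                    (nat \<Rightarrow> ('j \<Rightarrow> 'a) set) \<Rightarrow> nat \<Rightarrow> nat \<Rightarrow> nat \<Rightarrow> ('i \<times> 'j \<Rightarrow> 'a) set" where
  "Sdef m V W U U' l l' t =
     r_inv m (tens V W)
       {vsum w {i. i \<le> t \<and> i \<le> l \<and> t - i \<le> l'} | w.
          \<forall>i. i \<le> t \<and> i \<le> l \<and> t - i \<le> l' \<longrightarrow> w i \<in> tens_sub (U i) (U' (t - i))}"

end

theory Submission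
  imports Defs "HOL.Vector_Spaces" "HOL-Library.Function_Algebras"
begin

text \<open>Since \<open>r\<close> acts nilpotently and trivially on irreducible modules, the socle of \<open>V \<otimes> W\<close> is its space
  of \<open>r\<close>-invariants, as soon as the latter is a sum of irreducible \<open>sl(2)\<close>-modules; so everything is
  read off from the highest weight vectors killed by \<open>r\<close>. Such a vector is killed by \<open>r\<close> as soon as it
  is killed by the lowest weight vector \<open>x\<^sub>m\<close> of \<open>r\<close>. Because \<open>x\<^sub>m\<close> commutes with \<open>f\<close>, it acts on
  suitably scaled bases \<open>f\<^sup>k v\<close> of the layers \<open>V(a\<^sub>i)\<close> as a shift: by \<open>0\<close> if the weights \<open>a\<^sub>i\<close> increase,
  and by \<open>m\<close> if they decrease. The conditions \<open>e v = 0\<close> and \<open>x\<^sub>m v = 0\<close> therefore become two-term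
  recurrences for coefficients, which can be solved by hand. On an antidiagonal of one
  \<open>V(a\<^sub>i) \<otimes> V(b\<^sub>j)\<close> the coefficients all vanish or are all nonzero, which rules out all but the listed solutions.\<close>

text \<open>The pointwise rules must not be used by default: they also rewrite eta-expanded function
  constants, such as those produced by induction rules.\<close>

declare zero_fun_apply [simp del] plus_fun_apply [simp del] minus_apply [simp del]
  uminus_apply [simp del] times_fun_apply [simp del] one_fun_apply [simp del]

text \<open>The claimed highest weights are pairwise distinct: in degrees t \<ge> 1 they all exceed
  \<open>a0 + b0\<close> or all lie below \<open>b0 - a0\<close>, outside the Clebsch-Gordan range
  of degree 0. Hence one highest weight vector per weight suffices, and a family indexed by weights
  describes all \<open>r\<close>-invariants. The same distinctness forces a highest weight vector,
  which a priori mixes the degrees t = i + j, to be homogeneous; this yields the decomposition into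
  the S_t together with multiplicity freeness. Uniqueness within a weight needs no computation of a
  solution space: every nonzero solution of the recurrences has a nonzero coefficient at one of a
  few base positions, so a suitable multiple of a known solution can be subtracted until nothing is
  left. The obstacle is the passage between layers: \<open>x_m\<close> ties the coefficients on
  (i+1, j) to those on (i, j+1), whose index ranges differ. Chains of nonzero coefficients are
  pushed to the ends of the range of layers, and the bounds on layers and weights then produce the
  conditions on t.\<close>

lemma vadd_eq [simp]: "vadd = (+)"
  by (simp add: vadd_def plus_fun_def fun_eq_iff)

lemma vsub_eq [simp]: "vsub u v = u - v"
  by (simp add: vsub_def fun_diff_def)

lemma vzero_eq [simp]: "vzero = 0"
  by (simp add: vzero_def zero_fun_def)

lemma vsmul_apply: "vsmul c v i = c * v i"
  by (simp add: vsmul_def)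

lemmas fun_apply = zero_fun_apply plus_fun_apply minus_apply uminus_apply vsmul_apply

lemma sum_fun_apply: "sum w A i = (\<Sum>k\<in>A. w k i)"
  for w :: "'k \<Rightarrow> 'i \<Rightarrow> 'a::comm_monoid_add"
  by (induction A rule: infinite_finite_induct) (auto simp: fun_apply)

lemma vsum_eq [simp]: "vsum w A = sum w A"
  by (simp add: vsum_def fun_eq_iff sum_fun_apply)

global_interpretation fv: vector_space "vsmul :: 'a::field \<Rightarrow> ('i \<Rightarrow> 'a) \<Rightarrow> 'i \<Rightarrow> 'a"
  by standard (auto simp: fun_eq_iff fun_apply algebra_simps)

section \<open>Subspaces, and maps that are linear on a subspace\<close>

lemma subspace_of_eq: "subspace_of = fv.subspace"
  by (auto simp: subspace_of_def fv.subspace_def)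

lemma subspace_vecs [intro, simp]: "fv.subspace (vecs A)"
  by (auto simp: fv.subspace_def vecs_def fun_apply)

context
  fixes D :: "('i \<Rightarrow> 'a::field) set" and g :: "('i \<Rightarrow> 'a) \<Rightarrow> ('j \<Rightarrow> 'a)"
  assumes D: "fv.subspace D" and g: "lin_on D g"
begin

lemma lin_on_add: "u \<in> D \<Longrightarrow> v \<in> D \<Longrightarrow> g (u + v) = g u + g v"
  using g by (simp add: lin_on_def)

lemma lin_on_smul: "v \<in> D \<Longrightarrow> g (vsmul c v) = vsmul c (g v)"
  using g by (simp add: lin_on_def)

lemma lin_on_zero: "g 0 = 0"
  using lin_on_smul[of 0 0] fv.subspace_0[OF D] by simp

lemma lin_on_diff: "u \<in> D \<Longrightarrow> v \<in> D \<Longrightarrow> g (u - v) = g u - g v"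
  using lin_on_add[of "u - v" v] fv.subspace_diff[OF D] by (simp add: algebra_simps)

lemma lin_on_sum: "(\<And>k. k \<in> A \<Longrightarrow> w k \<in> D) \<Longrightarrow> g (\<Sum>k\<in>A. w k) = (\<Sum>k\<in>A. g (w k))"
  by (induction A rule: infinite_finite_induct)
    (simp_all add: lin_on_zero lin_on_add fv.subspace_sum[OF D])

text \<open>Combined with \<open>fv.span_minimal\<close>, this extends statements about the action
  from generators to spans. The preimage is taken inside \<open>D\<close> because \<open>g\<close>
  is linear only there.\<close>

lemma subspace_lin_preimage: "fv.subspace S \<Longrightarrow> fv.subspace {v \<in> D. g v \<in> S}"
  using D by (auto simp: fv.subspace_def lin_on_add lin_on_smul lin_on_zero)

end

lemma subspace_sums:
  assumes S: "\<And>i. i \<in> A \<Longrightarrow> fv.subspace (S i)"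
  shows "fv.subspace {sum w A | w. \<forall>i\<in>A. w i \<in> S i}" (is "fv.subspace ?S")
  unfolding fv.subspace_def
proof (intro conjI ballI allI)
  show "0 \<in> ?S"
    by (intro CollectI exI[of _ "\<lambda>_. 0"]) (auto simp: fv.subspace_0[OF S])
  fix x y k assume "x \<in> ?S"
  then obtain w where w: "x = sum w A" "\<forall>i\<in>A. w i \<in> S i" by blast
  show "vsmul k x \<in> ?S"
    using w by (intro CollectI exI[of _ "\<lambda>i. vsmul k (w i)"])
      (auto simp: fv.subspace_scale[OF S] fv.scale_sum_right)
  assume "y \<in> ?S"
  then obtain w' where w': "y = sum w' A" "\<forall>i\<in>A. w' i \<in> S i" by blast
  show "x + y \<in> ?S"
    using w w' by (intro CollectI exI[of _ "\<lambda>i. w i + w' i"])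
      (auto simp: fv.subspace_add[OF S] sum.distrib)
qed

text \<open>The commutator computations give the raising coefficient over the integers, whereas
  \<open>Vact\<close> states it with truncated subtraction; the two agree below the top
  index.\<close>

lemma of_int_raising:
  assumes "k < c"
  shows "of_int ((int k + 1) * (int c - int k)) = (of_nat ((k + 1) * (c - k)) :: 'a::ring_1)"
proof -
  have "(int k + 1) * (int c - int k) = int ((k + 1) * (c - k))"
    using assms by (simp only: of_nat_mult of_nat_add of_nat_1 of_nat_diff[OF less_imp_le])
  then show ?thesis by (simp only: of_int_of_nat_eq)
qed

section \<open>Highest weight theory in a weight-graded \<open>sl(2)\<close>-module\<close>

text \<open>The weight bound \<open>N\<close> is what makes \<open>e\<close> and \<open>f\<close>
  nilpotent on weight vectors. Diagonalizability of \<open>h\<close> with integer weights is assumed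
  because every application reads it off from a weight basis.\<close>

locale sl2_module =
  fixes D :: "('i \<Rightarrow> 'a::field_char_0) set"
    and e f h :: "('i \<Rightarrow> 'a) \<Rightarrow> ('i \<Rightarrow> 'a)" and N :: int
  assumes D: "fv.subspace D"
    and closed: "v \<in> D \<Longrightarrow> e v \<in> D" "v \<in> D \<Longrightarrow> f v \<in> D" "v \<in> D \<Longrightarrow> h v \<in> D"
    and lin: "lin_on D e" "lin_on D f" "lin_on D h"
    and he: "v \<in> D \<Longrightarrow> h (e v) = e (h v) + vsmul 2 (e v)"
    and hf: "v \<in> D \<Longrightarrow> h (f v) = f (h v) - vsmul 2 (f v)"
    and ef: "v \<in> D \<Longrightarrow> e (f v) = f (e v) + h v"
    and wt_decomp: "v \<in> D \<Longrightarrow>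
      \<exists>w. v = (\<Sum>\<mu>\<in>{-N..N}. w \<mu>) \<and> (\<forall>\<mu>. w \<mu> \<in> D \<and> h (w \<mu>) = vsmul (of_int \<mu>) (w \<mu>))"
begin

definition wt :: "int \<Rightarrow> ('i \<Rightarrow> 'a) set" where
  "wt \<mu> = {v \<in> D. h v = vsmul (of_int \<mu>) v}"

definition stable :: "('i \<Rightarrow> 'a) set \<Rightarrow> bool" where
  "stable R \<longleftrightarrow> fv.subspace R \<and> R \<subseteq> D \<and> (\<forall>v\<in>R. e v \<in> R \<and> f v \<in> R \<and> h v \<in> R)"

lemma stableD:
  assumes "stable R"
  shows "fv.subspace R" "v \<in> R \<Longrightarrow> v \<in> D" "v \<in> R \<Longrightarrow> e v \<in> R" "v \<in> R \<Longrightarrow> f v \<in> R"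
    "v \<in> R \<Longrightarrow> h v \<in> R"
  using assms by (auto simp: stable_def)

lemma pow_closed: "v \<in> D \<Longrightarrow> (e ^^ n) v \<in> D" "v \<in> D \<Longrightarrow> (f ^^ n) v \<in> D"
  by (induction n) (auto intro: closed)

lemma pow_stable:
  assumes "stable R" "v \<in> R" shows "(e ^^ n) v \<in> R" "(f ^^ n) v \<in> R"
  using assms by (induction n) (auto intro: stableD)

lemma e_pow_lin: "lin_on D (e ^^ n)"
proof (induction n)
  case (Suc n)
  then show ?case
    by (simp add: lin_on_def pow_closed lin_on_add[OF D lin(1)] lin_on_smul[OF D lin(1)])
qed (simp add: lin_on_def)

lemma pow_zero: "(e ^^ n) 0 = 0" "(f ^^ n) 0 = 0"
  by (induction n) (simp_all add: lin_on_zero[OF D lin(1)] lin_on_zero[OF D lin(2)])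

lemma wt_subspace: "fv.subspace (wt \<mu>)"
  unfolding fv.subspace_def wt_def
  by (auto simp: lin_on_add[OF D lin(3)] lin_on_smul[OF D lin(3)] lin_on_zero[OF D lin(3)]
      fv.subspace_0[OF D] fv.subspace_add[OF D] fv.subspace_scale[OF D] fv.scale_right_distrib
      mult.commute)

lemma e_wt: "v \<in> wt \<mu> \<Longrightarrow> e v \<in> wt (\<mu> + 2)"
  by (simp add: wt_def closed he lin_on_smul[OF D lin(1)] flip: fv.scale_left_distrib)

lemma f_wt: "v \<in> wt \<mu> \<Longrightarrow> f v \<in> wt (\<mu> - 2)"
  by (simp add: wt_def closed hf lin_on_smul[OF D lin(2)] flip: fv.scale_left_diff_distrib)

lemma e_pow_wt: "v \<in> wt \<mu> \<Longrightarrow> (e ^^ n) v \<in> wt (\<mu> + 2 * int n)"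
proof (induction n)
  case (Suc n)
  then show ?case using e_wt[of "(e ^^ n) v" "\<mu> + 2 * int n"] by (simp add: algebra_simps)
qed simp

lemma f_pow_wt: "v \<in> wt \<mu> \<Longrightarrow> (f ^^ n) v \<in> wt (\<mu> - 2 * int n)"
proof (induction n)
  case (Suc n)
  then show ?case using f_wt[of "(f ^^ n) v" "\<mu> - 2 * int n"] by (simp add: algebra_simps)
qed simp

text \<open>Applying \<open>h - \<mu>\<close> removes the component of weight \<open>\<mu>\<close>.\<close>

lemma wt_components:
  assumes R: "fv.subspace R" "\<And>v. v \<in> R \<Longrightarrow> h v \<in> R"
    and A: "finite A" and w: "\<And>\<mu>. \<mu> \<in> A \<Longrightarrow> w \<mu> \<in> wt \<mu>" and s: "(\<Sum>\<mu>\<in>A. w \<mu>) \<in> R"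
    and \<mu>: "\<mu> \<in> A"
  shows "w \<mu> \<in> R"
  using A w s \<mu>
proof (induction A arbitrary: w \<mu> rule: finite_induct)
  case (insert x A)
  let ?s = "\<Sum>\<nu>\<in>insert x A. w \<nu>"
  have "h ?s = (\<Sum>\<nu>\<in>insert x A. vsmul (of_int \<nu>) (w \<nu>))"
    using insert.prems(1) by (subst lin_on_sum[OF D lin(3)]) (auto simp: wt_def intro!: sum.cong)
  then have "h ?s - vsmul (of_int x) ?s = (\<Sum>\<nu>\<in>A. vsmul (of_int (\<nu> - x)) (w \<nu>))"
    using insert.hyps
    by (simp add: fv.scale_right_distrib fv.scale_sum_right fv.scale_left_diff_distrib sum_subtractf)
  moreover have "h ?s - vsmul (of_int x) ?s \<in> R"
    by (intro fv.subspace_diff[OF R(1)] fv.subspace_scale[OF R(1)] R(2) insert.prems(2))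
  ultimately have s': "(\<Sum>\<nu>\<in>A. vsmul (of_int (\<nu> - x)) (w \<nu>)) \<in> R" by simp
  have wA: "w \<nu> \<in> R" if "\<nu> \<in> A" for \<nu>
  proof -
    have "vsmul (of_int (\<nu> - x)) (w \<nu>) \<in> R"
      by (rule insert.IH[OF _ s' that]) (use insert.prems(1) in \<open>auto intro: fv.subspace_scale[OF wt_subspace]\<close>)
    then have "vsmul (inverse (of_int (\<nu> - x))) (vsmul (of_int (\<nu> - x)) (w \<nu>)) \<in> R"
      by (rule fv.subspace_scale[OF R(1)])
    moreover have "of_int \<nu> \<noteq> (of_int x :: 'a)" using that insert.hyps by auto
    ultimately show ?thesis by simp
  qed
  have "w x = ?s - (\<Sum>\<nu>\<in>A. w \<nu>)" using insert.hyps by simp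
  then have "w x \<in> R"
    using insert.prems(2) wA fv.subspace_diff[OF R(1)] fv.subspace_sum[OF R(1), of A w] by metis
  then show ?case using wA insert.prems(3) by auto
qed simp

lemma wt_indep:
  assumes "finite A" "\<And>\<mu>. \<mu> \<in> A \<Longrightarrow> w \<mu> \<in> wt \<mu>" "(\<Sum>\<mu>\<in>A. w \<mu>) = 0" "\<mu> \<in> A"
  shows "w \<mu> = 0"
  using wt_components[of "{0}" A w \<mu>] assms by (simp add: lin_on_zero[OF D lin(3)])

lemma wt_decomp_stable:
  assumes "stable R" "v \<in> R"
  obtains w where "v = (\<Sum>\<mu>\<in>{-N..N}. w \<mu>)" "\<And>\<mu>. w \<mu> \<in> wt \<mu>"
    "\<And>\<mu>. \<mu> \<in> {-N..N} \<Longrightarrow> w \<mu> \<in> R"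
proof -
  obtain w where w: "v = (\<Sum>\<mu>\<in>{-N..N}. w \<mu>)" "\<forall>\<mu>. w \<mu> \<in> wt \<mu>"
    using wt_decomp[OF stableD(2)[OF assms]] by (auto simp: wt_def)
  have "w \<mu> \<in> R" if "\<mu> \<in> {-N..N}" for \<mu>
    using wt_components[of R "{-N..N}" w \<mu>] w that assms stableD[OF assms(1)] by auto
  then show ?thesis using that w by blast
qed

lemma wt_bounded:
  assumes v: "v \<in> wt \<mu>" and "\<mu> \<notin> {-N..N}"
  shows "v = 0"
proof -
  obtain w where w: "v = (\<Sum>\<nu>\<in>{-N..N}. w \<nu>)" "\<forall>\<nu>. w \<nu> \<in> wt \<nu>"
    using wt_decomp[of v] v by (auto simp: wt_def)
  \<comment> \<open>Adding \<open>- v\<close> as the component of weight \<mu> to a decomposition of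
    \<open>v\<close> gives a vanishing sum over distinct weights, so \<open>v\<close> vanishes by
    independence.\<close>
  have "(\<Sum>\<nu>\<in>insert \<mu> {-N..N}. if \<nu> = \<mu> then - v else w \<nu>) = - v + (\<Sum>\<nu>\<in>{-N..N}. w \<nu>)"
    using assms(2) by (subst sum.insert) (auto intro!: sum.cong)
  then have "(if \<mu> = \<mu> then - v else w \<mu>) = 0"
    by (intro wt_indep[of "insert \<mu> {-N..N}" "\<lambda>\<nu>. if \<nu> = \<mu> then - v else w \<nu>"])
      (use w v in \<open>auto intro: fv.subspace_neg[OF wt_subspace]\<close>)
  then show ?thesis by simp
qed

lemma e_pow_nilpotent: "v \<in> wt \<mu> \<Longrightarrow> \<exists>n. (e ^^ n) v = 0"
  by (rule exI[of _ "nat (N - \<mu> + 1)"]) (erule wt_bounded[OF e_pow_wt], auto)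

lemma f_pow_nilpotent: "v \<in> wt \<mu> \<Longrightarrow> \<exists>n. (f ^^ n) v = 0"
  by (rule exI[of _ "nat (N + \<mu> + 1)"]) (erule wt_bounded[OF f_pow_wt], auto)

text \<open>Moving \<open>e\<close> past n + 1 factors \<open>f\<close> produces \<open>h\<close>
  once per factor, on the weights \<mu>, \<mu> - 2, ..., \<mu> - 2n; these add up to (n + 1)(\<mu> -
  n).\<close>

lemma e_f_pow:
  assumes v: "v \<in> wt \<mu>"
  shows "e ((f ^^ Suc n) v)
    = (f ^^ Suc n) (e v) + vsmul (of_int ((int n + 1) * (\<mu> - int n))) ((f ^^ n) v)"
proof (induction n)
  case 0
  then show ?case using v by (simp add: ef wt_def)
next
  case (Suc n)
  have "e ((f ^^ Suc (Suc n)) v) = f (e ((f ^^ Suc n) v)) + h ((f ^^ Suc n) v)"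
    using ef[of "(f ^^ Suc n) v"] pow_closed(2)[of v "Suc n"] v by (simp add: wt_def)
  also have "h ((f ^^ Suc n) v) = vsmul (of_int (\<mu> - 2 * int (Suc n))) ((f ^^ Suc n) v)"
    using f_pow_wt[OF v, of "Suc n"] by (simp add: wt_def del: funpow.simps)
  also have "f (e ((f ^^ Suc n) v))
      = (f ^^ Suc (Suc n)) (e v) + vsmul (of_int ((int n + 1) * (\<mu> - int n))) ((f ^^ Suc n) v)"
    unfolding Suc.IH using v
    by (subst lin_on_add[OF D lin(2)])
      (auto simp: pow_closed closed wt_def fv.subspace_scale[OF D] lin_on_smul[OF D lin(2)]
        simp del: of_int_mult)
  also have "(f ^^ Suc (Suc n)) (e v)
      + vsmul (of_int ((int n + 1) * (\<mu> - int n))) ((f ^^ Suc n) v)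
      + vsmul (of_int (\<mu> - 2 * int (Suc n))) ((f ^^ Suc n) v)
    = (f ^^ Suc (Suc n)) (e v)
      + vsmul (of_int ((int n + 1) * (\<mu> - int n) + (\<mu> - 2 * int (Suc n)))) ((f ^^ Suc n) v)"
    by (simp only: of_int_add fv.scale_left_distrib add.assoc)
  also have "(int n + 1) * (\<mu> - int n) + (\<mu> - 2 * int (Suc n))
      = (int (Suc n) + 1) * (\<mu> - int (Suc n))"
    by (simp add: algebra_simps)
  finally show ?case .
qed

text \<open>Mirror image of \<open>e_f_pow\<close> for a vector killed by \<open>f\<close>; the sign
  comes from writing f e = e f - h.\<close>

lemma f_e_pow:
  assumes v: "v \<in> wt \<mu>" "f v = 0"
  shows "f ((e ^^ Suc n) v) = vsmul (- of_int ((int n + 1) * (\<mu> + int n))) ((e ^^ n) v)"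
proof (induction n)
  case 0
  have "0 = f (e v) + vsmul (of_int \<mu>) v"
    using ef[of v] v lin_on_zero[OF D lin(1)] by (simp add: wt_def)
  then show ?case by (simp add: add_eq_0_iff eq_commute[of 0] minus_equation_iff[of "f (e v)"])
next
  case (Suc n)
  have "f (e ((e ^^ Suc n) v)) = e (f ((e ^^ Suc n) v)) - h ((e ^^ Suc n) v)"
    using ef[of "(e ^^ Suc n) v"] pow_closed(1)[of v "Suc n"] v by (simp add: wt_def)
  also have "h ((e ^^ Suc n) v) = vsmul (of_int (\<mu> + 2 * int (Suc n))) ((e ^^ Suc n) v)"
    using e_pow_wt[OF v(1), of "Suc n"] by (simp add: wt_def del: funpow.simps)
  also have "e (f ((e ^^ Suc n) v))
      = vsmul (- of_int ((int n + 1) * (\<mu> + int n))) ((e ^^ Suc n) v)"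
    unfolding Suc.IH using v
    by (subst lin_on_smul[OF D lin(1)]) (auto simp: pow_closed wt_def)
  also have "vsmul (- of_int ((int n + 1) * (\<mu> + int n))) ((e ^^ Suc n) v)
      - vsmul (of_int (\<mu> + 2 * int (Suc n))) ((e ^^ Suc n) v)
    = vsmul (of_int (- ((int n + 1) * (\<mu> + int n)) - (\<mu> + 2 * int (Suc n)))) ((e ^^ Suc n) v)"
    by (simp only: of_int_diff of_int_minus fv.scale_left_diff_distrib)
  also have "- ((int n + 1) * (\<mu> + int n)) - (\<mu> + 2 * int (Suc n))
      = - ((int (Suc n) + 1) * (\<mu> + int (Suc n)))"
    by (simp add: algebra_simps)
  finally show ?case by (simp del: of_int_mult funpow.simps) simp
qed

text \<open>If \<open>f (e v) = 0\<close>, the extra term in \<open>e_f_pow\<close> vanishes,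
  exactly as for a highest weight vector. For negative \<mu> the remaining coefficient is never
  zero, so no power of \<open>f\<close> could kill a nonzero \<open>v\<close>.\<close>

lemma f_e_zero_neg:
  assumes v: "v \<in> wt \<mu>" "f (e v) = 0" "\<mu> < 0"
  shows "v = 0"
proof (rule ccontr)
  assume "v \<noteq> 0"
  have "(f ^^ n) v \<noteq> 0" for n
  proof (induction n)
    case (Suc n)
    have "(f ^^ Suc n) (e v) = 0"
      using v(2) pow_zero by (simp add: funpow_Suc_right del: funpow.simps)
    then have "e ((f ^^ Suc n) v) = vsmul (of_int ((int n + 1) * (\<mu> - int n))) ((f ^^ n) v)"
      using e_f_pow[OF v(1), of n] by simp
    moreover have "(int n + 1) * (\<mu> - int n) \<noteq> 0" using \<open>\<mu> < 0\<close> by simp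
    ultimately have "e ((f ^^ Suc n) v) \<noteq> 0"
      using Suc by (simp only: fv.scale_eq_0_iff of_int_eq_0_iff) simp
    then show ?case using lin_on_zero[OF D lin(1)] by metis
  qed (simp add: \<open>v \<noteq> 0\<close>)
  then show False using f_pow_nilpotent[OF v(1)] by blast
qed

lemma f_zero_pos:
  assumes v: "v \<in> wt \<mu>" "f v = 0" "\<mu> > 0"
  shows "v = 0"
proof (rule ccontr)
  assume "v \<noteq> 0"
  have "(e ^^ n) v \<noteq> 0" for n
  proof (induction n)
    case (Suc n)
    have "(int n + 1) * (\<mu> + int n) \<noteq> 0" using \<open>\<mu> > 0\<close> by simp
    then have "f ((e ^^ Suc n) v) \<noteq> 0"
      using Suc unfolding f_e_pow[OF v(1,2)]
      by (simp only: fv.scale_eq_0_iff of_int_eq_0_iff neg_equal_0_iff_equal) simp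
    then show ?case using lin_on_zero[OF D lin(2)] by metis
  qed (simp add: \<open>v \<noteq> 0\<close>)
  then show False using e_pow_nilpotent[OF v(1)] by blast
qed

lemma hw_nonneg:
  assumes v: "v \<in> wt \<mu>" "e v = 0" "v \<noteq> 0"
  shows "\<mu> \<ge> 0"
  using f_e_zero_neg[of v \<mu>] assms lin_on_zero[OF D lin(2)] by force

lemma hw_e_f_pow:
  assumes "v \<in> wt (int c)" "e v = 0"
  shows "e ((f ^^ Suc n) v) = vsmul (of_int ((int n + 1) * (int c - int n))) ((f ^^ n) v)"
proof -
  show ?thesis using e_f_pow[OF assms(1), of n] assms(2) pow_zero(2)[of "Suc n"] by simp
qed

text \<open>At n = c the coefficient c - n vanishes, so \<open>(f ^^ Suc c) v\<close> is killed by
  \<open>e\<close>. Its weight is -c - 2, and a nonzero highest weight vector cannot have negative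
  weight.\<close>

lemma hw_f_pow_zero:
  assumes v: "v \<in> wt (int c)" "e v = 0" and n: "n > c"
  shows "(f ^^ n) v = 0"
proof -
  have "e ((f ^^ Suc c) v) = 0" using hw_e_f_pow[OF v] by simp
  moreover have "(f ^^ Suc c) v \<in> wt (int c - 2 * int (Suc c))" by (rule f_pow_wt[OF v(1)])
  ultimately have z: "(f ^^ Suc c) v = 0"
    using hw_nonneg by fastforce
  have "(f ^^ (k + Suc c)) v = 0" for k
    unfolding funpow_add comp_apply z by (rule pow_zero)
  from this[of "n - Suc c"] show ?thesis using n by simp
qed

end

context sl2_module
begin

lemma hw_e_pow_f_pow_less:
  assumes v: "v \<in> wt (int c)" "e v = 0" and "k < n"
  shows "(e ^^ n) ((f ^^ k) v) = 0"
  using \<open>k < n\<close>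
proof (induction n arbitrary: k)
  case (Suc n)
  show ?case
  proof (cases k)
    case 0
    then show ?thesis using v(2) pow_zero(1) by (simp add: funpow_Suc_right del: funpow.simps)
  next
    case (Suc j)
    have "(e ^^ Suc n) ((f ^^ k) v) = (e ^^ n) (e ((f ^^ Suc j) v))"
      unfolding Suc by (simp add: funpow_Suc_right del: funpow.simps)
    also have "\<dots> = vsmul (of_int ((int j + 1) * (int c - int j))) ((e ^^ n) ((f ^^ j) v))"
      unfolding hw_e_f_pow[OF v] using v
      by (subst lin_on_smul[OF D e_pow_lin]) (auto simp: pow_closed wt_def)
    also have "(e ^^ n) ((f ^^ j) v) = 0" using Suc Suc.prems by (intro Suc.IH) simp
    finally show ?thesis by simp
  qed
qed simp

lemma hw_e_pow_f_pow:
  assumes v: "v \<in> wt (int c)" "e v = 0" and "n \<le> c"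
  obtains \<gamma> where "\<gamma> \<noteq> 0" "(e ^^ n) ((f ^^ n) v) = vsmul \<gamma> v"
proof -
  have "\<exists>\<gamma>. \<gamma> \<noteq> 0 \<and> (e ^^ n) ((f ^^ n) v) = vsmul \<gamma> v"
    using \<open>n \<le> c\<close>
  proof (induction n)
    case 0
    then show ?case by (intro exI[of _ 1]) simp
  next
    case (Suc n)
    then obtain \<gamma> where \<gamma>: "\<gamma> \<noteq> 0" "(e ^^ n) ((f ^^ n) v) = vsmul \<gamma> v" by auto
    have "(e ^^ Suc n) ((f ^^ Suc n) v) = (e ^^ n) (e ((f ^^ Suc n) v))"
      by (simp only: funpow_Suc_right comp_apply)
    also have "\<dots> = vsmul (of_int ((int n + 1) * (int c - int n))) (vsmul \<gamma> v)"
      unfolding hw_e_f_pow[OF v] using v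
      by (subst lin_on_smul[OF D e_pow_lin]) (auto simp: pow_closed wt_def \<gamma>)
    finally have "(e ^^ Suc n) ((f ^^ Suc n) v)
      = vsmul (of_int ((int n + 1) * (int c - int n)) * \<gamma>) v" by simp
    moreover have "of_int ((int n + 1) * (int c - int n)) * \<gamma> \<noteq> 0"
      using \<gamma> Suc.prems by (simp only: mult_eq_0_iff of_int_eq_0_iff) simp
    ultimately show ?case by blast
  qed
  then show ?thesis using that by blast
qed

end

text \<open>Complete reducibility is obtained without Weyl's theorem: modulo the span \<open>G\<close> of the strings
  \<open>f\<^sup>k u\<^sub>c\<close>, a vector \<open>v\<close> with \<open>e v \<in> G\<close> can be corrected so that \<open>f (e v) = 0\<close>; each weight component of
  the corrected vector is then either zero (negative weight) or a highest weight vector.\<close>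

locale hw_family = sl2_module D e f h N
  for D :: "('i \<Rightarrow> 'a::field_char_0) set" and e f h N +
  fixes R :: "('i \<Rightarrow> 'a) set" and W :: "nat set" and u :: "nat \<Rightarrow> 'i \<Rightarrow> 'a"
  assumes R: "stable R" and finW: "finite W"
    and hw: "c \<in> W \<Longrightarrow> u c \<in> R" "c \<in> W \<Longrightarrow> u c \<noteq> 0" "c \<in> W \<Longrightarrow> e (u c) = 0"
      "c \<in> W \<Longrightarrow> u c \<in> wt (int c)"
    and hw_complete: "v \<in> R \<Longrightarrow> e v = 0 \<Longrightarrow> v \<in> wt \<mu> \<Longrightarrow> v \<noteq> 0 \<Longrightarrow> \<exists>c\<in>W. \<exists>a. v = vsmul a (u c)"
begin

definition gens :: "('i \<Rightarrow> 'a) set" where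
  "gens = {(f ^^ k) (u c) | c k. c \<in> W}"

lemma span_gens_sub: "fv.span gens \<subseteq> R"
  by (rule fv.span_minimal) (auto simp: gens_def stableD(1)[OF R] pow_stable[OF R] hw)

lemma u_pow_D: "c \<in> W \<Longrightarrow> (f ^^ k) (u c) \<in> D"
  using hw(1) pow_stable(2)[OF R] stableD(2)[OF R] by blast

lemma f_e_zero_in_span:
  assumes v: "v \<in> R" "f (e v) = 0"
  shows "v \<in> fv.span gens"
proof -
  obtain w where w: "v = (\<Sum>\<mu>\<in>{-N..N}. w \<mu>)" "\<And>\<mu>. w \<mu> \<in> wt \<mu>"
    "\<And>\<mu>. \<mu> \<in> {-N..N} \<Longrightarrow> w \<mu> \<in> R"
    using wt_decomp_stable[OF R v(1)] by blast
  have fe: "f (e v) = (\<Sum>\<mu>\<in>{-N..N}. f (e (w \<mu>)))"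
    unfolding w(1) using w(2)
    by (subst lin_on_sum[OF D lin(1)], simp add: wt_def, subst lin_on_sum[OF D lin(2)])
      (auto simp: wt_def closed)
  have fe_wt: "f (e (w \<mu>)) \<in> wt \<mu>" for \<mu>
    using f_wt[OF e_wt[OF w(2)]] by simp
  have "w \<mu> \<in> fv.span gens" if \<mu>: "\<mu> \<in> {-N..N}" for \<mu>
  proof -
    have fe0: "f (e (w \<mu>)) = 0"
      using wt_indep[of "{-N..N}" "\<lambda>\<mu>. f (e (w \<mu>))" \<mu>] fe_wt fe v(2) \<mu> by simp
    consider "\<mu> < 0" | "\<mu> \<ge> 0" by linarith
    then show ?thesis
    proof cases
      case 1
      then have "w \<mu> = 0" using f_e_zero_neg[OF w(2) fe0] by simp
      then show ?thesis by (simp add: fv.span_zero)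
    next
      case 2
      then have e0: "e (w \<mu>) = 0" using f_zero_pos[OF e_wt[OF w(2)] fe0] by simp
      show ?thesis
      proof (cases "w \<mu> = 0")
        case False
        then obtain c a where "c \<in> W" "w \<mu> = vsmul a (u c)"
          using hw_complete[OF w(3)[OF \<mu>] e0 w(2)] by blast
        moreover have "(f ^^ 0) (u c) \<in> gens" using \<open>c \<in> W\<close> unfolding gens_def by blast
        then have "u c \<in> gens" by simp
        ultimately show ?thesis by (simp add: fv.span_base fv.span_scale)
      qed (simp add: fv.span_zero)
    qed
  qed
  then show ?thesis unfolding w(1) by (rule fv.span_sum)
qed

lemma span_gens_D: "v \<in> fv.span gens \<Longrightarrow> v \<in> D"
  using span_gens_sub stableD(2)[OF R] by blast

text \<open>Supplies the correction term for \<open>in_span_gensI\<close>. On the string of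
  \<open>u c\<close>, \<open>e\<close> hits every vector up to scalars except the last one; that one
  is killed by \<open>f\<close>, so equality holds once \<open>f\<close> is applied on both
  sides.\<close>

lemma span_gens_lift: "g \<in> fv.span gens \<Longrightarrow> g \<in> D \<and> (\<exists>g'\<in>fv.span gens. f (e g') = f g)"
proof (induction rule: fv.span_induct_alt)
  case base
  then show ?case
    by (auto simp: fv.span_zero fv.subspace_0[OF D] lin_on_zero[OF D lin(1)] intro!: bexI[of _ 0])
next
  case (step a x y)
  then obtain y' where y': "y' \<in> fv.span gens" "f (e y') = f y" "y \<in> D" by blast
  obtain c k where x: "c \<in> W" "x = (f ^^ k) (u c)" using step(1) by (auto simp: gens_def)
  have "\<exists>x'\<in>fv.span gens. f (e x') = f x"
  proof (cases "k < c")
    case True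
    define \<gamma> where "\<gamma> = (of_int ((int k + 1) * (int c - int k)) :: 'a)"
    have "\<gamma> \<noteq> 0" unfolding \<gamma>_def using True by (simp only: of_int_eq_0_iff) simp
    then have "e (vsmul (inverse \<gamma>) ((f ^^ Suc k) (u c))) = x"
      using x by (subst lin_on_smul[OF D lin(1) u_pow_D])
        (simp_all only: hw_e_f_pow[OF hw(4,3)] fv.scale_scale flip: \<gamma>_def, simp)
    moreover have "(f ^^ Suc k) (u c) \<in> gens" unfolding gens_def using x(1) by blast
    ultimately show ?thesis by (metis fv.span_base fv.span_scale)
  next
    case False
    then have "(f ^^ Suc k) (u c) = 0" by (intro hw_f_pow_zero[OF hw(4,3)]) (use x in auto)
    then have "f x = 0" using x by simp
    then show ?thesis
      by (intro bexI[of _ 0]) (auto simp: fv.span_zero lin_on_zero[OF D lin(1)] lin_on_zero[OF D lin(2)])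
  qed
  then obtain x' where x': "x' \<in> fv.span gens" "f (e x') = f x" by blast
  have D': "x \<in> D" "y \<in> D" "x' \<in> D" "y' \<in> D"
    using x' y' span_gens_D[of x'] span_gens_D[of y'] x u_pow_D by auto
  have "f (e (vsmul a x' + y')) = f (vsmul a x + y)"
    using D' x' y' by (simp add: lin_on_add[OF D lin(1)] lin_on_add[OF D lin(2)]
        lin_on_smul[OF D lin(1)] lin_on_smul[OF D lin(2)] fv.subspace_scale[OF D] closed)
  then show ?case
    using x' y' D' by (auto intro!: bexI[of _ "vsmul a x' + y'"] fv.span_add fv.span_scale
        fv.subspace_add[OF D] fv.subspace_scale[OF D])
qed

text \<open>Subtracting the lift \<open>g'\<close> of \<open>e v\<close> leaves a vector killed by f
  e, for which the weight-by-weight argument of \<open>f_e_zero_in_span\<close> applies.\<close>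

lemma in_span_gensI:
  assumes v: "v \<in> R" "e v \<in> fv.span gens"
  shows "v \<in> fv.span gens"
proof -
  obtain g' where g': "g' \<in> fv.span gens" "f (e g') = f (e v)"
    using span_gens_lift[OF v(2)] by blast
  have g'R: "g' \<in> R" using g' span_gens_sub by blast
  have "f (e (v - g')) = 0"
    using g' stableD(2)[OF R] v g'R
    by (simp add: lin_on_diff[OF D lin(1)] lin_on_diff[OF D lin(2)] closed)
  then have "v - g' \<in> fv.span gens"
    using v g'R by (intro f_e_zero_in_span) (auto intro: fv.subspace_diff[OF stableD(1)[OF R]])
  then show ?thesis using fv.span_add[OF _ g'(1)] by fastforce
qed

lemma span_gens_eq: "R = fv.span gens"
proof
  show "R \<subseteq> fv.span gens"
  proof
    fix v assume v: "v \<in> R"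
    obtain w where w: "v = (\<Sum>\<mu>\<in>{-N..N}. w \<mu>)" "\<And>\<mu>. w \<mu> \<in> wt \<mu>"
      "\<And>\<mu>. \<mu> \<in> {-N..N} \<Longrightarrow> w \<mu> \<in> R"
      using wt_decomp_stable[OF R v] by blast
    \<comment> \<open>Induction on the order of nilpotency: \<open>e x\<close> is in the span by the
      hypothesis, and \<open>in_span_gensI\<close> pulls this back to \<open>x\<close>.\<close>
    have nil: "x \<in> fv.span gens" if "x \<in> R" "(e ^^ n) x = 0" for n x
      using that
    proof (induction n arbitrary: x)
      case (Suc n)
      have "(e ^^ n) (e x) = 0" using Suc.prems by (simp add: funpow_Suc_right del: funpow.simps)
      then have "e x \<in> fv.span gens" using Suc.IH[of "e x"] Suc.prems stableD(3)[OF R] by blast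
      then show ?case using in_span_gensI Suc.prems by blast
    qed (simp add: fv.span_zero)
    show "v \<in> fv.span gens"
      unfolding w(1) using nil w(3) e_pow_nilpotent[OF w(2)] by (blast intro: fv.span_sum)
  qed
qed (rule span_gens_sub)

section \<open>The isomorphism with a direct sum of standard modules\<close>

definition comb :: "nat list \<Rightarrow> (nat \<times> nat \<Rightarrow> 'a) \<Rightarrow> 'i \<Rightarrow> 'a" where
  "comb cs d = (\<Sum>j<length cs. \<Sum>k\<le>cs ! j. vsmul (d (j, k)) ((f ^^ k) (u (cs ! j))))"

lemma weight_unique:
  assumes "v \<in> wt \<mu>" "v \<in> wt \<nu>" "v \<noteq> 0" shows "\<mu> = \<nu>"
proof -
  have "vsmul (of_int \<mu>) v = vsmul (of_int \<nu>) v" using assms by (auto simp: wt_def)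
  then show ?thesis using assms(3) by (simp add: fv.scale_cancel_right)
qed

lemma u_indep:
  assumes "(\<Sum>c\<in>W. vsmul (a c) (u c)) = 0" "c \<in> W"
  shows "a c = 0"
proof -
  have "(\<Sum>\<mu>\<in>int ` W. vsmul (a (nat \<mu>)) (u (nat \<mu>))) = 0"
    using assms(1) by (subst sum.reindex) auto
  then have "vsmul (a (nat (int c))) (u (nat (int c))) = 0"
    by (rule wt_indep[of "int ` W" "\<lambda>\<mu>. vsmul (a (nat \<mu>)) (u (nat \<mu>))", rotated 2])
      (use finW assms hw(4) in \<open>auto intro!: fv.subspace_scale[OF wt_subspace]\<close>)
  then show ?thesis using hw(2)[OF assms(2)] by simp
qed

text \<open>Coefficients are eliminated from the largest exponent downwards. If all those with k > K
  vanish, \<open>e ^^ K\<close> kills the terms with k < K and turns the terms with k = K into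
  nonzero multiples of the \<open>u c\<close>, which are independent because their weights differ.
  The induction variable \<open>K\<close> is a bound from which on the coefficients are known to
  vanish, so the induction descends.\<close>

lemma gens_indep:
  assumes "(\<Sum>c\<in>W. \<Sum>k\<le>c. vsmul (d c k) ((f ^^ k) (u c))) = 0"
  shows "\<forall>c\<in>W. \<forall>k\<le>c. d c k = 0"
proof -
  have "\<forall>c\<in>W. \<forall>k\<le>c. d c k = 0" if "\<forall>c\<in>W. \<forall>k\<le>c. K \<le> k \<longrightarrow> d c k = 0" for K
    using that
  proof (induction K)
    case (Suc K)
    have e: "(e ^^ K) (vsmul (d c k) ((f ^^ k) (u c))) = 0"
      if "c \<in> W" "k \<le> c" "k \<noteq> K" for c k
    proof (cases "k < K")
      case True
      then show ?thesis
        using that by (simp add: lin_on_smul[OF D e_pow_lin u_pow_D] hw_e_pow_f_pow_less[OF hw(4,3)])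
    next
      case False
      then show ?thesis using that Suc.prems pow_zero by simp
    qed
    have "\<exists>\<gamma>. \<gamma> \<noteq> 0 \<and> (e ^^ K) ((f ^^ K) (u c)) = vsmul \<gamma> (u c)" if "c \<in> W" "K \<le> c" for c
      using hw_e_pow_f_pow[OF hw(4,3) that(2)] that by metis
    then obtain \<gamma> where \<gamma>: "\<And>c. c \<in> W \<Longrightarrow> K \<le> c \<Longrightarrow> \<gamma> c \<noteq> 0"
      "\<And>c. c \<in> W \<Longrightarrow> K \<le> c \<Longrightarrow> (e ^^ K) ((f ^^ K) (u c)) = vsmul (\<gamma> c) (u c)" by metis
    have "(\<Sum>c\<in>W. vsmul (if K \<le> c then d c K * \<gamma> c else 0) (u c))
      = (\<Sum>c\<in>W. \<Sum>k\<le>c. (e ^^ K) (vsmul (d c k) ((f ^^ k) (u c))))"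
    proof (rule sum.cong[OF refl])
      fix c assume c: "c \<in> W"
      have "(\<Sum>k\<le>c. (e ^^ K) (vsmul (d c k) ((f ^^ k) (u c))))
        = (\<Sum>k\<in>{..c} \<inter> {K}. (e ^^ K) (vsmul (d c k) ((f ^^ k) (u c))))"
        using c e by (intro sum.mono_neutral_right) auto
      also have "\<dots> = vsmul (if K \<le> c then d c K * \<gamma> c else 0) (u c)"
        using c \<gamma> by (auto simp: lin_on_smul[OF D e_pow_lin u_pow_D])
      finally show "vsmul (if K \<le> c then d c K * \<gamma> c else 0) (u c)
        = (\<Sum>k\<le>c. (e ^^ K) (vsmul (d c k) ((f ^^ k) (u c))))" by simp
    qed
    also have "\<dots> = (e ^^ K) (\<Sum>c\<in>W. \<Sum>k\<le>c. vsmul (d c k) ((f ^^ k) (u c)))"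
      using u_pow_D by (simp add: lin_on_sum[OF D e_pow_lin] fv.subspace_sum[OF D] fv.subspace_scale[OF D])
    also have "\<dots> = 0" using assms pow_zero by simp
    finally have "(if K \<le> c then d c K * \<gamma> c else 0) = 0" if "c \<in> W" for c
      by (rule u_indep) (rule that)
    then have "\<forall>c\<in>W. \<forall>k\<le>c. K \<le> k \<longrightarrow> d c k = 0"
      using \<gamma>(1) Suc.prems by (metis le_antisym mult_eq_0_iff not_less_eq_eq)
    then show ?case by (rule Suc.IH)
  qed simp
  \<comment> \<open>The sum over \<open>W\<close> is a crude upper bound for each of its elements,
    so from its successor on there is no coefficient to consider.\<close>
  moreover have "\<forall>c\<in>W. \<forall>k\<le>c. Suc (\<Sum>c\<in>W. c) \<le> k \<longrightarrow> d c k = 0"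
    using member_le_sum[of _ W "\<lambda>c. c"] finW by fastforce
  ultimately show ?thesis by blast
qed

text \<open>Coordinates in \<open>ds_vecs\<close> are indexed by list positions, the family by
  weights; distinctness of \<open>cs\<close> gives the translation \<open>i\<close> from weights to
  positions.\<close>

lemma comb_eq:
  assumes "distinct cs" "set cs = W"
  shows "\<exists>i. (\<forall>j<length cs. i (cs ! j) = j) \<and>
    (\<forall>d. comb cs d = (\<Sum>c\<in>W. \<Sum>k\<le>c. vsmul (d (i c, k)) ((f ^^ k) (u c)))) \<and>
    (\<forall>c\<in>W. i c < length cs \<and> cs ! i c = c)"
proof -
  have bij: "bij_betw (\<lambda>j. cs ! j) {..<length cs} W"
    using assms bij_betw_nth by blast
  define i where "i = the_inv_into {..<length cs} (\<lambda>j. cs ! j)"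
  have i: "i (cs ! j) = j" if "j < length cs" for j
    unfolding i_def using bij that by (intro the_inv_into_f_f) (auto simp: bij_betw_def)
  have "comb cs d = (\<Sum>c\<in>W. \<Sum>k\<le>c. vsmul (d (i c, k)) ((f ^^ k) (u c)))" for d
    unfolding comb_def using i by (subst sum.reindex_bij_betw[OF bij, symmetric]) auto
  moreover have "i c < length cs \<and> cs ! i c = c" if "c \<in> W" for c
    using i that assms(2) by (metis in_set_conv_nth)
  ultimately show ?thesis using i by blast
qed

lemma comb_inj:
  assumes "distinct cs" "set cs = W"
  shows "inj_on (comb cs) (ds_vecs cs)"
proof (rule inj_onI)
  fix x y assume xy: "x \<in> ds_vecs cs" "y \<in> ds_vecs cs" "comb cs x = comb cs y"
  obtain i where i: "\<And>j. j < length cs \<Longrightarrow> i (cs ! j) = j"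
    "\<And>d. comb cs d = (\<Sum>c\<in>W. \<Sum>k\<le>c. vsmul (d (i c, k)) ((f ^^ k) (u c)))"
    using comb_eq[OF assms] by blast
  have "(\<Sum>c\<in>W. \<Sum>k\<le>c. vsmul (x (i c, k) - y (i c, k)) ((f ^^ k) (u c))) = 0"
    using xy(3) unfolding i(2) by (simp add: fv.scale_left_diff_distrib sum_subtractf)
  then have z: "\<forall>c\<in>W. \<forall>k\<le>c. x (i c, k) - y (i c, k) = 0" by (rule gens_indep)
  show "x = y"
  proof (rule ext, clarify)
    fix j k
    show "x (j, k) = y (j, k)"
    proof (cases "j < length cs \<and> k \<le> cs ! j")
      case True
      then have "cs ! j \<in> W" using assms(2) by auto
      then show ?thesis using z i(1)[of j] True by auto
    qed (use xy in \<open>auto simp: ds_vecs_def vecs_def\<close>)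
  qed
qed

lemma comb_range:
  assumes "distinct cs" "set cs = W"
  shows "comb cs ` ds_vecs cs = R"
proof
  show "comb cs ` ds_vecs cs \<subseteq> R"
    unfolding comb_def using assms hw(1) pow_stable(2)[OF R]
    by (auto intro!: fv.subspace_sum fv.subspace_scale stableD(1)[OF R])
  obtain i where i: "\<And>j. j < length cs \<Longrightarrow> i (cs ! j) = j"
    "\<And>d. comb cs d = (\<Sum>c\<in>W. \<Sum>k\<le>c. vsmul (d (i c, k)) ((f ^^ k) (u c)))"
    "\<And>c. c \<in> W \<Longrightarrow> i c < length cs \<and> cs ! i c = c"
    using comb_eq[OF assms] by blast
  have lin: "comb cs (vsmul a x + y) = vsmul a (comb cs x) + comb cs y" for a x y
    unfolding comb_def
    by (simp add: fun_apply fv.scale_left_distrib sum.distrib fv.scale_sum_right)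
  have "x \<in> comb cs ` ds_vecs cs" if "x \<in> fv.span gens" for x
    using that
  proof (induction rule: fv.span_induct_alt)
    case base
    have "comb cs 0 = 0" by (simp add: comb_def fun_apply)
    then show ?case by (intro image_eqI[of _ _ 0]) (auto simp: ds_vecs_def fv.subspace_0)
  next
    case (step a x y)
    obtain c k where x: "c \<in> W" "x = (f ^^ k) (u c)" using step(1) by (auto simp: gens_def)
    obtain d where d: "d \<in> ds_vecs cs" "comb cs d = y" using step(2) by auto
    obtain d' where d': "d' \<in> ds_vecs cs" "comb cs d' = x"
    proof (cases "k \<le> c")
      case True
      define d' where "d' = (\<lambda>p. if p = (i c, k) then 1 else 0 :: 'a)"
      have "comb cs d' = (\<Sum>c'\<in>W. \<Sum>k'\<le>c'. if c' = c \<and> k' = k then (f ^^ k) (u c) else 0)"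
        unfolding i(2) d'_def
      proof (intro sum.cong refl)
        fix c' k' assume c': "c' \<in> W"
        have "i c' = i c \<longleftrightarrow> c' = c" using i(3)[OF c'] i(3)[OF x(1)] by metis
        then show "vsmul (if (i c', k') = (i c, k) then 1 else 0) ((f ^^ k') (u c'))
          = (if c' = c \<and> k' = k then (f ^^ k) (u c) else 0)" by auto
      qed
      also have "\<dots> = (\<Sum>c'\<in>W. if c' = c then (f ^^ k) (u c) else 0)"
        using True by (intro sum.cong) (auto simp: sum.delta)
      also have "\<dots> = x" using x finW by (simp add: sum.delta)
      finally have "comb cs d' = x" .
      moreover have "d' \<in> ds_vecs cs"
        using i(3)[OF x(1)] True by (auto simp: d'_def ds_vecs_def vecs_def)
      ultimately show ?thesis using that by blast
    next
      case False
      then have "x = 0" using hw_f_pow_zero[OF hw(4,3)] x by simp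
      moreover have "comb cs 0 = 0" by (simp add: comb_def fun_apply)
      ultimately show ?thesis using that[of 0] by (simp add: ds_vecs_def fv.subspace_0)
    qed
    have "vsmul a d' + d \<in> ds_vecs cs"
      using d d' by (auto simp: ds_vecs_def intro: fv.subspace_add fv.subspace_scale)
    then show ?case using lin d d' by (metis image_eqI)
  qed
  then show "R \<subseteq> comb cs ` ds_vecs cs" using span_gens_eq by blast
qed

lemma nth_u_pow_D: "set cs \<subseteq> W \<Longrightarrow> j < length cs \<Longrightarrow> (f ^^ k) (u (cs ! j)) \<in> D"
  using u_pow_D nth_mem by blast

lemma lin_on_comb:
  assumes g: "lin_on D g" and "set cs \<subseteq> W"
  shows "g (comb cs d)
    = (\<Sum>j<length cs. \<Sum>k\<le>cs ! j. vsmul (d (j, k)) (g ((f ^^ k) (u (cs ! j)))))"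
proof -
  have D': "vsmul (d (j, k)) ((f ^^ k) (u (cs ! j))) \<in> D" if "j \<in> {..<length cs}" for j k
    using nth_u_pow_D[OF assms(2)] that by (intro fv.subspace_scale[OF D]) auto
  have "g (comb cs d) = (\<Sum>j<length cs. g (\<Sum>k\<le>cs ! j. vsmul (d (j, k)) ((f ^^ k) (u (cs ! j)))))"
    unfolding comb_def by (rule lin_on_sum[OF D g]) (rule fv.subspace_sum[OF D D'])
  also have "\<dots> = (\<Sum>j<length cs. \<Sum>k\<le>cs ! j. g (vsmul (d (j, k)) ((f ^^ k) (u (cs ! j)))))"
    by (rule sum.cong[OF refl]) (rule lin_on_sum[OF D g D'])
  also have "\<dots> = (\<Sum>j<length cs. \<Sum>k\<le>cs ! j. vsmul (d (j, k)) (g ((f ^^ k) (u (cs ! j)))))"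
    using nth_u_pow_D[OF assms(2)] by (intro sum.cong refl lin_on_smul[OF D g]) auto
  finally show ?thesis .
qed

lemma comb_e:
  assumes "set cs \<subseteq> W"
  shows "comb cs (ds_act cs E d) = e (comb cs d)"
proof -
  have "e (comb cs d) = (\<Sum>j<length cs. \<Sum>k\<le>cs ! j. vsmul (d (j, k)) (e ((f ^^ k) (u (cs ! j)))))"
    by (rule lin_on_comb[OF lin(1) assms])
  also have "\<dots> = comb cs (ds_act cs E d)"
    unfolding comb_def
  proof (rule sum.cong[OF refl])
    fix j assume j: "j \<in> {..<length cs}"
    define c where "c = cs ! j"
    have c: "c \<in> W" using assms j by (auto simp: c_def)
    have "(\<Sum>k\<le>c. vsmul (d (j, k)) (e ((f ^^ k) (u c))))
      = (\<Sum>k<c. vsmul (d (j, Suc k)) (e ((f ^^ Suc k) (u c))))"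
      using hw(3)[OF c] by (simp add: sum.atMost_shift)
    also have "\<dots> = (\<Sum>k<c. vsmul (ds_act cs E d (j, k)) ((f ^^ k) (u c)))"
    proof (rule sum.cong[OF refl])
      fix k assume "k \<in> {..<c}"
      then have "of_int ((int k + 1) * (int c - int k)) = (of_nat ((k + 1) * (c - k)) :: 'a)"
        by (intro of_int_raising) simp
      then show "vsmul (d (j, Suc k)) (e ((f ^^ Suc k) (u c)))
        = vsmul (ds_act cs E d (j, k)) ((f ^^ k) (u c))"
        using j \<open>k \<in> {..<c}\<close> unfolding hw_e_f_pow[OF hw(4,3)[OF c]]
        by (simp only: ds_act_def Vact_def gmb.case fv.scale_scale c_def[symmetric] lessThan_iff
            if_True split_conv Suc_eq_plus1 mult.commute)
    qed
    also have "\<dots> = (\<Sum>k\<le>c. vsmul (ds_act cs E d (j, k)) ((f ^^ k) (u c)))"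
      by (simp add: ds_act_def Vact_def c_def flip: lessThan_Suc_atMost)
    finally show "(\<Sum>k\<le>cs ! j. vsmul (d (j, k)) (e ((f ^^ k) (u (cs ! j)))))
      = (\<Sum>k\<le>cs ! j. vsmul (ds_act cs E d (j, k)) ((f ^^ k) (u (cs ! j))))"
      by (simp add: c_def)
  qed
  finally show ?thesis by simp
qed

lemma comb_f:
  assumes "set cs \<subseteq> W"
  shows "comb cs (ds_act cs F d) = f (comb cs d)"
proof -
  have "f (comb cs d) = (\<Sum>j<length cs. \<Sum>k\<le>cs ! j. vsmul (d (j, k)) (f ((f ^^ k) (u (cs ! j)))))"
    by (rule lin_on_comb[OF lin(2) assms])
  also have "\<dots> = comb cs (ds_act cs F d)"
    unfolding comb_def
  proof (rule sum.cong[OF refl])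
    fix j assume j: "j \<in> {..<length cs}"
    define c where "c = cs ! j"
    have c: "c \<in> W" using assms j by (auto simp: c_def)
    have "f ((f ^^ c) (u c)) = 0" using hw_f_pow_zero[OF hw(4,3)[OF c], of "Suc c"] by simp
    then have "(\<Sum>k\<le>c. vsmul (d (j, k)) (f ((f ^^ k) (u c))))
      = (\<Sum>k<c. vsmul (d (j, k)) (f ((f ^^ k) (u c))))"
      by (simp flip: lessThan_Suc_atMost)
    also have "\<dots> = (\<Sum>k\<le>c. vsmul (ds_act cs F d (j, k)) ((f ^^ k) (u c)))"
      unfolding sum.atMost_shift using j by (auto simp: ds_act_def Vact_def c_def intro!: sum.cong)
    finally show "(\<Sum>k\<le>cs ! j. vsmul (d (j, k)) (f ((f ^^ k) (u (cs ! j)))))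
      = (\<Sum>k\<le>cs ! j. vsmul (ds_act cs F d (j, k)) ((f ^^ k) (u (cs ! j))))"
      by (simp add: c_def)
  qed
  finally show ?thesis by simp
qed

lemma comb_h:
  assumes "set cs \<subseteq> W"
  shows "comb cs (ds_act cs H d) = h (comb cs d)"
proof -
  have "h (comb cs d) = (\<Sum>j<length cs. \<Sum>k\<le>cs ! j. vsmul (d (j, k)) (h ((f ^^ k) (u (cs ! j)))))"
    by (rule lin_on_comb[OF lin(3) assms])
  also have "\<dots> = comb cs (ds_act cs H d)"
    unfolding comb_def
  proof (intro sum.cong refl)
    fix j k assume j: "j \<in> {..<length cs}" and k: "k \<in> {..cs ! j}"
    have "cs ! j \<in> W" using assms j by auto
    then have "h ((f ^^ k) (u (cs ! j))) = vsmul (of_int (int (cs ! j) - 2 * int k)) ((f ^^ k) (u (cs ! j)))"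
      using f_pow_wt[OF hw(4), of "cs ! j" k] by (simp add: wt_def)
    then show "vsmul (d (j, k)) (h ((f ^^ k) (u (cs ! j))))
      = vsmul (ds_act cs H d (j, k)) ((f ^^ k) (u (cs ! j)))"
      using j k by (simp add: ds_act_def Vact_def mult.commute)
  qed
  finally show ?thesis by simp
qed

lemma iso_onto:
  assumes "distinct cs" "set cs = W"
    and M: "D = vecs (car M)" "act M E = e" "act M F = f" "act M H = h"
  shows "sl2_iso_onto cs M R"
proof -
  have "lin_on (ds_vecs cs) (comb cs)"
    unfolding lin_on_def comb_def
    by (simp add: fun_apply fv.scale_left_distrib sum.distrib fv.scale_sum_right)
  then have "sl2_hom cs M (comb cs)"
    unfolding sl2_hom_def using assms comb_range[OF assms(1,2)] stableD(2)[OF R] comb_e comb_f comb_h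
    by auto
  then show ?thesis
    unfolding sl2_iso_onto_def using comb_inj[OF assms(1,2)] comb_range[OF assms(1,2)] by blast
qed

text \<open>Two copies of V(c) would contain two independent highest weight vectors of weight c, but
  inside \<open>R\<close> both are multiples of \<open>u c\<close>. Multiplying crosswise by the two
  scalars gives equal images of different vectors.\<close>

lemma mult_free:
  assumes M: "D = vecs (car M)" "act M E = e" "act M F = f" "act M H = h"
  shows "sl2_mult_free M R"
  unfolding sl2_mult_free_def
proof (intro allI notI, elim exE conjE)
  fix c \<phi>
  assume hom: "sl2_hom [c, c] M \<phi>" and inj: "inj_on \<phi> (ds_vecs [c, c])"
    and im: "\<phi> ` ds_vecs [c, c] \<subseteq> R"
  define \<delta> :: "nat \<Rightarrow> nat \<times> nat \<Rightarrow> 'a" where "\<delta> j = (\<lambda>p. if p = (j, 0) then 1 else 0)" for j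
  have Y: "fv.subspace (ds_vecs [c, c] :: (nat \<times> nat \<Rightarrow> 'a) set)" by (simp add: ds_vecs_def)
  have lin\<phi>: "lin_on (ds_vecs [c, c]) \<phi>" using hom by (simp add: sl2_hom_def)
  have \<delta>: "\<delta> j \<in> ds_vecs [c, c]" if "j < 2" for j
    using that by (auto simp: \<delta>_def ds_vecs_def vecs_def less_2_cases_iff)
  have "\<exists>a. \<phi> (\<delta> j) = vsmul a (u c) \<and> a \<noteq> 0" if j: "j < 2" for j
  proof -
    have E0: "ds_act [c, c] E (\<delta> j) = 0" and H0: "ds_act [c, c] H (\<delta> j) = vsmul (of_int (int c)) (\<delta> j)"
      using j by (auto simp: ds_act_def Vact_def \<delta>_def fun_eq_iff fun_apply less_2_cases_iff nth_Cons')
    have "e (\<phi> (\<delta> j)) = \<phi> 0" "h (\<phi> (\<delta> j)) = \<phi> (vsmul (of_int (int c)) (\<delta> j))"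
      using hom \<delta>[OF j] M E0 H0 by (auto simp: sl2_hom_def)
    then have e0: "e (\<phi> (\<delta> j)) = 0" and h0: "h (\<phi> (\<delta> j)) = vsmul (of_int (int c)) (\<phi> (\<delta> j))"
      using lin_on_zero[OF Y lin\<phi>] lin_on_smul[OF Y lin\<phi> \<delta>[OF j]] by auto
    have inR: "\<phi> (\<delta> j) \<in> R" using im \<delta>[OF j] by blast
    then have wt: "\<phi> (\<delta> j) \<in> wt (int c)" using h0 stableD(2)[OF R] by (simp add: wt_def)
    have "\<delta> j (j, 0) \<noteq> 0" by (simp add: \<delta>_def)
    then have "\<delta> j \<noteq> 0" by (auto simp: fun_apply)
    then have nz: "\<phi> (\<delta> j) \<noteq> 0"
      using inj_onD[OF inj, of "\<delta> j" 0] \<delta>[OF j] lin_on_zero[OF Y lin\<phi>] fv.subspace_0[OF Y] by auto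
    obtain c' a where c': "c' \<in> W" "\<phi> (\<delta> j) = vsmul a (u c')"
      using hw_complete[OF inR e0 wt nz] by blast
    have "\<phi> (\<delta> j) \<in> wt (int c')" using c' hw(4) by (simp add: fv.subspace_scale[OF wt_subspace])
    then have "c' = c" using weight_unique[OF wt _ nz] by fastforce
    then show ?thesis using c' nz by auto
  qed
  from this[of 0] this[of 1] obtain a b where ab: "\<phi> (\<delta> 0) = vsmul a (u c)" "a \<noteq> 0"
    "\<phi> (\<delta> 1) = vsmul b (u c)" "b \<noteq> 0" by auto
  have "\<phi> (vsmul b (\<delta> 0)) = \<phi> (vsmul a (\<delta> 1))"
    using ab \<delta> by (simp add: lin_on_smul[OF Y lin\<phi>] mult.commute)
  then have "vsmul b (\<delta> 0) = vsmul a (\<delta> 1)"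
    using inj_onD[OF inj] \<delta> fv.subspace_scale[OF Y] by (metis one_less_numeral_iff semiring_norm(76) zero_less_numeral)
  then have "vsmul b (\<delta> 0) (0, 0) = vsmul a (\<delta> 1) (0, 0)" by simp
  then show False using ab by (simp add: \<delta>_def fun_apply)
qed

section \<open>Irreducibility of the strings\<close>

definition string :: "nat \<Rightarrow> ('i \<Rightarrow> 'a) set" where
  "string c = fv.span {(f ^^ k) (u c) | k. True}"

lemma string_sub: "c \<in> W \<Longrightarrow> string c \<subseteq> R"
  unfolding string_def span_gens_eq gens_def by (rule fv.span_mono) auto

lemma string_stable:
  assumes c: "c \<in> W"
  shows "stable (string c)"
proof -
  have sub: "fv.subspace (string c)" by (simp add: string_def)
  have D': "string c \<subseteq> D" using string_sub[OF c] stableD(2)[OF R] by blast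
  have gen: "(f ^^ k) (u c) \<in> string c" for k
    unfolding string_def by (rule fv.span_base) blast
  have ind: "g v \<in> string c"
    if "lin_on D g" "\<And>k. g ((f ^^ k) (u c)) \<in> string c" "v \<in> string c" for g v
  proof -
    have "fv.span {(f ^^ k) (u c) | k. True} \<subseteq> {v \<in> D. g v \<in> string c}"
      by (rule fv.span_minimal) (use that(2) u_pow_D[OF c] subspace_lin_preimage[OF D that(1) sub] in auto)
    then show ?thesis using that(3) by (auto simp: string_def)
  qed
  have "e ((f ^^ k) (u c)) \<in> string c" for k
  proof (cases k)
    case 0
    then show ?thesis using hw(3)[OF c] fv.subspace_0[OF sub] by simp
  next
    case (Suc j)
    show ?thesis
      unfolding Suc hw_e_f_pow[OF hw(4,3)[OF c]] by (rule fv.subspace_scale[OF sub gen])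
  qed
  moreover have "f ((f ^^ k) (u c)) \<in> string c" for k
    using gen[of "Suc k"] by simp
  moreover have "h ((f ^^ k) (u c)) \<in> string c" for k
    using f_pow_wt[OF hw(4)[OF c], of k] fv.subspace_scale[OF sub gen] by (simp add: wt_def)
  ultimately show ?thesis
    unfolding stable_def using sub D' ind lin by blast
qed

lemma string_explicit:
  assumes c: "c \<in> W" and v: "v \<in> string c"
  shows "\<exists>d. v = (\<Sum>k\<le>c. vsmul (d k) ((f ^^ k) (u c)))"
  using v unfolding string_def
proof (induction rule: fv.span_induct_alt)
  case base
  show ?case by (intro exI[of _ "\<lambda>_. 0"]) simp
next
  case (step a x y)
  then obtain k d where kd: "x = (f ^^ k) (u c)" "y = (\<Sum>k\<le>c. vsmul (d k) ((f ^^ k) (u c)))" by auto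
  show ?case
  proof (cases "k \<le> c")
    case True
    have "vsmul a x + y
      = (\<Sum>i\<le>c. (if i = k then vsmul a x else 0) + vsmul (d i) ((f ^^ i) (u c)))"
      using True kd(2) by (simp add: sum.distrib)
    also have "\<dots> = (\<Sum>i\<le>c. vsmul ((if i = k then a else 0) + d i) ((f ^^ i) (u c)))"
      using kd(1) by (intro sum.cong) (auto simp: fv.scale_left_distrib)
    finally show ?thesis by (intro exI)
  next
    case False
    then show ?thesis using hw_f_pow_zero[OF hw(4,3)[OF c], of k] kd by auto
  qed
qed

text \<open>With \<open>K\<close> the largest exponent occurring in a nonzero vector of
  \<open>S\<close>, \<open>e ^^ K\<close> leaves just a nonzero multiple of \<open>u c\<close>, and
  \<open>u c\<close> regenerates the string under \<open>f\<close>.\<close>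

lemma string_irreducible:
  assumes c: "c \<in> W" and S: "stable S" "S \<subseteq> string c" "S \<noteq> {0}"
  shows "S = string c"
proof -
  obtain v where v: "v \<in> S" "v \<noteq> 0" using S fv.subspace_0[OF stableD(1)[OF S(1)]] by blast
  then obtain d where d: "v = (\<Sum>k\<le>c. vsmul (d k) ((f ^^ k) (u c)))"
    using string_explicit[OF c] S(2) by blast
  define A where "A = {k. k \<le> c \<and> d k \<noteq> 0}"
  have "A \<noteq> {}"
  proof
    assume "A = {}"
    then have "v = 0" unfolding d A_def by (intro sum.neutral) auto
    then show False using v by blast
  qed
  moreover have finA: "finite A" by (simp add: A_def)
  ultimately have K: "Max A \<in> A" by simp
  define K where "K = Max A"
  have K: "K \<le> c" "d K \<noteq> 0" using K by (auto simp: A_def K_def)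
  have dK: "d k = 0" if "k > K" "k \<le> c" for k
    using that Max_ge[OF finA, of k] by (fastforce simp: A_def K_def)
  obtain \<gamma> where \<gamma>: "\<gamma> \<noteq> 0" "(e ^^ K) ((f ^^ K) (u c)) = vsmul \<gamma> (u c)"
    using hw_e_pow_f_pow[OF hw(4,3)[OF c] K(1)] by blast
  have "(e ^^ K) v = (\<Sum>k\<le>c. vsmul (d k) ((e ^^ K) ((f ^^ k) (u c))))"
    unfolding d using u_pow_D[OF c]
    by (simp add: lin_on_sum[OF D e_pow_lin] fv.subspace_scale[OF D] lin_on_smul[OF D e_pow_lin])
  also have "\<dots> = (\<Sum>k\<in>{K}. vsmul (d k) ((e ^^ K) ((f ^^ k) (u c))))"
  proof (rule sum.mono_neutral_right)
    show "\<forall>k\<in>{..c} - {K}. vsmul (d k) ((e ^^ K) ((f ^^ k) (u c))) = 0"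
    proof
      fix k assume "k \<in> {..c} - {K}"
      then show "vsmul (d k) ((e ^^ K) ((f ^^ k) (u c))) = 0"
        using dK[of k] hw_e_pow_f_pow_less[OF hw(4,3)[OF c], of k K] by (cases "k < K") auto
    qed
  qed (use K in auto)
  finally have eK: "(e ^^ K) v = vsmul (d K * \<gamma>) (u c)" by (simp add: \<gamma>)
  have "vsmul (inverse (d K * \<gamma>)) ((e ^^ K) v) \<in> S"
    using pow_stable(1)[OF S(1) v(1)] fv.subspace_scale[OF stableD(1)[OF S(1)]] by blast
  moreover have "vsmul (inverse (d K * \<gamma>)) ((e ^^ K) v) = u c"
    unfolding eK fv.scale_scale using K \<gamma> by (subst left_inverse) auto
  ultimately have "u c \<in> S" by simp
  then have "string c \<subseteq> S"
    unfolding string_def using pow_stable(2)[OF S(1)] stableD(1)[OF S(1)]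
    by (intro fv.span_minimal) auto
  then show ?thesis using S(2) by blast
qed

lemma string_nonzero: "c \<in> W \<Longrightarrow> string c \<noteq> {0}"
proof
  assume c: "c \<in> W" and eq: "string c = {0}"
  have "(f ^^ 0) (u c) \<in> string c" unfolding string_def by (rule fv.span_base) blast
  then show False using eq hw(2)[OF c] by simp
qed

end

section \<open>The socle as the space of \<open>r\<close>-invariants\<close>

locale graded_gm_module =
  fixes m :: nat and M :: "('a::field_char_0, 'i) gmod" and N :: int
    and Fil :: "nat \<Rightarrow> ('i \<Rightarrow> 'a) set" and L :: nat
  assumes gm: "gm_module m M"
    and weights: "v \<in> vecs (car M) \<Longrightarrow> \<exists>w. v = (\<Sum>\<mu>\<in>{-N..N}. w \<mu>) \<and>
      (\<forall>\<mu>. w \<mu> \<in> vecs (car M) \<and> act M H (w \<mu>) = vsmul (of_int \<mu>) (w \<mu>))"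
    and Fil_bot: "Fil 0 = {0}" and Fil_top: "vecs (car M) \<subseteq> Fil L"
    and Fil_step: "v \<in> Fil (Suc n) \<Longrightarrow> k \<le> m \<Longrightarrow> act M (X k) v \<in> Fil n"

lemma gm_moduleD:
  assumes "gm_module m M"
  shows "finite (car M)"
    "valid_gmb m b \<Longrightarrow> v \<in> vecs (car M) \<Longrightarrow> act M b v \<in> vecs (car M)"
    "valid_gmb m b \<Longrightarrow> lin_on (vecs (car M)) (act M b)"
    "v \<in> vecs (car M) \<Longrightarrow> act M H (act M E v) = act M E (act M H v) + vsmul 2 (act M E v)"
    "v \<in> vecs (car M) \<Longrightarrow> act M H (act M F v) = act M F (act M H v) - vsmul 2 (act M F v)"
    "v \<in> vecs (car M) \<Longrightarrow> act M E (act M F v) = act M F (act M E v) + act M H v"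
    "v \<in> vecs (car M) \<Longrightarrow> k \<le> m \<Longrightarrow> act M H (act M (X k) v)
      = act M (X k) (act M H v) + vsmul (of_int (int m - 2 * int k)) (act M (X k) v)"
    "v \<in> vecs (car M) \<Longrightarrow> k \<le> m \<Longrightarrow> act M F (act M (X k) v)
      = act M (X k) (act M F v) + (if k < m then act M (X (Suc k)) v else 0)"
    "v \<in> vecs (car M) \<Longrightarrow> k \<le> m \<Longrightarrow> act M E (act M (X k) v)
      = act M (X k) (act M E v)
        + (if 0 < k then vsmul (of_nat (k * (m - k + 1))) (act M (X (k - 1)) v) else 0)"
  using assms by (auto simp: gm_module_def comm_def diff_eq_eq add.commute)

lemma valid_gmb_simps [simp]:
  "valid_gmb m E" "valid_gmb m F" "valid_gmb m H" "valid_gmb m (X k) \<longleftrightarrow> k \<le> m"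
  by (simp_all add: valid_gmb_def)

text \<open>Since \<open>[e, x\<^sub>k]\<close> is a nonzero multiple of \<open>x\<^sub>k\<^sub>-\<^sub>1\<close>, on vectors killed by \<open>e\<close>
  (more generally, on an \<open>e\<close>-stable set) only the lowest weight vector \<open>x\<^sub>m\<close> matters.\<close>

lemma X_zero_of_lowest:
  fixes M :: "('a::field_char_0, 'i) gmod"
  assumes gm: "gm_module m M" and A: "A \<subseteq> vecs (car M)" "\<And>v. v \<in> A \<Longrightarrow> act M E v \<in> A"
    and X: "\<And>v. v \<in> A \<Longrightarrow> act M (X m) v = 0" and "k \<le> m" "v \<in> A"
  shows "act M (X k) v = 0"
proof -
  note rules = gm_moduleD[OF gm]
  have "\<forall>v\<in>A. act M (X (m - j)) v = 0" if "j \<le> m" for j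
    using that
  proof (induction j)
    case (Suc j)
    define k where "k = m - j"
    have k: "0 < k" "k \<le> m" "m - Suc j = k - 1" using Suc.prems by (auto simp: k_def)
    have IH: "act M (X k) v = 0" if "v \<in> A" for v using Suc that by (simp add: k_def)
    show ?case unfolding k
    proof
      fix v assume v: "v \<in> A"
      then have "vsmul (of_nat (k * (m - k + 1))) (act M (X (k - 1)) v) = 0"
        using rules(9)[of v k] k A IH[OF v] IH[OF A(2)[OF v]] lin_on_zero[OF subspace_vecs rules(3)[of E]]
        by (auto simp del: of_nat_mult)
      moreover have "k * (m - k + 1) \<noteq> 0" using k by simp
      ultimately show "act M (X (k - 1)) v = 0" unfolding fv.scale_eq_0_iff of_nat_eq_0_iff by blast
    qed
  qed (simp add: X)
  from this[of "m - k"] assms show ?thesis by simp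
qed

context graded_gm_module
begin

lemmas gm_rules = gm_moduleD[OF gm]

sublocale sl2_module "vecs (car M)" "act M E" "act M F" "act M H" N
  by unfold_locales (simp_all add: gm_rules weights)

lemma submod_iff:
  "submod m M S \<longleftrightarrow> stable S \<and> (\<forall>k\<le>m. \<forall>v\<in>S. act M (X k) v \<in> S)"
proof -
  have "(\<forall>b. valid_gmb m b \<longrightarrow> (\<forall>v\<in>S. act M b v \<in> S)) \<longleftrightarrow>
    (\<forall>v\<in>S. act M E v \<in> S \<and> act M F v \<in> S \<and> act M H v \<in> S) \<and> (\<forall>k\<le>m. \<forall>v\<in>S. act M (X k) v \<in> S)"
    by (auto simp: valid_gmb_def split: gmb.splits)
  then show ?thesis by (auto simp: submod_def stable_def subspace_of_eq)
qed

text \<open>\<open>r\<close> is an ideal: moving \<open>e\<close>, \<open>f\<close> or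
  \<open>h\<close> past \<open>x_k\<close> leaves only elements of \<open>r\<close>, which kill the
  vector.\<close>

lemma r_inv_stable:
  assumes S: "stable S"
  shows "stable (r_inv m M S)"
proof -
  note zero = lin_on_zero[OF subspace_vecs gm_rules(3)]
  have "fv.subspace (r_inv m M S)"
    using stableD(1,2)[OF S]
    by (auto simp: fv.subspace_def r_inv_def zero subset_eq
        lin_on_add[OF subspace_vecs gm_rules(3)] lin_on_smul[OF subspace_vecs gm_rules(3)])
  moreover have "act M E v \<in> r_inv m M S \<and> act M F v \<in> r_inv m M S \<and> act M H v \<in> r_inv m M S"
    if "v \<in> r_inv m M S" for v
  proof -
    have v: "v \<in> S" "v \<in> vecs (car M)" and X: "\<And>k. k \<le> m \<Longrightarrow> act M (X k) v = 0"
      using that stableD(2)[OF S] by (auto simp: r_inv_def)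
    have "act M (X k) (act M E v) = 0 \<and> act M (X k) (act M F v) = 0 \<and> act M (X k) (act M H v) = 0"
      if k: "k \<le> m" for k
      using gm_rules(7-9)[OF v(2) k] X k by (auto simp: zero split: if_splits)
    then show ?thesis using v stableD[OF S] by (simp add: r_inv_def)
  qed
  moreover have "r_inv m M S \<subseteq> vecs (car M)" using stableD(2)[OF S] by (auto simp: r_inv_def)
  ultimately show ?thesis by (simp add: stable_def)
qed

lemma vecs_stable: "stable (vecs (car M))"
  by (simp add: stable_def closed)

lemma r_inv_submod: "stable S \<Longrightarrow> submod m M (r_inv m M S)"
  using r_inv_stable fv.subspace_0[OF stableD(1)]
  by (auto simp: submod_iff r_inv_def lin_on_zero[OF subspace_vecs gm_rules(3)])

text \<open>The lowest step of the filtration that meets \<open>S\<close> nontrivially consists of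
  invariants there, since \<open>r\<close> maps it into \<open>S\<close> one step further down,
  where only 0 is left.\<close>

lemma r_inv_nonzero:
  assumes S: "submod m M S" "S \<noteq> {0}"
  shows "r_inv m M S \<noteq> {0}"
proof
  assume inv: "r_inv m M S = {0}"
  have "S \<inter> Fil n \<subseteq> {0}" for n
  proof (induction n)
    case (Suc n)
    show ?case
    proof
      fix v assume v: "v \<in> S \<inter> Fil (Suc n)"
      then have "act M (X k) v = 0" if "k \<le> m" for k
        using that Suc S(1) Fil_step[of v n k] unfolding submod_iff by blast
      then show "v \<in> {0}" using v inv by (auto simp: r_inv_def)
    qed
  qed (simp add: Fil_bot)
  then have "S \<subseteq> {0}" using Fil_top S(1) by (fastforce simp: submod_iff stable_def)
  then show False using S fv.subspace_0[of S] by (auto simp: submod_iff stable_def)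
qed

lemma irred_submod_r_inv:
  assumes "irred_submod m M S"
  shows "S \<subseteq> r_inv m M (vecs (car M))"
proof -
  have S: "submod m M S" "S \<noteq> {0}" and
    irr: "\<And>S'. submod m M S' \<Longrightarrow> S' \<subseteq> S \<Longrightarrow> S' = {0} \<or> S' = S"
    using assms by (auto simp: irred_submod_def)
  have st: "stable S" using S(1) by (simp add: submod_iff)
  have "r_inv m M S = S"
    using irr[OF r_inv_submod[OF st]] r_inv_nonzero[OF S] by (auto simp: r_inv_def)
  then show ?thesis using stableD(2)[OF st] by (auto simp: r_inv_def)
qed

lemma socle_sub_r_inv: "socle m M \<subseteq> r_inv m M (vecs (car M))"
proof
  fix v assume "v \<in> socle m M"
  then obtain w and n :: nat where "v = sum w {..<n}" "\<forall>j<n. \<exists>S. irred_submod m M S \<and> w j \<in> S"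
    by (auto simp: socle_def)
  then show "v \<in> r_inv m M (vecs (car M))"
    using irred_submod_r_inv stableD(1)[OF r_inv_stable[OF vecs_stable]]
    by (auto intro!: fv.subspace_sum)
qed

text \<open>The invariants are spanned by strings. On these \<open>r\<close> acts by zero, so they
  are submodules, and irreducibility under \<open>sl(2)\<close> suffices.\<close>

lemma socle_eq_r_inv:
  assumes "hw_family (vecs (car M)) (act M E) (act M F) (act M H) N (r_inv m M (vecs (car M))) W u"
  shows "socle m M = r_inv m M (vecs (car M))"
proof
  interpret hw_family "vecs (car M)" "act M E" "act M F" "act M H" N "r_inv m M (vecs (car M))" W u
    by (rule assms)
  have irr: "irred_submod m M (string c)" if c: "c \<in> W" for c
  proof -
    have "act M (X k) v = 0" if "k \<le> m" "v \<in> string c" for k v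
      using string_sub[OF c] that by (auto simp: r_inv_def)
    then have "submod m M (string c)"
      using string_stable[OF c] fv.subspace_0[OF stableD(1)] by (auto simp: submod_iff)
    then show ?thesis
      using string_irreducible[OF c] string_nonzero[OF c]
      by (auto simp: irred_submod_def submod_iff)
  qed
  show "r_inv m M (vecs (car M)) \<subseteq> socle m M"
  proof
    fix v assume "v \<in> r_inv m M (vecs (car M))"
    then have "v \<in> fv.span gens" using span_gens_eq by simp
    \<comment> \<open>The socle is defined through sums over initial segments of the naturals, so
      the finite support of the linear combination has to be enumerated.\<close>
    then obtain t r where tr: "finite t" "t \<subseteq> gens" "v = (\<Sum>a\<in>t. vsmul (r a) a)"
      unfolding fv.span_explicit by auto
    obtain p where p: "bij_betw p {..<card t} t"
      using ex_bij_betw_nat_finite[OF tr(1)] by (auto simp: atLeast0LessThan)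
    have "v = (\<Sum>j<card t. vsmul (r (p j)) (p j))"
      unfolding tr(3) by (rule sum.reindex_bij_betw[OF p, symmetric])
    moreover have "\<exists>S. irred_submod m M S \<and> vsmul (r (p j)) (p j) \<in> S" if "j < card t" for j
    proof -
      have "p j \<in> t" using p that by (auto simp: bij_betw_def)
      then obtain c k where ck: "c \<in> W" "p j = (act M F ^^ k) (u c)" using tr(2) by (auto simp: gens_def)
      have "p j \<in> string c" unfolding ck string_def by (rule fv.span_base) blast
      then show ?thesis using irr[OF ck(1)] fv.span_scale by (metis string_def)
    qed
    ultimately show "v \<in> socle m M" unfolding socle_def vsum_eq by blast
  qed
qed (rule socle_sub_r_inv)

end

section \<open>Bases of modules of type \<open>Z\<close>\<close>

text \<open>The shift \<open>\<sigma>\<close> comes from comparing weights: \<open>x_m\<close>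
  lowers weights by m, and a(i+1) - m = a(i) - 2 \<sigma> holds with \<sigma> = 0 for increasing and
  \<sigma> = m for decreasing weights. Extending the layers by zero vectors lets the action formulas
  hold for every k, and the scaling makes the coefficient of the shift equal to 1.\<close>

locale z_basis =
  fixes m :: nat and M :: "('a::field_char_0, 'i) gmod" and U :: "nat \<Rightarrow> ('i \<Rightarrow> 'a) set"
    and l :: nat and a :: "nat \<Rightarrow> nat" and \<sigma> :: nat and \<beta> :: "nat \<times> nat \<Rightarrow> 'i \<Rightarrow> 'a"
  assumes gm: "gm_module m M"
    and \<beta>_vecs: "\<beta> p \<in> vecs (car M)"
    and \<beta>_zero: "k > a i \<Longrightarrow> \<beta> (i, k) = 0"
    and act_E_0: "act M E (\<beta> (i, 0)) = 0"
    and act_E_Suc: "act M E (\<beta> (i, Suc k)) = vsmul (of_int ((int k + 1) * (int (a i) - int k))) (\<beta> (i, k))"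
    and act_F: "act M F (\<beta> (i, k)) = \<beta> (i, Suc k)"
    and act_H: "act M H (\<beta> (i, k)) = vsmul (of_int (int (a i) - 2 * int k)) (\<beta> (i, k))"
    and act_Xm: "Suc i \<le> l \<Longrightarrow> act M (X m) (\<beta> (Suc i, k)) = \<beta> (i, k + \<sigma>)"
    and act_X_0: "k \<le> m \<Longrightarrow> act M (X k) (\<beta> (0, s)) = 0"
    and act_X_Suc: "k \<le> m \<Longrightarrow> Suc i \<le> l \<Longrightarrow> act M (X k) (\<beta> (Suc i, s)) \<in> U i"
    and \<sigma>_le: "Suc i \<le> l \<Longrightarrow> \<sigma> \<le> a i"
    and U_span: "i \<le> l \<Longrightarrow> U i = fv.span (\<beta> ` ({i} \<times> {..a i}))"
    and indep: "(\<Sum>p\<in>Sigma {..l} (\<lambda>i. {..a i}). vsmul (c p) (\<beta> p)) = 0 \<Longrightarrow>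
      i \<le> l \<Longrightarrow> k \<le> a i \<Longrightarrow> c (i, k) = 0"
    and spans: "vecs (car M) = fv.span (\<beta> ` Sigma {..l} (\<lambda>i. {..a i}))"

lemma span_image_explicit:
  assumes "finite I"
  shows "fv.span (\<beta> ` I) = range (\<lambda>c. \<Sum>p\<in>I. vsmul (c p) (\<beta> p))" (is "?S = ?R")
proof
  have "\<beta> p \<in> ?R" if "p \<in> I" for p
  proof (rule range_eqI)
    show "\<beta> p = (\<Sum>q\<in>I. vsmul (if q = p then 1 else 0) (\<beta> q))"
      using assms that by (simp add: if_distrib[where f = "\<lambda>x. vsmul x _"] cong: if_cong)
  qed
  moreover have "fv.subspace ?R"
    unfolding fv.subspace_def
  proof (intro conjI allI ballI; (elim rangeE)?; clarify?)
    show "0 \<in> ?R" by (rule range_eqI[of _ _ "\<lambda>_. 0"]) simp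
    fix c d k
    show "(\<Sum>p\<in>I. vsmul (c p) (\<beta> p)) + (\<Sum>p\<in>I. vsmul (d p) (\<beta> p)) \<in> ?R"
      by (rule range_eqI[of _ _ "\<lambda>p. c p + d p"]) (simp add: sum.distrib fv.scale_left_distrib)
    show "vsmul k (\<Sum>p\<in>I. vsmul (c p) (\<beta> p)) \<in> ?R"
      by (rule range_eqI[of _ _ "\<lambda>p. k * c p"]) (simp add: fv.scale_sum_right)
  qed
  ultimately show "?S \<subseteq> ?R" by (intro fv.span_minimal) auto
  show "?R \<subseteq> ?S"
  proof clarify
    fix c show "(\<Sum>p\<in>I. vsmul (c p) (\<beta> p)) \<in> ?S"
      by (rule fv.span_sum, rule fv.span_scale, rule fv.span_base) simp
  qed
qed

definition sl2_basis ::
  "('a::field_char_0, 'i) gmod \<Rightarrow> nat \<Rightarrow> ('i \<Rightarrow> 'a) set \<Rightarrow> (nat \<Rightarrow> 'i \<Rightarrow> 'a) \<Rightarrow> bool" where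
  "sl2_basis M c S \<beta> \<longleftrightarrow> (\<forall>k. \<beta> k \<in> vecs (car M)) \<and> (\<forall>k>c. \<beta> k = 0) \<and>
    act M E (\<beta> 0) = 0 \<and>
    (\<forall>k. act M E (\<beta> (Suc k)) = vsmul (of_int ((int k + 1) * (int c - int k))) (\<beta> k)) \<and>
    (\<forall>k. act M F (\<beta> k) = \<beta> (Suc k)) \<and>
    (\<forall>k. act M H (\<beta> k) = vsmul (of_int (int c - 2 * int k)) (\<beta> k)) \<and>
    S = fv.span (\<beta> ` {..c}) \<and>
    (\<forall>d. (\<Sum>k\<le>c. vsmul (d k) (\<beta> k)) = 0 \<longrightarrow> (\<forall>k\<le>c. d k = 0))"

lemma sl2_basisD:
  assumes "sl2_basis M c S \<beta>"
  shows "\<beta> k \<in> vecs (car M)" "k > c \<Longrightarrow> \<beta> k = 0" "act M E (\<beta> 0) = 0"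
    "act M E (\<beta> (Suc k)) = vsmul (of_int ((int k + 1) * (int c - int k))) (\<beta> k)"
    "act M F (\<beta> k) = \<beta> (Suc k)"
    "act M H (\<beta> k) = vsmul (of_int (int c - 2 * int k)) (\<beta> k)"
    "S = fv.span (\<beta> ` {..c})"
    "(\<Sum>k\<le>c. vsmul (d k) (\<beta> k)) = 0 \<Longrightarrow> k \<le> c \<Longrightarrow> d k = 0"
  using assms unfolding sl2_basis_def by blast+

lemma sl2_iso_onto_basis:
  fixes M :: "('a::field_char_0, 'i) gmod"
  assumes iso: "sl2_iso_onto [c] M S"
  shows "\<exists>\<beta>. sl2_basis M c S \<beta>"
proof -
  obtain \<phi> where hom: "sl2_hom [c] M \<phi>" and inj: "inj_on \<phi> (ds_vecs [c])" and im: "\<phi> ` ds_vecs [c] = S"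
    using iso by (auto simp: sl2_iso_onto_def)
  have Y: "fv.subspace (ds_vecs [c] :: (nat \<times> nat \<Rightarrow> 'a) set)" by (simp add: ds_vecs_def)
  have lin\<phi>: "lin_on (ds_vecs [c]) \<phi>" using hom by (simp add: sl2_hom_def)
  have \<phi>_act: "\<phi> (ds_act [c] b v) = act M b (\<phi> v)" if "b \<in> {E, F, H}" "v \<in> ds_vecs [c]" for b v
    using hom that unfolding sl2_hom_def by blast
  define \<delta> :: "nat \<Rightarrow> nat \<times> nat \<Rightarrow> 'a" where "\<delta> k = (\<lambda>p. if p = (0, k) \<and> k \<le> c then 1 else 0)" for k
  have \<delta>: "\<delta> k \<in> ds_vecs [c]" for k
    by (auto simp: \<delta>_def ds_vecs_def vecs_def)
  have \<delta>0: "\<delta> k = 0" if "k > c" for k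
    using that by (auto simp: \<delta>_def fun_eq_iff fun_apply)
  have E0: "ds_act [c] E (\<delta> 0) = 0"
    by (auto simp: ds_act_def Vact_def \<delta>_def fun_eq_iff fun_apply)
  have E: "ds_act [c] E (\<delta> (Suc k)) = vsmul (of_int ((int k + 1) * (int c - int k))) (\<delta> k)" for k
  proof (cases "k < c")
    case True
    then show ?thesis
      using of_int_raising[OF True, where 'a = 'a] by (auto simp: ds_act_def Vact_def \<delta>_def fun_eq_iff fun_apply simp del: of_int_mult of_nat_mult)
  next
    case False
    then show ?thesis by (cases "k = c") (simp_all add: \<delta>0 ds_act_def Vact_def fun_eq_iff fun_apply)
  qed
  have F: "ds_act [c] F (\<delta> k) = \<delta> (Suc k)" for k
    by (auto simp: ds_act_def Vact_def \<delta>_def fun_eq_iff fun_apply)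
  have H: "ds_act [c] H (\<delta> k) = vsmul (of_int (int c - 2 * int k)) (\<delta> k)" for k
    by (auto simp: ds_act_def Vact_def \<delta>_def fun_eq_iff fun_apply)
  define \<beta> where "\<beta> k = \<phi> (\<delta> k)" for k
  have comb: "d = (\<Sum>k\<le>c. vsmul (d (0, k)) (\<delta> k))" if "d \<in> ds_vecs [c]" for d
  proof
    fix p :: "nat \<times> nat"
    obtain j k where p: "p = (j, k)" by (cases p)
    have "(\<Sum>k\<le>c. vsmul (d (0, k)) (\<delta> k)) (j, k) = (\<Sum>k'\<le>c. if k' = k then (if j = 0 then d (0, k) else 0) else 0)"
      unfolding sum_fun_apply by (intro sum.cong) (auto simp: \<delta>_def fun_apply)
    also have "\<dots> = d (j, k)" using that by (auto simp: ds_vecs_def vecs_def)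
    finally show "d p = (\<Sum>k\<le>c. vsmul (d (0, k)) (\<delta> k)) p" using p by simp
  qed
  have \<phi>_comb: "\<phi> (\<Sum>k\<le>c. vsmul (d k) (\<delta> k)) = (\<Sum>k\<le>c. vsmul (d k) (\<beta> k))" for d
    using \<delta> by (simp add: lin_on_sum[OF Y lin\<phi>] fv.subspace_scale[OF Y] lin_on_smul[OF Y lin\<phi>] \<beta>_def)
  have in_ds: "(\<Sum>k\<le>c. vsmul (d k) (\<delta> k)) \<in> ds_vecs [c]" for d
    using \<delta> by (intro fv.subspace_sum[OF Y] fv.subspace_scale[OF Y])
  show ?thesis
    unfolding sl2_basis_def
  proof (intro exI[of _ \<beta>] conjI allI impI)
    show "S = fv.span (\<beta> ` {..c})"
      unfolding span_image_explicit[OF finite_atMost] im[symmetric]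
    proof (intro equalityI subsetI)
      fix v assume "v \<in> \<phi> ` ds_vecs [c]"
      then obtain d where d: "d \<in> ds_vecs [c]" "v = \<phi> d" by blast
      then have "v = (\<Sum>k\<le>c. vsmul (d (0, k)) (\<beta> k))" using comb[OF d(1)] \<phi>_comb by metis
      then show "v \<in> range (\<lambda>c'. \<Sum>k\<le>c. vsmul (c' k) (\<beta> k))"
        by (intro range_eqI[of _ _ "\<lambda>k. d (0, k)"])
    next
      fix v assume "v \<in> range (\<lambda>c'. \<Sum>k\<le>c. vsmul (c' k) (\<beta> k))"
      then show "v \<in> \<phi> ` ds_vecs [c]" using \<phi>_comb in_ds by (metis (no_types, lifting) imageE image_eqI)
    qed
    fix d :: "nat \<Rightarrow> 'a" and k assume "(\<Sum>k\<le>c. vsmul (d k) (\<beta> k)) = 0" "k \<le> c"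
    then have "\<phi> (\<Sum>k\<le>c. vsmul (d k) (\<delta> k)) = \<phi> 0" using \<phi>_comb lin_on_zero[OF Y lin\<phi>] by simp
    then have "(\<Sum>k\<le>c. vsmul (d k) (\<delta> k)) = 0"
      using inj_onD[OF inj] in_ds fv.subspace_0[OF Y] by blast
    then have "(\<Sum>k\<le>c. vsmul (d k) (\<delta> k)) (0, k) = 0" by (simp add: fun_apply)
    moreover have "(\<Sum>k\<le>c. vsmul (d k) (\<delta> k)) (0, k) = (\<Sum>k'\<le>c. if k' = k then d k else 0)"
      unfolding sum_fun_apply using \<open>k \<le> c\<close> by (intro sum.cong) (auto simp: \<delta>_def fun_apply)
    ultimately show "d k = 0" using \<open>k \<le> c\<close> by simp
  next
    show "\<beta> k \<in> vecs (car M)" for k using hom \<delta> by (auto simp: sl2_hom_def \<beta>_def)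
    show "\<beta> k = 0" if "k > c" for k using \<delta>0[OF that] lin_on_zero[OF Y lin\<phi>] by (simp add: \<beta>_def)
    show "act M E (\<beta> 0) = 0" using \<phi>_act[of E] \<delta> E0 lin_on_zero[OF Y lin\<phi>] by (simp add: \<beta>_def flip: \<phi>_act)
    show "act M E (\<beta> (Suc k)) = vsmul (of_int ((int k + 1) * (int c - int k))) (\<beta> k)" for k
      unfolding \<beta>_def lin_on_smul[OF Y lin\<phi> \<delta>, symmetric] E[symmetric] using \<phi>_act \<delta> by simp
    show "act M F (\<beta> k) = \<beta> (Suc k)" for k
      unfolding \<beta>_def F[symmetric] using \<phi>_act \<delta> by simp
    show "act M H (\<beta> k) = vsmul (of_int (int c - 2 * int k)) (\<beta> k)" for k
      unfolding \<beta>_def lin_on_smul[OF Y lin\<phi> \<delta>, symmetric] H[symmetric] using \<phi>_act \<delta> by simp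
  qed
qed

text \<open>\<open>x_m\<close> maps the highest weight vector of \<open>U (Suc i)\<close> into a
  weight space of \<open>U i\<close> that is a line. As \<open>x_m\<close> commutes with
  \<open>f\<close>, one scalar \<open>\<gamma> i\<close> describes it on the whole layer. Rescaling
  the layers absorbs these scalars, which are nonzero because \<open>r\<close> acts nontrivially on
  each layer above the bottom.\<close>

lemma zmod_z_basis:
  fixes M :: "('a::field_char_0, 'i) gmod"
  assumes z: "zmod m M U a0 l up"
  obtains \<beta> where "z_basis m M U l (zweight up a0 m) (if up then 0 else m) \<beta>"
proof -
  define a where "a = zweight up a0 m"
  define \<sigma> where "\<sigma> = (if up then 0 else m)"
  have gm: "gm_module m M" and dn: "up \<or> l * m \<le> a0"
    and iso: "\<And>i. i \<le> l \<Longrightarrow> sl2_iso_onto [a i] M (U i)"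
    and ds: "is_dsum (vecs (car M)) U l"
    and X0: "\<And>k u. k \<le> m \<Longrightarrow> u \<in> U 0 \<Longrightarrow> act M (X k) u = 0"
    and XU: "\<And>i k u. Suc i \<le> l \<Longrightarrow> k \<le> m \<Longrightarrow> u \<in> U (Suc i) \<Longrightarrow> act M (X k) u \<in> U i"
    and Xnz: "\<And>i. Suc i \<le> l \<Longrightarrow> \<exists>k\<le>m. \<exists>u\<in>U (Suc i). act M (X k) u \<noteq> 0"
    using z unfolding zmod_def a_def by (auto dest: spec[of _ "Suc _"])
  note rules = gm_moduleD[OF gm]
  have lin: "lin_on (vecs (car M)) (act M b)" if "valid_gmb m b" for b using rules(3) that .
  have a_step: "int (a (Suc i)) - int m = int (a i) - 2 * int \<sigma>" and \<sigma>_le: "\<sigma> \<le> a i"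
    if "Suc i \<le> l" for i
  proof -
    have "up \<or> Suc i * m \<le> a0" using dn that mult_le_mono1[OF that, of m] by linarith
    then show "int (a (Suc i)) - int m = int (a i) - 2 * int \<sigma>" "\<sigma> \<le> a i"
      by (auto simp: a_def zweight_def \<sigma>_def of_nat_diff)
  qed
  have "\<forall>i. \<exists>\<beta>. i \<le> l \<longrightarrow> sl2_basis M (a i) (U i) \<beta>"
    using sl2_iso_onto_basis[OF iso] by blast
  then obtain \<beta>0 where "\<And>i. i \<le> l \<Longrightarrow> sl2_basis M (a i) (U i) (\<beta>0 i)" by metis
  note B = sl2_basisD[OF this]
  have U_sub: "fv.subspace (U i)" "\<And>k. \<beta>0 i k \<in> U i" "U i \<subseteq> vecs (car M)" if "i \<le> l" for i
  proof -
    show "fv.subspace (U i)" unfolding B(7)[OF that] by simp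
    show "\<beta>0 i k \<in> U i" for k
    proof (cases "k \<le> a i")
      case True
      then have "\<beta>0 i k \<in> fv.span (\<beta>0 i ` {..a i})" by (intro fv.span_base) simp
      then show ?thesis using B(7)[OF that] by simp
    next
      case False
      then show ?thesis unfolding B(7)[OF that] using B(2)[OF that] fv.span_zero by (metis not_le)
    qed
    have "fv.span (\<beta>0 i ` {..a i}) \<subseteq> vecs (car M)" using B(1)[OF that] by (intro fv.span_minimal) auto
    then show "U i \<subseteq> vecs (car M)" using B(7)[OF that] by simp
  qed
  have "\<exists>\<gamma>. Suc i \<le> l \<longrightarrow> \<gamma> \<noteq> 0 \<and> (\<forall>k. act M (X m) (\<beta>0 (Suc i) k) = vsmul \<gamma> (\<beta>0 i (k + \<sigma>)))" for i
  proof (cases "Suc i \<le> l")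
    case True
    then have i: "i \<le> l" by simp
    let ?x = "act M (X m) (\<beta>0 (Suc i) 0)"
    have v: "\<beta>0 (Suc i) 0 \<in> vecs (car M)" using B(1)[OF True] .
    have "?x \<in> U i" by (rule XU[OF True _ U_sub(2)[OF True]]) simp
    then obtain c where c: "?x = (\<Sum>k\<le>a i. vsmul (c k) (\<beta>0 i k))"
      unfolding B(7)[OF i] span_image_explicit[OF finite_atMost] by blast
    \<comment> \<open>Evaluating \<open>h\<close> on \<open>?x\<close> in two ways leaves the
      coefficient at \<sigma> as the only possibly nonzero one.\<close>
    have "act M H ?x = vsmul (of_int (int (a (Suc i)) - int m)) ?x"
      using rules(7)[OF v, of m] B(6)[OF True] lin_on_smul[OF subspace_vecs lin[of "X m"] v]
      by (simp add: fv.scale_left_diff_distrib algebra_simps)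
    also have "\<dots> = (\<Sum>k\<le>a i. vsmul (of_int (int (a i) - 2 * int \<sigma>) * c k) (\<beta>0 i k))"
      unfolding a_step[OF True] by (simp add: c fv.scale_sum_right)
    also have "act M H ?x = (\<Sum>k\<le>a i. vsmul (of_int (int (a i) - 2 * int k) * c k) (\<beta>0 i k))"
      unfolding c using B(1,6)[OF i]
      by (simp add: lin_on_sum[OF subspace_vecs lin] lin_on_smul[OF subspace_vecs lin]
          fv.subspace_scale[OF subspace_vecs] mult.commute)
    finally have "(\<Sum>k\<le>a i. vsmul (of_int (int (a i) - 2 * int k) * c k
        - of_int (int (a i) - 2 * int \<sigma>) * c k) (\<beta>0 i k)) = 0"
      by (simp only: fv.scale_left_diff_distrib sum_subtractf) simp
    then have "of_int (int (a i) - 2 * int k) * c k - of_int (int (a i) - 2 * int \<sigma>) * c k = 0"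
      if "k \<le> a i" for k
      using that by (rule B(8)[OF i])
    then have "of_int (2 * (int \<sigma> - int k)) * c k = 0" if "k \<le> a i" for k
      using that by (simp add: algebra_simps)
    then have ck: "c k = 0" if "k \<le> a i" "k \<noteq> \<sigma>" for k
      using that by (auto simp: mult_eq_0_iff simp del: of_int_mult)
    have "?x = (\<Sum>k\<in>{\<sigma>}. vsmul (c k) (\<beta>0 i k))"
      unfolding c using ck \<sigma>_le[OF True] by (intro sum.mono_neutral_right) auto
    then have x0: "?x = vsmul (c \<sigma>) (\<beta>0 i \<sigma>)" by simp
    have x: "act M (X m) (\<beta>0 (Suc i) k) = vsmul (c \<sigma>) (\<beta>0 i (k + \<sigma>))" for k
    proof (induction k)
      case (Suc k)
      have "act M (X m) (\<beta>0 (Suc i) (Suc k)) = act M F (act M (X m) (\<beta>0 (Suc i) k))"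
        using rules(8)[of "\<beta>0 (Suc i) k" m] B(1,5)[OF True] by simp
      also have "\<dots> = vsmul (c \<sigma>) (\<beta>0 i (Suc k + \<sigma>))"
        unfolding Suc.IH using B(1,5)[OF i] by (simp add: lin_on_smul[OF subspace_vecs lin])
      finally show ?case .
    qed (simp add: x0)
    have "c \<sigma> \<noteq> 0"
    proof
      assume c0: "c \<sigma> = 0"
      \<comment> \<open>With a zero scalar, \<open>x_m\<close> kills the whole layer; since the
        layer is \<open>e\<close>-stable, \<open>X_zero_of_lowest\<close> makes all of
        \<open>r\<close> vanish on it, contrary to the hypothesis on type Z.\<close>
      have "U (Suc i) \<subseteq> {u \<in> vecs (car M). act M (X m) u \<in> {0}}"
        unfolding B(7)[OF True]
      proof (rule fv.span_minimal)
        show "fv.subspace {u \<in> vecs (car M). act M (X m) u \<in> {0}}"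
          by (intro subspace_lin_preimage subspace_vecs lin fv.subspace_single_0) simp
      qed (use x c0 B(1)[OF True] in auto)
      moreover have "act M E u \<in> U (Suc i)" if "u \<in> U (Suc i)" for u
      proof -
        have "U (Suc i) \<subseteq> {u \<in> vecs (car M). act M E u \<in> U (Suc i)}"
          unfolding B(7)[OF True]
        proof (rule fv.span_minimal)
          show "fv.subspace {u \<in> vecs (car M). act M E u \<in> fv.span (\<beta>0 (Suc i) ` {..a (Suc i)})}"
            by (intro subspace_lin_preimage subspace_vecs lin fv.subspace_span) simp
          have "act M E (\<beta>0 (Suc i) k) \<in> fv.span (\<beta>0 (Suc i) ` {..a (Suc i)})" if "k \<le> a (Suc i)" for k
          proof (cases k)
            case (Suc k')
            then have "\<beta>0 (Suc i) k' \<in> fv.span (\<beta>0 (Suc i) ` {..a (Suc i)})"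
              using that by (intro fv.span_base) auto
            then show ?thesis unfolding Suc B(4)[OF True] by (rule fv.span_scale)
          qed (use B(3)[OF True] in \<open>simp add: fv.span_zero\<close>)
          then show "\<beta>0 (Suc i) ` {..a (Suc i)}
              \<subseteq> {u \<in> vecs (car M). act M E u \<in> fv.span (\<beta>0 (Suc i) ` {..a (Suc i)})}"
            using B(1)[OF True] by auto
        qed
        then show ?thesis using that by blast
      qed
      ultimately have "act M (X k) u = 0" if "k \<le> m" "u \<in> U (Suc i)" for k u
        using X_zero_of_lowest[OF gm U_sub(3)[OF True] _ _ that] by blast
      then show False using Xnz[OF True] by blast
    qed
    then show ?thesis using x by blast
  qed simp
  then obtain \<gamma> where \<gamma>: "\<And>i. Suc i \<le> l \<Longrightarrow> \<gamma> i \<noteq> 0"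
    "\<And>i k. Suc i \<le> l \<Longrightarrow> act M (X m) (\<beta>0 (Suc i) k) = vsmul (\<gamma> i) (\<beta>0 i (k + \<sigma>))" by metis
  \<comment> \<open>Chosen so that \<open>\<rho> (Suc i) * \<gamma> i = \<rho> i\<close>, which
    turns the scalar of the shift between rescaled layers into 1.\<close>
  define \<rho> where "\<rho> i = (\<Prod>j<i. inverse (\<gamma> j))" for i
  have \<rho>: "\<rho> i \<noteq> 0" if "i \<le> l" for i using \<gamma>(1) that by (auto simp: \<rho>_def prod_zero_iff)
  define \<beta> where "\<beta> = (\<lambda>(i, k). if i \<le> l then vsmul (\<rho> i) (\<beta>0 i k) else 0)"
  have zero: "act M b 0 = 0" if "valid_gmb m b" for b
    by (rule lin_on_zero[OF subspace_vecs lin[OF that]])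
  have smul: "act M b (vsmul c (\<beta>0 i k)) = vsmul c (act M b (\<beta>0 i k))" if "valid_gmb m b" "i \<le> l" for b c i k
    by (rule lin_on_smul[OF subspace_vecs lin[OF that(1)] B(1)[OF that(2)]])
  let ?I = "Sigma {..l} (\<lambda>i. {..a i})"
  have U\<beta>: "U i = fv.span (\<beta> ` ({i} \<times> {..a i}))" if i: "i \<le> l" for i
  proof -
    have "fv.span (\<beta>0 i ` {..a i}) \<subseteq> fv.span (\<beta> ` ({i} \<times> {..a i}))"
    proof (rule fv.span_minimal)
      show "\<beta>0 i ` {..a i} \<subseteq> fv.span (\<beta> ` ({i} \<times> {..a i}))"
      proof clarify
        fix k assume "k \<le> a i"
        then have "vsmul (inverse (\<rho> i)) (\<beta> (i, k)) \<in> fv.span (\<beta> ` ({i} \<times> {..a i}))"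
          by (intro fv.span_scale fv.span_base) auto
        then show "\<beta>0 i k \<in> fv.span (\<beta> ` ({i} \<times> {..a i}))" using \<rho>[OF i] i by (simp add: \<beta>_def)
      qed
    qed simp
    moreover have "fv.span (\<beta> ` ({i} \<times> {..a i})) \<subseteq> U i"
      using U_sub[OF i] i by (intro fv.span_minimal) (auto simp: \<beta>_def fv.subspace_scale)
    ultimately show ?thesis using B(7)[OF i] by auto
  qed
  have "z_basis m M U l a \<sigma> \<beta>"
  proof
    show "gm_module m M" by (rule gm)
    show "\<beta> p \<in> vecs (car M)" for p
      using B(1) by (cases p) (auto simp: \<beta>_def intro: fv.subspace_scale fv.subspace_0)
    show "\<beta> (i, k) = 0" if "k > a i" for i k using B(2) that by (simp add: \<beta>_def)
    show "act M E (\<beta> (i, 0)) = 0" for i using B(3) by (simp add: \<beta>_def zero smul)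
    show "act M E (\<beta> (i, Suc k)) = vsmul (of_int ((int k + 1) * (int (a i) - int k))) (\<beta> (i, k))" for i k
      using B(4) by (simp add: \<beta>_def zero smul mult.commute del: of_int_mult)
    show "act M F (\<beta> (i, k)) = \<beta> (i, Suc k)" for i k using B(5) by (simp add: \<beta>_def zero smul)
    show "act M H (\<beta> (i, k)) = vsmul (of_int (int (a i) - 2 * int k)) (\<beta> (i, k))" for i k
      using B(6) by (simp add: \<beta>_def zero smul mult.commute)
    show "act M (X m) (\<beta> (Suc i, k)) = \<beta> (i, k + \<sigma>)" if "Suc i \<le> l" for i k
      using that \<gamma>[of i] by (simp add: \<beta>_def smul \<rho>_def)
    show "act M (X k) (\<beta> (0, s)) = 0" if "k \<le> m" for k s
      using X0[OF that] U_sub(2)[of 0] that by (simp add: \<beta>_def smul)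
    show "act M (X k) (\<beta> (Suc i, s)) \<in> U i" if "k \<le> m" "Suc i \<le> l" for k i s
      using XU[OF that(2,1) U_sub(2)[OF that(2)]] that U_sub(1)[of i]
      by (simp add: \<beta>_def smul fv.subspace_scale)
    show "\<sigma> \<le> a i" if "Suc i \<le> l" for i by (rule \<sigma>_le[OF that])
    show "U i = fv.span (\<beta> ` ({i} \<times> {..a i}))" if "i \<le> l" for i by (rule U\<beta>[OF that])
    show "vecs (car M) = fv.span (\<beta> ` ?I)"
    proof
      show "vecs (car M) \<subseteq> fv.span (\<beta> ` ?I)"
      proof
        fix v :: "'i \<Rightarrow> 'a" assume "v \<in> vecs (car M)"
        also have "vecs (car M) = {vsum w {..l} | w. \<forall>t\<le>l. w t \<in> U t}"
          using ds unfolding is_dsum_def by blast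
        finally obtain w where w: "v = sum w {..l}" "\<forall>t\<le>l. w t \<in> U t" by auto
        have "w t \<in> fv.span (\<beta> ` ?I)" if "t \<le> l" for t
          using fv.span_mono[of "\<beta> ` ({t} \<times> {..a t})" "\<beta> ` ?I"] U\<beta>[OF that] w(2) that by blast
        then show "v \<in> fv.span (\<beta> ` ?I)" unfolding w(1) by (intro fv.span_sum) auto
      qed
      show "fv.span (\<beta> ` ?I) \<subseteq> vecs (car M)"
      proof (intro fv.span_minimal subspace_vecs, clarify)
        fix i k assume "i \<le> l"
        then have "\<beta> (i, k) = vsmul (\<rho> i) (\<beta>0 i k)" by (simp add: \<beta>_def)
        also have "\<dots> \<in> vecs (car M)" by (intro fv.subspace_scale subspace_vecs B(1) \<open>i \<le> l\<close>)
        finally show "\<beta> (i, k) \<in> vecs (car M)" .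
      qed
    qed
    fix c :: "nat \<times> nat \<Rightarrow> 'a" and i k
    assume s: "(\<Sum>p\<in>?I. vsmul (c p) (\<beta> p)) = 0" and ik: "i \<le> l" "k \<le> a i"
    define w where "w t = (\<Sum>k\<le>a t. vsmul (c (t, k)) (\<beta> (t, k)))" for t
    have "sum w {..l} = (\<Sum>p\<in>?I. vsmul (c p) (\<beta> p))"
      unfolding w_def by (subst sum.Sigma) (auto intro!: sum.cong)
    then have "sum w {..l} = 0" using s by simp
    moreover have "\<forall>t\<le>l. w t \<in> U t"
      using U_sub by (auto simp: w_def \<beta>_def intro!: fv.subspace_sum fv.subspace_scale)
    ultimately have "w i = 0"
      using ds[unfolded is_dsum_def, THEN conjunct2, rule_format, of w i] ik by simp
    then have "(\<Sum>k\<le>a i. vsmul (c (i, k) * \<rho> i) (\<beta>0 i k)) = 0" using ik by (simp add: w_def \<beta>_def)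
    then have "c (i, k) * \<rho> i = 0"
      using ik(2) by (rule B(8)[OF ik(1)])
    then show "c (i, k) = 0" using \<rho>[OF ik(1)] by simp
  qed
  then show ?thesis using that by (simp add: a_def \<sigma>_def)
qed

section \<open>Weights and filtration from a graded weight basis\<close>

locale based_gm_module =
  fixes m :: nat and M :: "('a::field_char_0, 'i) gmod" and I :: "'k set"
    and B :: "'k \<Rightarrow> 'i \<Rightarrow> 'a" and \<omega> :: "'k \<Rightarrow> int" and dg :: "'k \<Rightarrow> nat"
  assumes gm: "gm_module m M" and fin: "finite I"
    and B_vecs: "p \<in> I \<Longrightarrow> B p \<in> vecs (car M)"
    and B_spans: "vecs (car M) \<subseteq> fv.span (B ` I)"
    and B_H: "p \<in> I \<Longrightarrow> act M H (B p) = vsmul (of_int (\<omega> p)) (B p)"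
    and B_X: "p \<in> I \<Longrightarrow> k \<le> m \<Longrightarrow> act M (X k) (B p) \<in> fv.span (B ` {q \<in> I. dg q < dg p})"
begin

lemma act_H_sum:
  "A \<subseteq> I \<Longrightarrow> act M H (\<Sum>p\<in>A. vsmul (c p) (B p)) = (\<Sum>p\<in>A. vsmul (c p * of_int (\<omega> p)) (B p))"
  using gm_moduleD(3)[OF gm, of H] B_vecs B_H
  by (subst lin_on_sum[OF subspace_vecs])
    (auto simp: lin_on_smul[OF subspace_vecs] fv.subspace_scale[OF subspace_vecs] subset_eq intro!: sum.cong)

text \<open>The sums over \<open>I\<close> are crude bounds for the single weights and degrees.
  Level n of the filtration uses degrees strictly below n, so level 0 is zero and the top level is
  the successor of the degree bound.\<close>

sublocale graded_gm_module m M "\<Sum>p\<in>I. \<bar>\<omega> p\<bar>" "\<lambda>n. fv.span (B ` {p \<in> I. dg p < n})" "Suc (\<Sum>p\<in>I. dg p)"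
proof
  show "gm_module m M" by (rule gm)
  let ?N = "\<Sum>p\<in>I. \<bar>\<omega> p\<bar>"
  show "\<exists>w. v = (\<Sum>\<mu>\<in>{- ?N..?N}. w \<mu>) \<and>
      (\<forall>\<mu>. w \<mu> \<in> vecs (car M) \<and> act M H (w \<mu>) = vsmul (of_int \<mu>) (w \<mu>))"
    if v: "v \<in> vecs (car M)" for v
  proof -
    obtain c where c: "v = (\<Sum>p\<in>I. vsmul (c p) (B p))"
      using v B_spans unfolding span_image_explicit[OF fin] by blast
    define w where "w \<mu> = (\<Sum>p\<in>{p \<in> I. \<omega> p = \<mu>}. vsmul (c p) (B p))" for \<mu>
    have "\<omega> ` I \<subseteq> {- ?N..?N}"
      using member_le_sum[OF _ _ fin, of _ "\<lambda>p. \<bar>\<omega> p\<bar>"] by (fastforce simp: abs_le_iff)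
    then have "(\<Sum>\<mu>\<in>{- ?N..?N}. w \<mu>) = v"
      unfolding w_def c by (intro sum.group fin) auto
    moreover have "w \<mu> \<in> vecs (car M)" for \<mu>
      unfolding w_def using B_vecs by (intro fv.subspace_sum fv.subspace_scale subspace_vecs) auto
    moreover have "act M H (w \<mu>) = vsmul (of_int \<mu>) (w \<mu>)" for \<mu>
      unfolding w_def by (subst act_H_sum) (auto simp: fv.scale_sum_right mult.commute intro!: sum.cong)
    ultimately show ?thesis by blast
  qed
  show "fv.span (B ` {p \<in> I. dg p < 0}) = {0}" by simp
  have "{p \<in> I. dg p < Suc (\<Sum>p\<in>I. dg p)} = I"
    using member_le_sum[OF _ _ fin, of _ dg] by (auto simp: less_Suc_eq_le)
  then show "vecs (car M) \<subseteq> fv.span (B ` {p \<in> I. dg p < Suc (\<Sum>p\<in>I. dg p)})"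
    using B_spans by simp
  show "act M (X k) v \<in> fv.span (B ` {p \<in> I. dg p < n})"
    if v: "v \<in> fv.span (B ` {p \<in> I. dg p < Suc n})" and k: "k \<le> m" for v n k
  proof -
    have lin: "lin_on (vecs (car M)) (act M (X k))" using gm_moduleD(3)[OF gm] k by simp
    have "fv.span (B ` {p \<in> I. dg p < Suc n})
        \<subseteq> {v \<in> vecs (car M). act M (X k) v \<in> fv.span (B ` {p \<in> I. dg p < n})}"
    proof (rule fv.span_minimal)
      have "act M (X k) (B p) \<in> fv.span (B ` {p \<in> I. dg p < n})" if "p \<in> I" "dg p < Suc n" for p
        using B_X[OF that(1) k] fv.span_mono[of "B ` {q \<in> I. dg q < dg p}" "B ` {p \<in> I. dg p < n}"] that
        by force
      then show "B ` {p \<in> I. dg p < Suc n}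
          \<subseteq> {v \<in> vecs (car M). act M (X k) v \<in> fv.span (B ` {p \<in> I. dg p < n})}"
        using B_vecs by auto
      show "fv.subspace {v \<in> vecs (car M). act M (X k) v \<in> fv.span (B ` {p \<in> I. dg p < n})}"
        by (rule subspace_lin_preimage[OF subspace_vecs lin fv.subspace_span])
    qed
    then show ?thesis using v by blast
  qed
qed

end

section \<open>Tensor products\<close>

text \<open>The pure tensor of two coordinate vectors.\<close>

definition tv :: "('i \<Rightarrow> 'a::field) \<Rightarrow> ('j \<Rightarrow> 'a) \<Rightarrow> 'i \<times> 'j \<Rightarrow> 'a" where
  "tv u v = (\<lambda>(x, y). u x * v y)"

lemma tv_add: "tv (u + u') v = tv u v + tv u' v" "tv u (v + v') = tv u v + tv u v'"
  by (auto simp: tv_def fun_eq_iff fun_apply algebra_simps)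

lemma tv_diff: "tv (u - u') v = tv u v - tv u' v" "tv u (v - v') = tv u v - tv u v'"
  by (auto simp: tv_def fun_eq_iff fun_apply algebra_simps)

lemma tv_smul: "tv (vsmul c u) v = vsmul c (tv u v)" "tv u (vsmul c v) = vsmul c (tv u v)"
  by (auto simp: tv_def fun_eq_iff fun_apply algebra_simps)

lemma tv_zero [simp]: "tv 0 v = 0" "tv u 0 = 0"
  by (auto simp: tv_def fun_eq_iff fun_apply)

lemma tv_sum: "tv (sum f A) v = (\<Sum>k\<in>A. tv (f k) v)" "tv u (sum g A) = (\<Sum>k\<in>A. tv u (g k))"
  by (auto simp: tv_def fun_eq_iff sum_fun_apply sum_distrib_left sum_distrib_right)

lemma tv_vecs: "u \<in> vecs A \<Longrightarrow> v \<in> vecs B \<Longrightarrow> tv u v \<in> vecs (A \<times> B)"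
  by (auto simp: tv_def vecs_def)

lemma tv_span:
  assumes "u \<in> fv.span A" "v \<in> fv.span B"
  shows "tv u v \<in> fv.span {tv x y | x y. x \<in> A \<and> y \<in> B}" (is "_ \<in> fv.span ?C")
proof -
  have 1: "tv x v \<in> fv.span ?C" if "x \<in> A" for x
    using assms(2)
  proof (induction rule: fv.span_induct_alt)
    case (step c y z)
    then show ?case using that
      by (simp only: tv_add tv_smul) (blast intro: fv.span_add fv.span_scale fv.span_base)
  qed (simp add: fv.span_zero)
  show ?thesis
    using assms(1)
  proof (induction rule: fv.span_induct_alt)
    case (step c y z)
    then show ?case using 1
      by (simp only: tv_add tv_smul) (blast intro: fv.span_add fv.span_scale)
  qed (simp add: fv.span_zero)
qed

lemma vecs_tens_span:
  fixes A :: "'i set" and B :: "'j set"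
  assumes "finite A" "finite B"
  shows "(vecs (A \<times> B) :: ('i \<times> 'j \<Rightarrow> 'a::field) set) \<subseteq> fv.span {tv u v | u v. u \<in> vecs A \<and> v \<in> vecs B}" (is "_ \<subseteq> fv.span ?C")
proof
  fix w :: "'i \<times> 'j \<Rightarrow> 'a" assume w: "w \<in> vecs (A \<times> B)"
  define \<delta> :: "'i \<Rightarrow> 'i \<Rightarrow> 'a" where "\<delta> x = (\<lambda>z. if z = x then 1 else 0)" for x
  define \<delta>' :: "'j \<Rightarrow> 'j \<Rightarrow> 'a" where "\<delta>' y = (\<lambda>z. if z = y then 1 else 0)" for y
  have w_eq: "w = (\<Sum>p\<in>A \<times> B. vsmul (w p) (tv (\<delta> (fst p)) (\<delta>' (snd p))))"
  proof
    fix q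
    have "(\<Sum>p\<in>A \<times> B. vsmul (w p) (tv (\<delta> (fst p)) (\<delta>' (snd p)))) q = (\<Sum>p\<in>A \<times> B. if p = q then w q else 0)"
      unfolding sum_fun_apply
      by (intro sum.cong refl) (cases q, auto simp: fun_apply tv_def \<delta>_def \<delta>'_def)
    also have "\<dots> = w q" using w assms by (cases q) (auto simp: vecs_def)
    finally show "w q = (\<Sum>p\<in>A \<times> B. vsmul (w p) (tv (\<delta> (fst p)) (\<delta>' (snd p)))) q" by simp
  qed
  have "(\<Sum>p\<in>A \<times> B. vsmul (w p) (tv (\<delta> (fst p)) (\<delta>' (snd p)))) \<in> fv.span ?C"
  proof (intro fv.span_sum fv.span_scale fv.span_base)
    fix p assume "p \<in> A \<times> B"
    then have "\<delta> (fst p) \<in> vecs A" "\<delta>' (snd p) \<in> vecs B" by (auto simp: \<delta>_def \<delta>'_def vecs_def)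
    then show "tv (\<delta> (fst p)) (\<delta>' (snd p)) \<in> ?C" by blast
  qed
  then show "w \<in> fv.span ?C" by (subst w_eq)
qed

lemma lin_on_compI:
  "lin_on D f \<Longrightarrow> (\<And>v. v \<in> D \<Longrightarrow> f v \<in> D') \<Longrightarrow> lin_on D' g \<Longrightarrow> lin_on D (\<lambda>v. g (f v))"
  by (simp add: lin_on_def)

lemma lin_on_diffI: "lin_on D f \<Longrightarrow> lin_on D g \<Longrightarrow> lin_on D (\<lambda>v. f v - g v)"
  by (simp add: lin_on_def fv.scale_right_diff_distrib)

lemma lin_on_smulI: "lin_on D f \<Longrightarrow> lin_on D (\<lambda>v. vsmul k (f v))"
  by (simp add: lin_on_def fv.scale_right_distrib mult.commute)

text \<open>Allows the module relations on a tensor product to be verified on pure tensors alone,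
  where the action is given by the Leibniz rule.\<close>

lemma lin_on_eq_tens:
  assumes fin: "finite A" "finite B"
    and lin: "lin_on (vecs (A \<times> B)) f" "lin_on (vecs (A \<times> B)) g"
    and eq: "\<And>u v. u \<in> vecs A \<Longrightarrow> v \<in> vecs B \<Longrightarrow> f (tv u v) = g (tv u v)"
    and w: "w \<in> vecs (A \<times> B)"
  shows "f w = g w"
proof -
  let ?C = "{tv u v | u v. u \<in> vecs A \<and> v \<in> vecs B}"
  have "fv.span ?C \<subseteq> {w \<in> vecs (A \<times> B). f w = g w}"
  proof (rule fv.span_minimal)
    show "fv.subspace {w \<in> vecs (A \<times> B). f w = g w}"
      using fv.subspace_0[OF subspace_vecs] fv.subspace_add[OF subspace_vecs] fv.subspace_scale[OF subspace_vecs]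
      by (auto simp: fv.subspace_def lin_on_add[OF subspace_vecs lin(1)] lin_on_smul[OF subspace_vecs lin(1)]
          lin_on_zero[OF subspace_vecs lin(1)] lin_on_add[OF subspace_vecs lin(2)]
          lin_on_smul[OF subspace_vecs lin(2)] lin_on_zero[OF subspace_vecs lin(2)])
  qed (use eq tv_vecs in auto)
  then show ?thesis using vecs_tens_span[OF fin] w by blast
qed

lemma gm_module_comm:
  assumes "gm_module m M" "u \<in> vecs (car M)"
  shows "comm M H E u = vsmul 2 (act M E u)" "comm M H F u = vsmul (- 2) (act M F u)"
    "comm M E F u = act M H u"
    "k \<le> m \<Longrightarrow> comm M H (X k) u = vsmul (of_int (int m - 2 * int k)) (act M (X k) u)"
    "k \<le> m \<Longrightarrow> comm M F (X k) u = (if k < m then act M (X (Suc k)) u else 0)"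
    "k \<le> m \<Longrightarrow> comm M E (X k) u = (if 0 < k then vsmul (of_nat (k * (m - k + 1))) (act M (X (k - 1)) u) else 0)"
    "j \<le> m \<Longrightarrow> k \<le> m \<Longrightarrow> comm M (X j) (X k) u = 0"
  using assms unfolding gm_module_def vzero_eq by blast+

locale gm_module_pair =
  fixes m :: nat and V :: "('a::field_char_0, 'i) gmod" and W :: "('a, 'j) gmod"
  assumes gmV: "gm_module m V" and gmW: "gm_module m W"
begin

lemma car_tens: "car (tens V W) = car V \<times> car W"
  by (simp add: tens_def car_def)

lemma slice_vecs:
  assumes "w \<in> vecs (car V \<times> car W)"
  shows "(\<lambda>x. w (x, y)) \<in> vecs (car V)" "(\<lambda>y. w (x, y)) \<in> vecs (car W)"
  using assms by (auto simp: vecs_def)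

lemma act_tens: "act (tens V W) b w = (\<lambda>(x, y). act V b (\<lambda>x'. w (x', y)) x + act W b (\<lambda>y'. w (x, y')) y)"
  by (simp add: tens_def act_def)

lemma act_tens_tv:
  assumes b: "valid_gmb m b" and u: "u \<in> vecs (car V)" and v: "v \<in> vecs (car W)"
  shows "act (tens V W) b (tv u v) = tv (act V b u) v + tv u (act W b v)"
proof
  fix p :: "'i \<times> 'j"
  obtain x y where p: "p = (x, y)" by (cases p)
  have "(\<lambda>x'. tv u v (x', y)) = vsmul (v y) u" "(\<lambda>y'. tv u v (x, y')) = vsmul (u x) v"
    by (auto simp: tv_def fun_eq_iff fun_apply)
  then show "act (tens V W) b (tv u v) p = (tv (act V b u) v + tv u (act W b v)) p"
    using lin_on_smul[OF subspace_vecs gm_moduleD(3)[OF gmV b] u]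
      lin_on_smul[OF subspace_vecs gm_moduleD(3)[OF gmW b] v]
    by (simp add: p act_tens fun_apply tv_def)
qed

lemma act_tens_vecs:
  assumes b: "valid_gmb m b" and w: "w \<in> vecs (car V \<times> car W)"
  shows "act (tens V W) b w \<in> vecs (car V \<times> car W)"
proof -
  have 0: "act V b 0 = 0" "act W b 0 = 0"
    using lin_on_zero[OF subspace_vecs gm_moduleD(3)[OF gmV b]]
      lin_on_zero[OF subspace_vecs gm_moduleD(3)[OF gmW b]] by auto
  have "act V b (\<lambda>x'. w (x', y)) x + act W b (\<lambda>y'. w (x, y')) y = 0" if "(x, y) \<notin> car V \<times> car W" for x y
  proof -
    have "act V b (\<lambda>x'. w (x', y)) x = 0"
    proof (cases "y \<in> car W")
      case True
      then show ?thesis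
        using that gm_moduleD(2)[OF gmV b slice_vecs(1)[OF w]] by (auto simp: vecs_def)
    next
      case False
      then have "(\<lambda>x'. w (x', y)) = 0" using w by (auto simp: vecs_def fun_eq_iff fun_apply)
      then show ?thesis by (simp add: 0 fun_apply)
    qed
    moreover have "act W b (\<lambda>y'. w (x, y')) y = 0"
    proof (cases "x \<in> car V")
      case True
      then show ?thesis
        using that gm_moduleD(2)[OF gmW b slice_vecs(2)[OF w]] by (auto simp: vecs_def)
    next
      case False
      then have "(\<lambda>y'. w (x, y')) = 0" using w by (auto simp: vecs_def fun_eq_iff fun_apply)
      then show ?thesis by (simp add: 0 fun_apply)
    qed
    ultimately show ?thesis by simp
  qed
  then show ?thesis by (auto simp: vecs_def act_tens)
qed

lemma act_tens_lin:
  assumes b: "valid_gmb m b"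
  shows "lin_on (vecs (car V \<times> car W)) (act (tens V W) b)"
proof -
  note lV = gm_moduleD(3)[OF gmV b] and lW = gm_moduleD(3)[OF gmW b]
  have "act (tens V W) b (u + v) = act (tens V W) b u + act (tens V W) b v"
    if "u \<in> vecs (car V \<times> car W)" "v \<in> vecs (car V \<times> car W)" for u v
  proof (rule ext, clarify)
    fix x y
    have "(\<lambda>x. (u + v) (x, y)) = (\<lambda>x. u (x, y)) + (\<lambda>x. v (x, y))"
      "(\<lambda>y. (u + v) (x, y)) = (\<lambda>y. u (x, y)) + (\<lambda>y. v (x, y))"
      by (auto simp: fun_apply)
    then show "act (tens V W) b (u + v) (x, y) = (act (tens V W) b u + act (tens V W) b v) (x, y)"
      using lin_on_add[OF subspace_vecs lV slice_vecs(1)[OF that(1)] slice_vecs(1)[OF that(2)]]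
        lin_on_add[OF subspace_vecs lW slice_vecs(2)[OF that(1)] slice_vecs(2)[OF that(2)]]
      by (simp add: act_tens fun_apply)
  qed
  moreover have "act (tens V W) b (vsmul c v) = vsmul c (act (tens V W) b v)"
    if "v \<in> vecs (car V \<times> car W)" for c v
  proof (rule ext, clarify)
    fix x y
    have "(\<lambda>x. vsmul c v (x, y)) = vsmul c (\<lambda>x. v (x, y))"
      "(\<lambda>y. vsmul c v (x, y)) = vsmul c (\<lambda>y. v (x, y))"
      by (auto simp: fun_apply)
    then show "act (tens V W) b (vsmul c v) (x, y) = vsmul c (act (tens V W) b v) (x, y)"
      using lin_on_smul[OF subspace_vecs lV slice_vecs(1)[OF that]]
        lin_on_smul[OF subspace_vecs lW slice_vecs(2)[OF that]]
      by (simp add: act_tens fun_apply distrib_left)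
  qed
  ultimately show ?thesis by (simp add: lin_on_def)
qed

text \<open>On a pure tensor the mixed terms, with one generator acting on each factor, cancel in
  the commutator, so commutators obey the Leibniz rule too. Every bracket of basis elements is a
  scalar times one basis element, hence the single scalar \<open>k\<close>.\<close>

lemma comm_tens:
  assumes bcd: "valid_gmb m b" "valid_gmb m c" "valid_gmb m d"
    and V: "\<And>u. u \<in> vecs (car V) \<Longrightarrow> comm V b c u = vsmul k (act V d u)"
    and W: "\<And>u. u \<in> vecs (car W) \<Longrightarrow> comm W b c u = vsmul k (act W d u)"
    and w: "w \<in> vecs (car V \<times> car W)"
  shows "comm (tens V W) b c w = vsmul k (act (tens V W) d w)"
proof (rule lin_on_eq_tens[OF gm_moduleD(1)[OF gmV] gm_moduleD(1)[OF gmW] _ _ _ w])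
  show "lin_on (vecs (car V \<times> car W)) (comm (tens V W) b c)"
    unfolding comm_def vsub_eq using bcd
    by (intro lin_on_diffI lin_on_compI[OF act_tens_lin act_tens_vecs act_tens_lin])
  show "lin_on (vecs (car V \<times> car W)) (\<lambda>w. vsmul k (act (tens V W) d w))"
    using bcd by (intro lin_on_smulI act_tens_lin)
  fix u :: "'i \<Rightarrow> 'a" and v :: "'j \<Rightarrow> 'a" assume uv: "u \<in> vecs (car V)" "v \<in> vecs (car W)"
  note closed = gm_moduleD(2)[OF gmV] gm_moduleD(2)[OF gmW]
  have "act (tens V W) b' (act (tens V W) c' (tv u v))
      = tv (act V b' (act V c' u)) v + tv (act V c' u) (act W b' v)
        + (tv (act V b' u) (act W c' v) + tv u (act W b' (act W c' v)))"
    if "valid_gmb m b'" "valid_gmb m c'" for b' c'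
    using that uv closed
    by (simp add: act_tens_tv lin_on_add[OF subspace_vecs act_tens_lin] tv_vecs)
  then have "comm (tens V W) b c (tv u v) = tv (comm V b c u) v + tv u (comm W b c v)"
    using bcd by (simp add: comm_def tv_diff)
  also have "\<dots> = vsmul k (act (tens V W) d (tv u v))"
    using uv V W bcd by (simp add: act_tens_tv tv_smul fv.scale_right_distrib)
  finally show "comm (tens V W) b c (tv u v) = vsmul k (act (tens V W) d (tv u v))" .
qed

lemma gm_module_tens: "gm_module m (tens V W)"
proof -
  note V = gm_module_comm[OF gmV] and W = gm_module_comm[OF gmW]
  show ?thesis
    unfolding gm_module_def vzero_eq car_tens
  proof (intro conjI allI ballI impI)
    show "finite (car V \<times> car W)" using gm_moduleD(1)[OF gmV] gm_moduleD(1)[OF gmW] by simp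
    fix w :: "'i \<times> 'j \<Rightarrow> 'a" assume w: "w \<in> vecs (car V \<times> car W)"
    show "comm (tens V W) H E w = vsmul 2 (act (tens V W) E w)"
      by (rule comm_tens[OF _ _ _ _ _ w]) (simp_all add: V W)
    show "comm (tens V W) H F w = vsmul (- 2) (act (tens V W) F w)"
      by (rule comm_tens[OF _ _ _ _ _ w]) (simp_all add: V(2) W(2))
    show "comm (tens V W) E F w = act (tens V W) H w"
      using comm_tens[of E F H 1 w] w by (simp add: V W)
    fix k assume k: "k \<le> m"
    show "comm (tens V W) H (X k) w = vsmul (of_int (int m - 2 * int k)) (act (tens V W) (X k) w)"
      by (rule comm_tens[OF _ _ _ _ _ w]) (use k in \<open>simp_all add: V(4) W(4)\<close>)
    show "comm (tens V W) F (X k) w = (if k < m then act (tens V W) (X (Suc k)) w else 0)"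
    proof (cases "k < m")
      case True
      then show ?thesis using comm_tens[of F "X k" "X (Suc k)" 1 w] w by (simp add: V(5) W(5))
    next
      case False
      \<comment> \<open>A vanishing bracket is presented as 0 times some valid generator.\<close>
      then show ?thesis using comm_tens[of F "X k" "X k" 0 w] w k by (simp add: V(5) W(5))
    qed
    show "comm (tens V W) E (X k) w
      = (if 0 < k then vsmul (of_nat (k * (m - k + 1))) (act (tens V W) (X (k - 1)) w) else 0)"
    proof (cases "0 < k")
      case True
      have "comm (tens V W) E (X k) w = vsmul (of_nat (k * (m - k + 1))) (act (tens V W) (X (k - 1)) w)"
        by (rule comm_tens[OF _ _ _ _ _ w]) (use k True V(6)[OF _ k] W(6)[OF _ k] in simp_all)
      then show ?thesis using True by simp
    next
      case False
      then show ?thesis using comm_tens[of E "X k" "X k" 0 w] w k V(6)[OF _ k] W(6)[OF _ k] by simp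
    qed
    fix j assume j: "j \<le> m"
    show "comm (tens V W) (X j) (X k) w = 0"
      using comm_tens[of "X j" "X k" "X k" 0 w] w k j by (simp add: V(7) W(7))
  qed (use act_tens_lin act_tens_vecs in auto)
qed

end

section \<open>Highest weight vectors in coordinates\<close>

text \<open>The coefficients of \<open>e v\<close> when \<open>v\<close> has coefficients
  \<open>c\<close>; the entry at k comes from index k + 1.\<close>

definition eC :: "(nat \<Rightarrow> nat) \<Rightarrow> (nat \<times> nat \<Rightarrow> 'a::field_char_0) \<Rightarrow> nat \<times> nat \<Rightarrow> 'a" where
  "eC a c p = of_int ((int (snd p) + 1) * (int (a (fst p)) - int (snd p))) * c (fst p, Suc (snd p))"

text \<open>The coefficients of \<open>x_m v\<close>: the entry in layer i comes from layer i + 1,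
  shifted by \<sigma>. In the top layer this reads \<open>c\<close> outside the index set, which is
  why its users require \<open>c\<close> to vanish there.\<close>

definition xC :: "nat \<Rightarrow> (nat \<times> nat \<Rightarrow> 'a::field_char_0) \<Rightarrow> nat \<times> nat \<Rightarrow> 'a" where
  "xC \<sigma> c p = (if \<sigma> \<le> snd p then c (Suc (fst p), snd p - \<sigma>) else 0)"

definition idx :: "nat \<Rightarrow> (nat \<Rightarrow> nat) \<Rightarrow> (nat \<times> nat) set" where
  "idx l a = Sigma {..l} (\<lambda>i. {..a i})"

lemma idx_iff [simp]: "(i, k) \<in> idx l a \<longleftrightarrow> i \<le> l \<and> k \<le> a i"
  by (auto simp: idx_def)

lemma finite_idx [simp]: "finite (idx l a)"
  by (simp add: idx_def)

lemma sum_idx: "sum f (idx l a) = (\<Sum>i\<le>l. \<Sum>k\<le>a i. f (i, k))"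
  unfolding idx_def by (subst sum.Sigma) auto

context z_basis
begin

lemma lin_act: "valid_gmb m b \<Longrightarrow> lin_on (vecs (car M)) (act M b)"
  by (rule gm_moduleD(3)[OF gm])

lemma act_sum_idx:
  assumes "valid_gmb m b"
  shows "act M b (\<Sum>p\<in>idx l a. vsmul (c p) (\<beta> p)) = (\<Sum>p\<in>idx l a. vsmul (c p) (act M b (\<beta> p)))"
  using \<beta>_vecs by (simp add: lin_on_sum[OF subspace_vecs lin_act[OF assms]]
      lin_on_smul[OF subspace_vecs lin_act[OF assms]] fv.subspace_scale[OF subspace_vecs])

lemma act_E_sum:
  "act M E (\<Sum>p\<in>idx l a. vsmul (c p) (\<beta> p)) = (\<Sum>p\<in>idx l a. vsmul (eC a c p) (\<beta> p))"
  unfolding act_sum_idx[OF valid_gmb_simps(1)]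
  unfolding sum_idx
proof (rule sum.cong[OF refl])
  fix i
  have "(\<Sum>k\<le>a i. vsmul (c (i, k)) (act M E (\<beta> (i, k))))
    = (\<Sum>k<a i. vsmul (eC a c (i, k)) (\<beta> (i, k)))"
    unfolding sum.atMost_shift act_E_0 act_E_Suc fv.scale_scale fv.scale_zero_right add_0_left
    by (simp only: eC_def mult.commute fst_conv snd_conv)
  also have "\<dots> = (\<Sum>k\<le>a i. vsmul (eC a c (i, k)) (\<beta> (i, k)))"
    by (simp add: eC_def flip: lessThan_Suc_atMost)
  finally show "(\<Sum>k\<le>a i. vsmul (c (i, k)) (act M E (\<beta> (i, k))))
    = (\<Sum>k\<le>a i. vsmul (eC a c (i, k)) (\<beta> (i, k)))" .
qed

lemma act_Xm_sum:
  assumes supp: "\<And>p. p \<notin> idx l a \<Longrightarrow> c p = 0"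
  shows "act M (X m) (\<Sum>p\<in>idx l a. vsmul (c p) (\<beta> p)) = (\<Sum>p\<in>idx l a. vsmul (xC \<sigma> c p) (\<beta> p))"
proof -
  have step: "(\<Sum>k\<le>a (Suc i). vsmul (c (Suc i, k)) (\<beta> (i, k + \<sigma>))) = (\<Sum>k\<le>a i. vsmul (xC \<sigma> c (i, k)) (\<beta> (i, k)))"
    if "i < l" for i
  proof -
    \<comment> \<open>A common range long enough for both layers: the coefficients vanish beyond
      \<open>a (Suc i)\<close> and the basis vectors beyond \<open>a i\<close>, so the shift by
      \<sigma> becomes a plain change of index that can be trimmed on either side.\<close>
    define n where "n = a i + a (Suc i)"
    have "(\<Sum>k\<le>a (Suc i). vsmul (c (Suc i, k)) (\<beta> (i, k + \<sigma>))) = (\<Sum>k\<in>{0..n}. vsmul (c (Suc i, k)) (\<beta> (i, k + \<sigma>)))"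
      using supp by (intro sum.mono_neutral_left) (auto simp: n_def)
    also have "\<dots> = (\<Sum>k\<in>{0 + \<sigma>..n + \<sigma>}. vsmul (c (Suc i, k - \<sigma>)) (\<beta> (i, k)))"
      by (subst sum.shift_bounds_cl_nat_ivl) simp
    also have "\<dots> = (\<Sum>k\<in>{0 + \<sigma>..n + \<sigma>}. vsmul (xC \<sigma> c (i, k)) (\<beta> (i, k)))"
      by (intro sum.cong) (auto simp: xC_def)
    also have "\<dots> = (\<Sum>k\<le>n + \<sigma>. vsmul (xC \<sigma> c (i, k)) (\<beta> (i, k)))"
      by (intro sum.mono_neutral_left) (auto simp: xC_def)
    also have "\<dots> = (\<Sum>k\<le>a i. vsmul (xC \<sigma> c (i, k)) (\<beta> (i, k)))"
      using \<beta>_zero by (intro sum.mono_neutral_right) (auto simp: n_def)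
    finally show ?thesis .
  qed
  have "act M (X m) (\<Sum>p\<in>idx l a. vsmul (c p) (\<beta> p))
    = (\<Sum>i\<le>l. \<Sum>k\<le>a i. vsmul (c (i, k)) (act M (X m) (\<beta> (i, k))))"
    by (subst act_sum_idx) (simp_all add: sum_idx)
  also have "\<dots> = (\<Sum>i<l. \<Sum>k\<le>a (Suc i). vsmul (c (Suc i, k)) (act M (X m) (\<beta> (Suc i, k))))"
    by (simp add: sum.atMost_shift act_X_0)
  also have "\<dots> = (\<Sum>i<l. \<Sum>k\<le>a (Suc i). vsmul (c (Suc i, k)) (\<beta> (i, k + \<sigma>)))"
    by (simp add: act_Xm)
  also have "\<dots> = (\<Sum>i<l. \<Sum>k\<le>a i. vsmul (xC \<sigma> c (i, k)) (\<beta> (i, k)))"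
    by (intro sum.cong refl step) simp
  also have "\<dots> = (\<Sum>i\<le>l. \<Sum>k\<le>a i. vsmul (xC \<sigma> c (i, k)) (\<beta> (i, k)))"
  proof -
    have "xC \<sigma> c (l, k) = 0" for k using supp by (simp add: xC_def)
    then have "(\<Sum>k\<le>a l. vsmul (xC \<sigma> c (l, k)) (\<beta> (l, k))) = 0" by simp
    then show ?thesis unfolding lessThan_Suc_atMost[symmetric, of l] sum.lessThan_Suc by simp
  qed
  finally show ?thesis by (simp add: sum_idx)
qed

lemma idx_indep:
  "(\<Sum>p\<in>idx l a. vsmul (c p) (\<beta> p)) = 0 \<Longrightarrow> p \<in> idx l a \<Longrightarrow> c p = 0"
  using indep[of c "fst p" "snd p"] by (cases p) (auto simp: idx_def)

lemma act_X_span: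
  assumes "(i, s) \<in> idx l a" "k \<le> m"
  shows "act M (X k) (\<beta> (i, s)) \<in> fv.span (\<beta> ` {q \<in> idx l a. fst q < i})"
proof (cases i)
  case 0
  then show ?thesis using assms by (simp add: act_X_0 fv.span_zero)
next
  case (Suc j)
  then have "act M (X k) (\<beta> (i, s)) \<in> fv.span (\<beta> ` ({j} \<times> {..a j}))"
    using assms act_X_Suc[of k j s] U_span[of j] by simp
  also have "\<dots> \<subseteq> fv.span (\<beta> ` {q \<in> idx l a. fst q < i})"
    using assms Suc by (intro fv.span_mono image_mono) auto
  finally show ?thesis .
qed

end

sublocale z_basis \<subseteq> bg: based_gm_module m M "idx l a" \<beta> "\<lambda>p. int (a (fst p)) - 2 * int (snd p)" fst
proof
  show "vecs (car M) \<subseteq> fv.span (\<beta> ` idx l a)" using spans by (simp add: idx_def)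
  show "act M (X k) (\<beta> p) \<in> fv.span (\<beta> ` {q \<in> idx l a. fst q < fst p})" if "p \<in> idx l a" "k \<le> m" for p k
    using act_X_span[of "fst p" "snd p" k] that by simp
qed (auto simp: gm \<beta>_vecs act_H)

context z_basis
begin

text \<open>In a single module every equation has just one term: the \<open>e\<close>-equations kill
  all coefficients at positive exponents, the \<open>x_m\<close>-equations those at exponent 0 in
  higher layers. Only the highest weight vector of the bottom layer survives.\<close>

lemma socle_eq: "socle m M = U 0"
proof -
  have F_pow: "(act M F ^^ k) (\<beta> (i, 0)) = \<beta> (i, k)" for i k
    by (induction k) (simp_all add: act_F)
  define R where "R = r_inv m M (vecs (car M))"
  have R: "bg.stable R" unfolding R_def by (rule bg.r_inv_stable[OF bg.vecs_stable])
  interpret hw_family "vecs (car M)" "act M E" "act M F" "act M H"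
    "\<Sum>p\<in>idx l a. \<bar>int (a (fst p)) - 2 * int (snd p)\<bar>" R "{a 0}" "\<lambda>_. \<beta> (0, 0)"
  proof
    show "bg.stable R" by (rule R)
    show "finite {a 0}" by simp
    show "\<beta> (0, 0) \<in> R" by (simp add: R_def r_inv_def \<beta>_vecs act_X_0)
    show "\<beta> (0, 0) \<noteq> 0"
    proof
      assume "\<beta> (0, 0) = 0"
      then have "(\<Sum>p\<in>idx l a. vsmul (if p = (0, 0) then 1 else 0) (\<beta> p)) = 0"
        by (intro sum.neutral) auto
      then have "(if (0 :: nat, 0 :: nat) = (0, 0) then 1 else (0 :: 'a)) = 0" by (rule idx_indep) simp
      then show False by simp
    qed
    show "act M E (\<beta> (0, 0)) = 0" by (rule act_E_0)
    show "\<beta> (0, 0) \<in> bg.wt (int c)" if "c \<in> {a 0}" for c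
      using that by (simp add: bg.wt_def \<beta>_vecs act_H)
    fix v \<mu> assume v: "v \<in> R" "act M E v = 0" "v \<in> bg.wt \<mu>" "v \<noteq> 0"
    have "v \<in> fv.span (\<beta> ` idx l a)" using v(1) bg.B_spans by (auto simp: R_def r_inv_def)
    then obtain c' where c': "v = (\<Sum>p\<in>idx l a. vsmul (c' p) (\<beta> p))"
      by (auto simp: span_image_explicit)
    define c where "c p = (if p \<in> idx l a then c' p else 0)" for p
    have c: "v = (\<Sum>p\<in>idx l a. vsmul (c p) (\<beta> p))" unfolding c' by (simp add: c_def)
    have supp: "c p = 0" if "p \<notin> idx l a" for p using that by (simp add: c_def)
    have "act M (X m) v = 0" using v(1) by (simp add: R_def r_inv_def)
    then have x0: "xC \<sigma> c p = 0" if "p \<in> idx l a" for p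
      using idx_indep[of "xC \<sigma> c"] act_Xm_sum[OF supp] that c by simp
    have e0: "eC a c p = 0" if "p \<in> idx l a" for p
      using idx_indep[of "eC a c"] act_E_sum[of c] that c v(2) by simp
    have "c (i, Suc k) = 0" for i k
    proof (cases "(i, Suc k) \<in> idx l a")
      case True
      then have "eC a c (i, k) = 0" by (intro e0) simp
      moreover have "(int k + 1) * (int (a i) - int k) \<noteq> 0" using True by simp
      ultimately show ?thesis unfolding eC_def fst_conv snd_conv mult_eq_0_iff of_int_eq_0_iff by blast
    qed (rule supp)
    moreover have "c (Suc i, 0) = 0" for i
    proof (cases "Suc i \<le> l")
      case True
      \<comment> \<open>The equation at exponent \<sigma> is the one that reads the coefficient at
        exponent 0 of the layer above; \<open>\<sigma>_le\<close> keeps it within range.\<close>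
      then have "xC \<sigma> c (i, \<sigma>) = 0" using \<sigma>_le[OF True] by (intro x0) simp
      then show ?thesis by (simp add: xC_def)
    qed (use supp in auto)
    ultimately have "c p = 0" if "p \<noteq> (0, 0)" for p
      using that by (cases p; cases "fst p"; cases "snd p") auto
    then have "v = (\<Sum>p\<in>{(0, 0)}. vsmul (c p) (\<beta> p))"
      unfolding c by (intro sum.mono_neutral_right) auto
    then show "\<exists>c\<in>{a 0}. \<exists>k. v = vsmul k (\<beta> (0, 0))" by auto
  qed
  have "gens \<subseteq> U 0"
  proof (clarsimp simp: gens_def F_pow)
    fix k
    show "\<beta> (0, k) \<in> U 0"
      using \<beta>_zero[of 0 k] by (cases "k \<le> a 0") (auto simp: U_span fv.span_zero intro!: fv.span_base)
  qed
  moreover have "\<beta> ` ({0} \<times> {..a 0}) \<subseteq> gens" by (auto simp: gens_def F_pow)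
  ultimately have "fv.span gens = U 0"
    using fv.span_mono[of "\<beta> ` ({0} \<times> {..a 0})" gens] fv.span_minimal[of gens "U 0"]
    by (simp add: U_span antisym)
  then show ?thesis
    using bg.socle_eq_r_inv[OF hw_family_axioms[unfolded R_def]] span_gens_eq by (simp add: R_def)
qed

end

text \<open>The coordinate form of being killed by \<open>e\<close> and \<open>x_m\<close>. For
  vectors killed by \<open>e\<close> the latter already means being killed by \<open>r\<close>.
  Neither a weight nor a degree is prescribed.\<close>

definition hw_sys ::
  "nat \<Rightarrow> (nat \<Rightarrow> nat) \<Rightarrow> nat \<Rightarrow> nat \<Rightarrow> (nat \<Rightarrow> nat) \<Rightarrow> nat \<Rightarrow> ((nat \<times> nat) \<times> nat \<times> nat \<Rightarrow> 'a::field_char_0) \<Rightarrow> bool"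
  where
  "hw_sys l a \<sigma> l' b \<tau> c \<longleftrightarrow> (\<forall>p. p \<notin> idx l a \<times> idx l' b \<longrightarrow> c p = 0) \<and>
    (\<forall>p\<in>idx l a. \<forall>q\<in>idx l' b. eC a (\<lambda>p'. c (p', q)) p + eC b (\<lambda>q'. c (p, q')) q = 0) \<and>
    (\<forall>p\<in>idx l a. \<forall>q\<in>idx l' b. xC \<sigma> (\<lambda>p'. c (p', q)) p + xC \<tau> (\<lambda>q'. c (p, q')) q = 0)"

definition pdeg :: "(nat \<times> nat) \<times> nat \<times> nat \<Rightarrow> nat" where
  "pdeg p = fst (fst p) + fst (snd p)"

definition pwt :: "(nat \<Rightarrow> nat) \<Rightarrow> (nat \<Rightarrow> nat) \<Rightarrow> (nat \<times> nat) \<times> nat \<times> nat \<Rightarrow> int" where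
  "pwt a b p = (int (a (fst (fst p))) - 2 * int (snd (fst p))) + (int (b (fst (snd p))) - 2 * int (snd (snd p)))"

text \<open>\<open>Ty\<close> indexes the highest weight vectors in the \<open>r\<close>-invariants by their degree \<open>t = i + j\<close> and a further
  parameter \<open>k\<close>; \<open>om\<close> gives their weights. The second condition says that a solution is determined by
  its coefficients at the positions \<open>base y\<close>.\<close>

definition hw_types ::
  "nat \<Rightarrow> (nat \<Rightarrow> nat) \<Rightarrow> nat \<Rightarrow> nat \<Rightarrow> (nat \<Rightarrow> nat) \<Rightarrow> nat \<Rightarrow> 'a::field_char_0 itself \<Rightarrow>
    (nat \<times> nat) set \<Rightarrow> (nat \<times> nat \<Rightarrow> (nat \<times> nat) \<times> nat \<times> nat) \<Rightarrow> (nat \<times> nat \<Rightarrow> nat) \<Rightarrow> bool"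
  where
  "hw_types l a \<sigma> l' b \<tau> (_ :: 'a itself) Ty base om \<longleftrightarrow> finite Ty \<and> inj_on om Ty \<and>
    (\<forall>c :: _ \<Rightarrow> 'a. hw_sys l a \<sigma> l' b \<tau> c \<longrightarrow>
      (\<forall>p. c p \<noteq> 0 \<longrightarrow> (\<exists>k. (pdeg p, k) \<in> Ty \<and> c (base (pdeg p, k)) \<noteq> 0))) \<and>
    (\<forall>y\<in>Ty. \<exists>c :: _ \<Rightarrow> 'a. hw_sys l a \<sigma> l' b \<tau> c \<and> c (base y) \<noteq> 0 \<and>
      (\<forall>p. c p \<noteq> 0 \<longrightarrow> pdeg p = fst y \<and> pwt a b p = int (om y)))"

lemma hw_sys_comb:
  assumes "hw_sys l a \<sigma> l' b \<tau> c" "hw_sys l a \<sigma> l' b \<tau> d"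
  shows "hw_sys l a \<sigma> l' b \<tau> (\<lambda>p. c p - k * d p)"
proof -
  have eC: "eC a (\<lambda>p. f p - k * g p) p = eC a f p - k * eC a g p" for a p and f g :: "_ \<Rightarrow> 'a"
    by (simp add: eC_def right_diff_distrib mult.left_commute del: of_int_mult)
  have xC: "xC \<sigma> (\<lambda>p. f p - k * g p) p = xC \<sigma> f p - k * xC \<sigma> g p" for \<sigma> p and f g :: "_ \<Rightarrow> 'a"
    by (simp add: xC_def)
  have sub: "x - k * y + (x' - k * y') = (x + x') - k * (y + y')" for x y x' y' :: 'a
    by (simp add: algebra_simps)
  show ?thesis using assms unfolding hw_sys_def eC xC sub by simp
qed

lemma (in z_basis) act_sl2_span:
  assumes "p \<in> idx l a" "b \<in> {E, F, H}"
  shows "act M b (\<beta> p) \<in> fv.span (\<beta> ` {q \<in> idx l a. fst q = fst p})"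
proof -
  obtain i k where p: "p = (i, k)" by (cases p)
  have mem: "\<beta> (i, k') \<in> fv.span (\<beta> ` {q \<in> idx l a. fst q = fst p})" for k'
    using assms(1) \<beta>_zero[of i k'] p
    by (cases "k' \<le> a i") (auto simp: fv.span_zero intro!: fv.span_base)
  show ?thesis
    using assms(2) mem p
    by (cases k) (auto simp: act_E_0 act_E_Suc act_F act_H fv.span_zero fv.span_scale simp del: of_int_mult)
qed

section \<open>The tensor product of two modules of type Z in coordinates\<close>

locale z_pair = V: z_basis m V U l a \<sigma> \<beta> + W: z_basis m W U' l' b \<tau> \<beta>'
  for m and V :: "('a::field_char_0, 'i) gmod" and U l a \<sigma> \<beta>
    and W :: "('a, 'j) gmod" and U' l' b \<tau> \<beta>'
begin

sublocale gm_module_pair m V W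
  by (rule gm_module_pair.intro) (rule V.gm, rule W.gm)

abbreviation P :: "((nat \<times> nat) \<times> nat \<times> nat) set" where
  "P \<equiv> idx l a \<times> idx l' b"

definition BB :: "(nat \<times> nat) \<times> nat \<times> nat \<Rightarrow> 'i \<times> 'j \<Rightarrow> 'a" where
  "BB p = tv (\<beta> (fst p)) (\<beta>' (snd p))"

definition vec :: "((nat \<times> nat) \<times> nat \<times> nat \<Rightarrow> 'a) \<Rightarrow> 'i \<times> 'j \<Rightarrow> 'a" where
  "vec c = (\<Sum>p\<in>P. vsmul (c p) (BB p))"

lemma BB_vecs: "BB p \<in> vecs (car V \<times> car W)"
  unfolding BB_def by (intro tv_vecs V.\<beta>_vecs W.\<beta>_vecs)

lemma act_BB:
  "valid_gmb m x \<Longrightarrow> act (tens V W) x (BB p)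
    = tv (act V x (\<beta> (fst p))) (\<beta>' (snd p)) + tv (\<beta> (fst p)) (act W x (\<beta>' (snd p)))"
  unfolding BB_def by (rule act_tens_tv) (auto simp: V.\<beta>_vecs W.\<beta>_vecs)

lemma tv_span_BB:
  assumes "u \<in> fv.span (\<beta> ` A)" "v \<in> fv.span (\<beta>' ` B)" "A \<times> B \<subseteq> Q"
  shows "tv u v \<in> fv.span (BB ` Q)"
proof -
  have "{tv x y | x y. x \<in> \<beta> ` A \<and> y \<in> \<beta>' ` B} \<subseteq> BB ` Q"
  proof clarify
    fix p q assume "p \<in> A" "q \<in> B"
    then have "(p, q) \<in> Q" using assms(3) by blast
    then show "tv (\<beta> p) (\<beta>' q) \<in> BB ` Q" by (rule rev_image_eqI) (simp add: BB_def)
  qed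
  then show ?thesis using tv_span[OF assms(1,2)] fv.span_mono by blast
qed

text \<open>By the Leibniz rule, each term of the action of \<open>r\<close> lowers the layer index
  of one factor and keeps the other, so the total degree i + j grades the nilpotency.\<close>

sublocale T: based_gm_module m "tens V W" P BB "pwt a b" pdeg
proof
  show "gm_module m (tens V W)" by (rule gm_module_tens)
  show "finite P" by simp
  show "BB p \<in> vecs (car (tens V W))" for p using BB_vecs by (simp add: car_tens)
  have "tv u v \<in> fv.span (BB ` P)" if "u \<in> vecs (car V)" "v \<in> vecs (car W)" for u v
    by (rule tv_span_BB[of u "idx l a" v "idx l' b"]) (use that V.bg.B_spans W.bg.B_spans in auto)
  then have "fv.span {tv u v | u v. u \<in> vecs (car V) \<and> v \<in> vecs (car W)} \<subseteq> fv.span (BB ` P)"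
    by (intro fv.span_minimal) auto
  then show "vecs (car (tens V W)) \<subseteq> fv.span (BB ` P)"
    using vecs_tens_span[OF gm_moduleD(1)[OF V.gm] gm_moduleD(1)[OF W.gm]] unfolding car_tens by fastforce
  show "act (tens V W) H (BB p) = vsmul (of_int (pwt a b p)) (BB p)" if "p \<in> P" for p
    using V.act_H[of "fst (fst p)" "snd (fst p)"] W.act_H[of "fst (snd p)" "snd (snd p)"]
    by (subst act_BB) (simp_all add: tv_smul pwt_def BB_def fv.scale_left_distrib)
  fix p k assume p: "p \<in> P" and k: "k \<le> m"
  obtain i s j t where ps: "p = ((i, s), (j, t))" by (cases p) auto
  have "tv (act V (X k) (\<beta> (i, s))) (\<beta>' (j, t)) \<in> fv.span (BB ` {q \<in> P. pdeg q < pdeg p})"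
    by (rule tv_span_BB[OF V.act_X_span[OF _ k] fv.span_base[of _ "\<beta>' ` {(j, t)}"]])
      (use p ps in \<open>auto simp: pdeg_def\<close>)
  moreover have "tv (\<beta> (i, s)) (act W (X k) (\<beta>' (j, t))) \<in> fv.span (BB ` {q \<in> P. pdeg q < pdeg p})"
    by (rule tv_span_BB[OF fv.span_base[of _ "\<beta> ` {(i, s)}"] W.act_X_span[OF _ k]])
      (use p ps in \<open>auto simp: pdeg_def\<close>)
  ultimately show "act (tens V W) (X k) (BB p) \<in> fv.span (BB ` {q \<in> P. pdeg q < pdeg p})"
    using k ps by (simp add: act_BB fv.span_add)
qed

text \<open>Fixing a coordinate \<open>y\<close> of the second factor turns a relation between pure
  tensors into one between the \<open>\<beta> p\<close>; their independence yields, for each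
  \<open>p\<close>, a relation between the \<open>\<beta>' q\<close>.\<close>

lemma BB_indep:
  assumes "vec c = 0" "p \<in> P" shows "c p = 0"
proof -
  have inner: "(\<Sum>q\<in>idx l' b. c (p', q) * \<beta>' q y) = 0" if p': "p' \<in> idx l a" for p' y
  proof (rule V.idx_indep[OF _ p'])
    show "(\<Sum>p\<in>idx l a. vsmul (\<Sum>q\<in>idx l' b. c (p, q) * \<beta>' q y) (\<beta> p)) = 0"
    proof
      fix x
      have "(\<Sum>p\<in>idx l a. vsmul (\<Sum>q\<in>idx l' b. c (p, q) * \<beta>' q y) (\<beta> p)) x
        = (\<Sum>p\<in>idx l a. \<Sum>q\<in>idx l' b. (vsmul (c (p, q)) (BB (p, q))) (x, y))"
        by (simp add: sum_fun_apply fun_apply BB_def tv_def sum_distrib_right sum_distrib_left mult.assoc mult.left_commute mult.commute)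
      also have "\<dots> = vec c (x, y)"
        by (simp add: vec_def sum_fun_apply sum.cartesian_product)
      finally show "(\<Sum>p\<in>idx l a. vsmul (\<Sum>q\<in>idx l' b. c (p, q) * \<beta>' q y) (\<beta> p)) x = (0 :: 'i \<Rightarrow> 'a) x"
        using assms(1) by (simp add: fun_apply)
    qed
  qed
  have "(\<Sum>q\<in>idx l' b. vsmul (c (fst p, q)) (\<beta>' q)) = 0"
    using inner[of "fst p"] assms(2) by (auto simp: fun_eq_iff sum_fun_apply fun_apply)
  then have "c (fst p, snd p) = 0" by (rule W.idx_indep) (use assms(2) in auto)
  then show ?thesis by simp
qed

lemma vec_diff: "vec (\<lambda>p. c p - k * d p) = vec c - vsmul k (vec d)"
  by (simp add: vec_def fv.scale_left_diff_distrib sum_subtractf fv.scale_sum_right)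

lemma vec_vecs: "vec c \<in> vecs (car V \<times> car W)"
  unfolding vec_def by (intro fv.subspace_sum fv.subspace_scale subspace_vecs BB_vecs)

text \<open>The common pattern behind \<open>e\<close> and \<open>x_m\<close>: \<open>KV\<close> and
  \<open>KW\<close> stand for the coefficient maps \<open>eC\<close> or \<open>xC\<close> of the two
  factors, applied with the other index frozen.\<close>

lemma act_vec:
  assumes x: "valid_gmb m x"
    and KV: "\<And>q. q \<in> idx l' b \<Longrightarrow> act V x (\<Sum>p\<in>idx l a. vsmul (c (p, q)) (\<beta> p))
      = (\<Sum>p\<in>idx l a. vsmul (KV (\<lambda>p. c (p, q)) p) (\<beta> p))"
    and KW: "\<And>p. p \<in> idx l a \<Longrightarrow> act W x (\<Sum>q\<in>idx l' b. vsmul (c (p, q)) (\<beta>' q))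
      = (\<Sum>q\<in>idx l' b. vsmul (KW (\<lambda>q. c (p, q)) q) (\<beta>' q))"
  shows "act (tens V W) x (vec c)
    = vec (\<lambda>p. KV (\<lambda>p'. c (p', snd p)) (fst p) + KW (\<lambda>q'. c (fst p, q')) (snd p))"
proof -
  have "act (tens V W) x (vec c) = (\<Sum>p\<in>P. vsmul (c p) (act (tens V W) x (BB p)))"
    unfolding vec_def using BB_vecs act_tens_lin[OF x]
    by (simp add: lin_on_sum[OF subspace_vecs act_tens_lin[OF x]] fv.subspace_scale[OF subspace_vecs]
        lin_on_smul[OF subspace_vecs act_tens_lin[OF x]])
  also have "\<dots> = (\<Sum>p\<in>P. vsmul (c p) (tv (act V x (\<beta> (fst p))) (\<beta>' (snd p))))
      + (\<Sum>p\<in>P. vsmul (c p) (tv (\<beta> (fst p)) (act W x (\<beta>' (snd p)))))"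
    using x by (simp add: act_BB fv.scale_right_distrib sum.distrib)
  also have "(\<Sum>p\<in>P. vsmul (c p) (tv (act V x (\<beta> (fst p))) (\<beta>' (snd p))))
    = (\<Sum>p\<in>idx l a. \<Sum>q\<in>idx l' b. tv (vsmul (c (p, q)) (act V x (\<beta> p))) (\<beta>' q))"
    by (simp add: tv_smul sum.cartesian_product case_prod_beta)
  also have "\<dots> = (\<Sum>q\<in>idx l' b. tv (\<Sum>p\<in>idx l a. vsmul (c (p, q)) (act V x (\<beta> p))) (\<beta>' q))"
    by (subst sum.swap) (simp add: tv_sum)
  also have "\<dots> = (\<Sum>q\<in>idx l' b. tv (\<Sum>p\<in>idx l a. vsmul (KV (\<lambda>p. c (p, q)) p) (\<beta> p)) (\<beta>' q))"
    using x by (simp add: V.act_sum_idx flip: KV)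
  also have "\<dots> = (\<Sum>p\<in>P. vsmul (KV (\<lambda>p'. c (p', snd p)) (fst p)) (BB p))"
    unfolding tv_sum tv_smul by (subst sum.swap) (simp add: sum.cartesian_product case_prod_beta BB_def)
  also have "(\<Sum>p\<in>P. vsmul (c p) (tv (\<beta> (fst p)) (act W x (\<beta>' (snd p)))))
    = (\<Sum>p\<in>idx l a. tv (\<beta> p) (\<Sum>q\<in>idx l' b. vsmul (c (p, q)) (act W x (\<beta>' q))))"
    by (simp add: tv_smul tv_sum sum.cartesian_product case_prod_beta)
  also have "\<dots> = (\<Sum>p\<in>idx l a. tv (\<beta> p) (\<Sum>q\<in>idx l' b. vsmul (KW (\<lambda>q. c (p, q)) q) (\<beta>' q)))"
    using x by (simp add: W.act_sum_idx flip: KW)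
  also have "\<dots> = (\<Sum>p\<in>P. vsmul (KW (\<lambda>q'. c (fst p, q')) (snd p)) (BB p))"
    unfolding tv_sum tv_smul by (simp add: sum.cartesian_product case_prod_beta BB_def)
  finally show ?thesis by (simp add: vec_def fv.scale_left_distrib sum.distrib)
qed

lemma hw_sys_iff:
  assumes supp: "\<And>p. p \<notin> P \<Longrightarrow> c p = 0"
  shows "hw_sys l a \<sigma> l' b \<tau> c \<longleftrightarrow> act (tens V W) E (vec c) = 0 \<and> act (tens V W) (X m) (vec c) = 0"
proof -
  have E: "act (tens V W) E (vec c)
    = vec (\<lambda>p. eC a (\<lambda>p'. c (p', snd p)) (fst p) + eC b (\<lambda>q'. c (fst p, q')) (snd p))"
    by (rule act_vec) (simp_all add: V.act_E_sum W.act_E_sum)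
  have X: "act (tens V W) (X m) (vec c)
    = vec (\<lambda>p. xC \<sigma> (\<lambda>p'. c (p', snd p)) (fst p) + xC \<tau> (\<lambda>q'. c (fst p, q')) (snd p))"
    by (rule act_vec) (use supp in \<open>auto intro!: V.act_Xm_sum W.act_Xm_sum\<close>)
  have z: "vec c = 0 \<longleftrightarrow> (\<forall>p\<in>idx l a. \<forall>q\<in>idx l' b. c (p, q) = 0)" for c
    using BB_indep[of c] by (auto simp: vec_def intro!: sum.neutral)
  show ?thesis unfolding E X z using supp by (auto simp: hw_sys_def)
qed

text \<open>A set of degrees as parameter lets one argument serve both \<open>S_t\<close>, with a
  singleton, and the socle, with all degrees.\<close>

definition Y :: "nat set \<Rightarrow> ('i \<times> 'j \<Rightarrow> 'a) set" where
  "Y \<Delta> = fv.span (BB ` {p \<in> P. pdeg p \<in> \<Delta>})"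

lemma Y_vecs: "Y \<Delta> \<subseteq> vecs (car V \<times> car W)"
  unfolding Y_def using BB_vecs by (intro fv.span_minimal) auto

lemma Y_UNIV: "Y UNIV = vecs (car V \<times> car W)"
  using T.B_spans Y_vecs[of UNIV] by (auto simp: Y_def car_tens)

lemma vec_in_Y: "(\<And>p. c p \<noteq> 0 \<Longrightarrow> pdeg p \<in> \<Delta>) \<Longrightarrow> vec c \<in> Y \<Delta>"
  unfolding vec_def Y_def
  by (rule fv.span_sum) (metis (mono_tags, lifting) fv.scale_zero_left fv.span_base fv.span_scale
      fv.span_zero imageI mem_Collect_eq)

lemma Y_explicit:
  assumes "v \<in> Y \<Delta>"
  obtains c where "v = vec c" "\<And>p. c p \<noteq> 0 \<Longrightarrow> p \<in> P \<and> pdeg p \<in> \<Delta>"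
proof -
  have fin: "finite {p \<in> P. pdeg p \<in> \<Delta>}" by (rule finite_subset[of _ P]) auto
  obtain d where d: "v = (\<Sum>p\<in>{p \<in> P. pdeg p \<in> \<Delta>}. vsmul (d p) (BB p))"
    using assms unfolding Y_def span_image_explicit[OF fin] by blast
  define c where "c p = (if p \<in> P \<and> pdeg p \<in> \<Delta> then d p else 0)" for p
  have "v = vec c" unfolding d vec_def by (rule sum.mono_neutral_cong_left) (auto simp: c_def)
  moreover have "p \<in> P \<and> pdeg p \<in> \<Delta>" if "c p \<noteq> 0" for p
    using that unfolding c_def by presburger
  ultimately show ?thesis using that by blast
qed

lemma Y_stable: "T.stable (Y \<Delta>)"
proof -
  have "act (tens V W) x v \<in> Y \<Delta>" if x: "x \<in> {E, F, H}" and v: "v \<in> Y \<Delta>" for x v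
  proof -
    have valid: "valid_gmb m x" using x by auto
    have BB: "act (tens V W) x (BB p) \<in> Y \<Delta>" if p: "p \<in> P" "pdeg p \<in> \<Delta>" for p
    proof -
      have "tv (act V x (\<beta> (fst p))) (\<beta>' (snd p)) \<in> Y \<Delta>"
        unfolding Y_def
        by (rule tv_span_BB[OF V.act_sl2_span[OF _ x] fv.span_base[of _ "\<beta>' ` {snd p}"]])
          (use p in \<open>auto simp: pdeg_def\<close>)
      moreover have "tv (\<beta> (fst p)) (act W x (\<beta>' (snd p))) \<in> Y \<Delta>"
        unfolding Y_def
        by (rule tv_span_BB[OF fv.span_base[of _ "\<beta> ` {fst p}"] W.act_sl2_span[OF _ x]])
          (use p in \<open>auto simp: pdeg_def\<close>)
      ultimately show ?thesis using valid by (simp add: act_BB Y_def fv.span_add)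
    qed
    obtain c where c: "v = vec c" "\<And>p. c p \<noteq> 0 \<Longrightarrow> p \<in> P \<and> pdeg p \<in> \<Delta>"
      using Y_explicit[OF v] by blast
    have "act (tens V W) x v = (\<Sum>p\<in>P. vsmul (c p) (act (tens V W) x (BB p)))"
      unfolding c(1) vec_def using BB_vecs
      by (simp add: lin_on_sum[OF subspace_vecs act_tens_lin[OF valid]] fv.subspace_scale[OF subspace_vecs]
          lin_on_smul[OF subspace_vecs act_tens_lin[OF valid]])
    also have "\<dots> \<in> Y \<Delta>"
      unfolding Y_def
    proof (rule fv.span_sum)
      fix p assume "p \<in> P"
      show "vsmul (c p) (act (tens V W) x (BB p)) \<in> fv.span (BB ` {p \<in> P. pdeg p \<in> \<Delta>})"
      proof (cases "c p = 0")
        case False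
        show ?thesis using BB c(2)[OF False] unfolding Y_def by (blast intro: fv.span_scale)
      qed (simp add: fv.span_zero)
    qed
    finally show ?thesis .
  qed
  moreover have "fv.subspace (Y \<Delta>)" by (simp add: Y_def)
  ultimately show ?thesis using Y_vecs[of \<Delta>] unfolding T.stable_def unfolding car_tens by simp
qed

lemma wt_coeff:
  assumes v: "vec c \<in> T.wt \<mu>" and p: "p \<in> P" "c p \<noteq> 0"
  shows "pwt a b p = \<mu>"
proof -
  have "act (tens V W) H (vec c) = vec (\<lambda>p. c p * of_int (pwt a b p))"
    unfolding vec_def by (rule T.act_H_sum) simp
  then have "vec (\<lambda>p. c p * of_int (pwt a b p) - of_int \<mu> * c p) = 0"
    unfolding vec_diff using v by (simp add: T.wt_def)
  then have "c p * of_int (pwt a b p) - of_int \<mu> * c p = 0" by (rule BB_indep) (rule p)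
  then show ?thesis using p by (simp add: mult.commute)
qed

lemma vec_in_wt:
  assumes "\<And>p. c p \<noteq> 0 \<Longrightarrow> pwt a b p = \<mu>"
  shows "vec c \<in> T.wt \<mu>"
proof -
  have "act (tens V W) H (vec c) = (\<Sum>p\<in>P. vsmul (c p * of_int (pwt a b p)) (BB p))"
    unfolding vec_def by (rule T.act_H_sum) simp
  also have "\<dots> = (\<Sum>p\<in>P. vsmul (of_int \<mu>) (vsmul (c p) (BB p)))"
  proof (rule sum.cong[OF refl])
    fix p assume "p \<in> P"
    show "vsmul (c p * of_int (pwt a b p)) (BB p) = vsmul (of_int \<mu>) (vsmul (c p) (BB p))"
      using assms[of p] by (cases "c p = 0") (auto simp: mult.commute)
  qed
  finally show ?thesis
    unfolding T.wt_def unfolding car_tens mem_Collect_eq using vec_vecs[of c]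
    by (simp add: vec_def fv.scale_sum_right)
qed

definition R :: "nat set \<Rightarrow> ('i \<times> 'j \<Rightarrow> 'a) set" where
  "R \<Delta> = r_inv m (tens V W) (Y \<Delta>)"

lemma R_mono: "\<Delta> \<subseteq> \<Delta>' \<Longrightarrow> R \<Delta> \<subseteq> R \<Delta>'"
proof -
  assume "\<Delta> \<subseteq> \<Delta>'"
  then have "Y \<Delta> \<subseteq> Y \<Delta>'" unfolding Y_def by (intro fv.span_mono) auto
  then show ?thesis by (auto simp: R_def r_inv_def)
qed

lemma R_stable: "T.stable (R \<Delta>)"
  unfolding R_def by (rule T.r_inv_stable[OF Y_stable])

lemma hw_in_R:
  assumes "v \<in> Y \<Delta>" "act (tens V W) E v = 0" "act (tens V W) (X m) v = 0"
  shows "v \<in> R \<Delta>"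
proof -
  have zero: "act (tens V W) x 0 = 0" if "valid_gmb m x" for x
    using lin_on_zero[OF subspace_vecs act_tens_lin[OF that]] .
  have "act (tens V W) (X k) v = 0" if "k \<le> m" for k
    \<comment> \<open>The two-element set \<open>{0, v}\<close> is \<open>e\<close>-stable since
      \<open>e\<close> kills \<open>v\<close>.\<close>
    by (rule X_zero_of_lowest[OF gm_module_tens, of "{0, v}"])
      (use assms Y_vecs fv.subspace_0[OF subspace_vecs] that zero in \<open>auto simp: car_tens\<close>)
  then show ?thesis using assms by (simp add: R_def r_inv_def)
qed

lemma tens_sub_U:
  assumes "i \<le> l" "j \<le> l'"
  shows "tens_sub (U i) (U' j) = fv.span (BB ` (({i} \<times> {..a i}) \<times> {j} \<times> {..b j}))"
proof
  show "tens_sub (U i) (U' j) \<subseteq> fv.span (BB ` (({i} \<times> {..a i}) \<times> {j} \<times> {..b j}))"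
  proof
    fix w assume "w \<in> tens_sub (U i) (U' j)"
    then obtain n u u' where u: "\<And>k. k < n \<Longrightarrow> u k \<in> U i \<and> u' k \<in> U' j"
      and w: "w = (\<lambda>(p, q). \<Sum>k<(n::nat). u k p * u' k q)"
      unfolding tens_sub_def by blast
    have "w = (\<Sum>k<n. tv (u k) (u' k))"
      by (auto simp: w fun_eq_iff sum_fun_apply tv_def)
    also have "\<dots> \<in> fv.span (BB ` (({i} \<times> {..a i}) \<times> {j} \<times> {..b j}))"
      using u V.U_span[OF assms(1)] W.U_span[OF assms(2)] by (intro fv.span_sum tv_span_BB) auto
    finally show "w \<in> fv.span (BB ` (({i} \<times> {..a i}) \<times> {j} \<times> {..b j}))" .
  qed
  show "fv.span (BB ` (({i} \<times> {..a i}) \<times> {j} \<times> {..b j})) \<subseteq> tens_sub (U i) (U' j)"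
  proof
    fix w assume "w \<in> fv.span (BB ` (({i} \<times> {..a i}) \<times> {j} \<times> {..b j}))"
    moreover have fin: "finite (({i} \<times> {..a i}) \<times> {j} \<times> {..b j})" by simp
    ultimately obtain d where d: "w = (\<Sum>p\<in>({i} \<times> {..a i}) \<times> {j} \<times> {..b j}. vsmul (d p) (BB p))"
      unfolding span_image_explicit[OF fin] by blast
    obtain \<pi> where \<pi>: "bij_betw \<pi> {..<card (({i} \<times> {..a i}) \<times> {j} \<times> {..b j})} (({i} \<times> {..a i}) \<times> {j} \<times> {..b j})"
      using ex_bij_betw_nat_finite[OF fin] unfolding atLeast0LessThan by blast
    define n where "n = card (({i} \<times> {..a i}) \<times> {j} \<times> {..b j})"
    have w: "w = (\<Sum>k<n. vsmul (d (\<pi> k)) (BB (\<pi> k)))"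
      unfolding d n_def by (rule sum.reindex_bij_betw[OF \<pi>, symmetric])
    have mem: "\<pi> k \<in> ({i} \<times> {..a i}) \<times> {j} \<times> {..b j}" if "k < n" for k
      using \<pi> that by (auto simp: bij_betw_def n_def)
    have "vsmul (d (\<pi> k)) (\<beta> (fst (\<pi> k))) \<in> U i \<and> \<beta>' (snd (\<pi> k)) \<in> U' j" if "k < n" for k
      using mem[OF that] unfolding V.U_span[OF \<open>i \<le> l\<close>] W.U_span[OF \<open>j \<le> l'\<close>]
      by (intro conjI fv.span_scale fv.span_base imageI) (simp_all add: mem_Times_iff)
    moreover have "w = (\<lambda>(p, q). \<Sum>k<n. vsmul (d (\<pi> k)) (\<beta> (fst (\<pi> k))) p * \<beta>' (snd (\<pi> k)) q)"
      by (auto simp: w fun_eq_iff sum_fun_apply BB_def tv_def fun_apply mult.assoc)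
    ultimately show "w \<in> tens_sub (U i) (U' j)"
      unfolding tens_sub_def
      by (intro CollectI exI[of _ n] exI[of _ "\<lambda>k. vsmul (d (\<pi> k)) (\<beta> (fst (\<pi> k)))"]
          exI[of _ "\<lambda>k. \<beta>' (snd (\<pi> k))"]) blast
  qed
qed

lemma Sdef_eq: "Sdef m V W U U' l l' t = R {t}"
proof -
  let ?A = "{i. i \<le> t \<and> i \<le> l \<and> t - i \<le> l'}"
  have finA: "finite ?A" by simp
  let ?S = "{sum w ?A | w. \<forall>i. i \<le> t \<and> i \<le> l \<and> t - i \<le> l' \<longrightarrow> w i \<in> tens_sub (U i) (U' (t - i))}"
  have "?S = Y {t}"
  proof
    show "?S \<subseteq> Y {t}"
    proof clarify
      fix w assume w: "\<forall>i. i \<le> t \<and> i \<le> l \<and> t - i \<le> l' \<longrightarrow> w i \<in> tens_sub (U i) (U' (t - i))"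
      have "w i \<in> Y {t}" if i: "i \<in> ?A" for i
      proof -
        have "w i \<in> fv.span (BB ` (({i} \<times> {..a i}) \<times> {t - i} \<times> {..b (t - i)}))"
          using w i tens_sub_U[of i "t - i"] by auto
        also have "\<dots> \<subseteq> Y {t}" unfolding Y_def using i by (intro fv.span_mono image_mono) (auto simp: pdeg_def)
        finally show ?thesis .
      qed
      then show "sum w ?A \<in> Y {t}" by (intro fv.subspace_sum) (auto simp: Y_def)
    qed
    show "Y {t} \<subseteq> ?S"
      unfolding Y_def
    proof (rule fv.span_minimal)
      have "fv.subspace {sum w ?A | w. \<forall>i\<in>?A. w i \<in> tens_sub (U i) (U' (t - i))}"
        by (rule subspace_sums) (auto simp: tens_sub_U)
      then show "fv.subspace ?S" by simp
      show "BB ` {p \<in> P. pdeg p \<in> {t}} \<subseteq> ?S"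
      proof (rule image_subsetI)
        fix p assume p: "p \<in> {p \<in> P. pdeg p \<in> {t}}"
        obtain i s j q where ps: "p = ((i, s), j, q)" by (cases p) auto
        have *: "(i, s) \<in> idx l a" "(j, q) \<in> idx l' b" "pdeg ((i, s), j, q) = t"
          using p unfolding ps by auto
        let ?w = "\<lambda>i'. if i' = i then BB ((i, s), j, q) else 0"
        have "sum ?w ?A = BB ((i, s), j, q)" using * by (subst sum.delta) (auto simp: pdeg_def)
        moreover have "?w i' \<in> tens_sub (U i') (U' (t - i'))" if "i' \<le> t \<and> i' \<le> l \<and> t - i' \<le> l'" for i'
          using that * by (auto simp: tens_sub_U pdeg_def fv.span_zero intro!: fv.span_base)
        ultimately show "BB p \<in> ?S"
          unfolding ps by (intro CollectI exI[of _ ?w]) simp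
      qed
    qed
  qed
  then show ?thesis by (simp add: Sdef_def R_def)
qed

end

section \<open>From a classification of solutions to the socle\<close>

locale typed_z_pair = z_pair m V U l a \<sigma> \<beta> W U' l' b \<tau> \<beta>'
  for m and V :: "('a::field_char_0, 'i) gmod" and U l a \<sigma> \<beta>
    and W :: "('a, 'j) gmod" and U' l' b \<tau> \<beta>' +
  fixes Ty base om
  assumes types: "hw_types l a \<sigma> l' b \<tau> TYPE('a) Ty base om"
begin

lemma fin_Ty: "finite Ty" and inj_om: "inj_on om Ty"
  using types by (auto simp: hw_types_def)

lemma type_of_hw:
  fixes c :: "_ \<Rightarrow> 'a"
  assumes "hw_sys l a \<sigma> l' b \<tau> c" "c p \<noteq> 0"
  obtains k where "(pdeg p, k) \<in> Ty" "c (base (pdeg p, k)) \<noteq> 0"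
  using types assms unfolding hw_types_def by blast

definition cc :: "nat \<times> nat \<Rightarrow> (nat \<times> nat) \<times> nat \<times> nat \<Rightarrow> 'a" where
  "cc y = (SOME c. hw_sys l a \<sigma> l' b \<tau> c \<and> c (base y) \<noteq> 0 \<and>
      (\<forall>p. c p \<noteq> 0 \<longrightarrow> pdeg p = fst y \<and> pwt a b p = int (om y)))"

lemma cc:
  assumes "y \<in> Ty"
  shows "hw_sys l a \<sigma> l' b \<tau> (cc y)" "cc y (base y) \<noteq> 0"
    "cc y p \<noteq> 0 \<Longrightarrow> pdeg p = fst y" "cc y p \<noteq> 0 \<Longrightarrow> pwt a b p = int (om y)"
proof -
  have "\<exists>c :: _ \<Rightarrow> 'a. hw_sys l a \<sigma> l' b \<tau> c \<and> c (base y) \<noteq> 0 \<and>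
      (\<forall>p. c p \<noteq> 0 \<longrightarrow> pdeg p = fst y \<and> pwt a b p = int (om y))"
    using types assms unfolding hw_types_def by blast
  from someI_ex[OF this, folded cc_def]
  show "hw_sys l a \<sigma> l' b \<tau> (cc y)" "cc y (base y) \<noteq> 0"
    "cc y p \<noteq> 0 \<Longrightarrow> pdeg p = fst y" "cc y p \<noteq> 0 \<Longrightarrow> pwt a b p = int (om y)"
    by blast+
qed

text \<open>\<open>hw_family\<close> indexes its vectors by weights, \<open>Ty\<close> by degree and
  parameter; inverting \<open>om\<close>, which is injective on \<open>Ty\<close>, translates
  between them.\<close>

definition hwv :: "nat \<Rightarrow> 'i \<times> 'j \<Rightarrow> 'a" where
  "hwv n = vec (cc (the_inv_into Ty om n))"

lemma hwv_om: "y \<in> Ty \<Longrightarrow> hwv (om y) = vec (cc y)"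
  by (simp add: hwv_def the_inv_into_f_f[OF inj_om])

lemma hw_sys_supp: "hw_sys l a \<sigma> l' b \<tau> c \<Longrightarrow> p \<notin> P \<Longrightarrow> c p = 0"
  unfolding hw_sys_def by blast

text \<open>For completeness, a highest weight vector has a nonzero base coefficient for some type
  \<open>y\<close>, and a multiple of the solution \<open>cc y\<close> removes it. Anything left
  over would have a nonzero base coefficient for a type of the same weight, hence for
  \<open>y\<close> itself by injectivity of \<open>om\<close>. Since \<open>om\<close> separates
  types of different degrees as well, this makes the vector homogeneous.\<close>

lemma hw_family_R:
  "hw_family (vecs (car (tens V W))) (act (tens V W) E) (act (tens V W) F) (act (tens V W) H)
    (\<Sum>p\<in>P. \<bar>pwt a b p\<bar>) (R \<Delta>) (om ` {y \<in> Ty. fst y \<in> \<Delta>}) hwv"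
proof
  show "T.stable (R \<Delta>)" by (rule R_stable)
  show "finite (om ` {y \<in> Ty. fst y \<in> \<Delta>})" using fin_Ty by simp
  fix n assume "n \<in> om ` {y \<in> Ty. fst y \<in> \<Delta>}"
  then obtain y where y: "n = om y" "y \<in> Ty" "fst y \<in> \<Delta>" by blast
  have supp: "cc y p = 0" if "p \<notin> P" for p using hw_sys_supp[OF cc(1)[OF y(2)] that] .
  have hw: "act (tens V W) E (vec (cc y)) = 0" "act (tens V W) (X m) (vec (cc y)) = 0"
    using hw_sys_iff[of "cc y"] supp cc(1)[OF y(2)] by auto
  have "vec (cc y) \<in> Y \<Delta>" using cc(3)[OF y(2)] y(3) by (auto intro: vec_in_Y)
  then show "hwv n \<in> R \<Delta>" using hw_in_R hw y by (simp add: hwv_om)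
  show "act (tens V W) E (hwv n) = 0" using hw y by (simp add: hwv_om)
  show "hwv n \<in> T.wt (int n)" using y vec_in_wt cc(4)[OF y(2)] by (auto simp: hwv_om)
  show "hwv n \<noteq> 0"
    using BB_indep[of "cc y" "base y"] cc(2)[OF y(2)] supp[of "base y"] y by (auto simp: hwv_om)
next
  fix v \<mu> assume v: "v \<in> R \<Delta>" "act (tens V W) E v = 0" "v \<in> T.wt \<mu>" "v \<noteq> 0"
  obtain c where c: "v = vec c" "\<And>p. c p \<noteq> 0 \<Longrightarrow> p \<in> P \<and> pdeg p \<in> \<Delta>"
    using Y_explicit[of v \<Delta>] v(1) by (auto simp: R_def r_inv_def)
  have supp: "c p = 0" if "p \<notin> P" for p using c(2) that by blast
  have "act (tens V W) (X m) v = 0" using v(1) by (simp add: R_def r_inv_def)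
  then have sys: "hw_sys l a \<sigma> l' b \<tau> c"
    using hw_sys_iff[of c, OF supp] v(2) unfolding c(1) by blast
  have "\<exists>p. c p \<noteq> 0"
  proof (rule ccontr)
    assume "\<nexists>p. c p \<noteq> 0"
    then have "c p = 0" for p by blast
    then have "vec c = 0"
      unfolding vec_def by (intro sum.neutral ballI) (simp only: fv.scale_zero_left)
    then show False using v(4) c(1) by simp
  qed
  then obtain p where p: "c p \<noteq> 0" ..
  obtain k where k: "(pdeg p, k) \<in> Ty" "c (base (pdeg p, k)) \<noteq> 0"
    using type_of_hw[OF sys p] by blast
  define y where "y = (pdeg p, k)"
  have y: "y \<in> Ty" "c (base y) \<noteq> 0" "fst y \<in> \<Delta>" using k c(2)[OF p] by (auto simp: y_def)
  have c_wt: "pwt a b q = \<mu>" if "c q \<noteq> 0" for q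
    using wt_coeff[of c \<mu> q] v(3) c that by simp
  have om_y: "int (om y) = \<mu>" using cc(4)[OF y(1) cc(2)[OF y(1)]] c_wt[OF y(2)] by simp
  \<comment> \<open>The scalar that cancels the coefficient at \<open>base y\<close>.\<close>
  define k' where "k' = c (base y) / cc y (base y)"
  define c' where "c' = (\<lambda>p. c p - k' * cc y p)"
  have sys': "hw_sys l a \<sigma> l' b \<tau> c'"
    unfolding c'_def by (rule hw_sys_comb[OF sys cc(1)[OF y(1)]])
  have "c' q = 0" for q
  proof (rule ccontr)
    assume "c' q \<noteq> 0"
    then obtain k'' where k'': "(pdeg q, k'') \<in> Ty" "c' (base (pdeg q, k'')) \<noteq> 0"
      using type_of_hw[OF sys'] by blast
    define y' where "y' = (pdeg q, k'')"
    have y': "y' \<in> Ty" "c' (base y') \<noteq> 0" using k'' by (simp_all add: y'_def)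
    have "c (base y') \<noteq> 0 \<or> cc y (base y') \<noteq> 0" using y'(2) by (auto simp: c'_def)
    then have "pwt a b (base y') = \<mu>" using c_wt[of "base y'"] cc(4)[OF y(1), of "base y'"] om_y by auto
    then have "om y' = om y" using cc(4)[OF y'(1) cc(2)[OF y'(1)]] om_y by simp
    then have "y' = y" using inj_onD[OF inj_om] y y' by blast
    then show False using y' cc(2)[OF y(1)] by (simp add: c'_def k'_def)
  qed
  then have "c = (\<lambda>p. k' * cc y p)" by (simp add: c'_def fun_eq_iff)
  then have "v = vsmul k' (vec (cc y))"
    unfolding c(1) by (simp add: vec_def fv.scale_sum_right)
  then show "\<exists>n\<in>om ` {y \<in> Ty. fst y \<in> \<Delta>}. \<exists>a. v = vsmul a (hwv n)"
    using y by (intro bexI[of _ "om y"] exI[of _ k'] imageI) (simp_all add: hwv_om)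
qed

lemma R_iso:
  assumes "distinct cs" "set cs = om ` {y \<in> Ty. fst y \<in> \<Delta>}"
  shows "sl2_iso_onto cs (tens V W) (R \<Delta>)"
  using hw_family.iso_onto[OF hw_family_R assms] by simp

lemma R_zero:
  assumes "\<And>y. y \<in> Ty \<Longrightarrow> fst y \<notin> \<Delta>"
  shows "R \<Delta> = {0}"
proof -
  interpret hw_family "vecs (car (tens V W))" "act (tens V W) E" "act (tens V W) F" "act (tens V W) H"
    "\<Sum>p\<in>P. \<bar>pwt a b p\<bar>" "R \<Delta>" "om ` {y \<in> Ty. fst y \<in> \<Delta>}" hwv
    by (rule hw_family_R)
  have "gens = {}" using assms by (auto simp: gens_def)
  then show ?thesis using span_gens_eq by simp
qed

lemma socle_eq: "socle m (tens V W) = R UNIV"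
  using T.socle_eq_r_inv[of "om ` {y \<in> Ty. fst y \<in> UNIV}" hwv] hw_family_R[of UNIV]
  by (simp add: R_def Y_UNIV car_tens)

lemma socle_mult_free: "sl2_mult_free (tens V W) (socle m (tens V W))"
  unfolding socle_eq by (rule hw_family.mult_free[OF hw_family_R[of UNIV]]) simp_all

text \<open>The bottom layers of both factors are killed by \<open>r\<close>, so in degree 0
  invariance is automatic.\<close>

lemma Y_0: "tens_sub (socle m V) (socle m W) = R {0}"
proof -
  have "Y {0} \<subseteq> R {0}"
  proof
    fix v assume v: "v \<in> Y {0}"
    then obtain c where c: "v = vec c" "\<And>p. c p \<noteq> 0 \<Longrightarrow> p \<in> P \<and> pdeg p \<in> {0}"
      using Y_explicit by blast
    have "act (tens V W) (X k) v = 0" if k: "k \<le> m" for k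
    proof -
      have "act (tens V W) (X k) v = (\<Sum>p\<in>P. vsmul (c p) (act (tens V W) (X k) (BB p)))"
        unfolding c(1) vec_def using BB_vecs k
        by (simp add: lin_on_sum[OF subspace_vecs act_tens_lin] fv.subspace_scale[OF subspace_vecs]
            lin_on_smul[OF subspace_vecs act_tens_lin])
      also have "\<dots> = 0"
      proof (rule sum.neutral, rule ballI)
        fix p assume p: "p \<in> P"
        show "vsmul (c p) (act (tens V W) (X k) (BB p)) = 0"
        proof (cases "c p = 0")
          case False
          obtain i s j q where ps: "p = ((i, s), (j, q))" by (cases p) auto
          have "i = 0" "j = 0" using c(2)[OF False] ps by (auto simp: pdeg_def)
          then show ?thesis using k ps by (simp add: act_BB V.act_X_0 W.act_X_0)
        qed simp
      qed
      finally show ?thesis .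
    qed
    then show "v \<in> R {0}" using v by (simp add: R_def r_inv_def)
  qed
  then have "R {0} = Y {0}" by (auto simp: R_def r_inv_def)
  moreover have "{p \<in> P. pdeg p \<in> {0}} = ({0} \<times> {..a 0}) \<times> {0} \<times> {..b 0}"
    by (auto simp: pdeg_def)
  ultimately show ?thesis
    by (simp add: V.socle_eq W.socle_eq tens_sub_U Y_def)
qed

text \<open>Vectors of different degrees have coefficients at disjoint positions, so a vanishing sum
  vanishes degree by degree.\<close>

lemma R_sum_zero:
  assumes w: "\<And>t. t \<in> A \<Longrightarrow> w t \<in> R {t}" and A: "finite A" and s: "sum w A = 0" and t: "t \<in> A"
  shows "w t = 0"
proof -
  have "\<exists>c. w t = vec c \<and> (\<forall>p. c p \<noteq> 0 \<longrightarrow> p \<in> P \<and> pdeg p = t)" if "t \<in> A" for t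
  proof -
    have "w t \<in> Y {t}" using w[OF that] by (simp add: R_def r_inv_def)
    from Y_explicit[OF this] obtain c where "w t = vec c" "\<And>p. c p \<noteq> 0 \<Longrightarrow> p \<in> P \<and> pdeg p \<in> {t}" by blast
    then show ?thesis by (intro exI[of _ c]) blast
  qed
  then obtain c where c: "\<And>t. t \<in> A \<Longrightarrow> w t = vec (c t)"
    "\<And>t p. t \<in> A \<Longrightarrow> c t p \<noteq> 0 \<Longrightarrow> pdeg p = t" by metis
  have "sum w A = (\<Sum>t\<in>A. \<Sum>p\<in>P. vsmul (c t p) (BB p))"
    by (intro sum.cong) (auto simp: c vec_def)
  also have "\<dots> = vec (\<lambda>p. \<Sum>t\<in>A. c t p)"
    unfolding vec_def by (subst sum.swap) (simp add: fv.scale_sum_left)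
  finally have z: "(\<Sum>t\<in>A. c t p) = 0" if "p \<in> P" for p
    using BB_indep[of "\<lambda>p. \<Sum>t\<in>A. c t p" p] s that by simp
  have "c t p = 0" if "p \<in> P" for p
  proof (cases "pdeg p = t")
    case True
    have "(\<Sum>t'\<in>A. c t' p) = (\<Sum>t'\<in>{t}. c t' p)"
    proof (rule sum.mono_neutral_right[OF A])
      show "\<forall>t'\<in>A - {t}. c t' p = 0" using c(2) True by (metis DiffE singletonI)
    qed (use t in auto)
    then show ?thesis using z[OF that] by simp
  qed (use c(2)[OF t] in blast)
  then show ?thesis unfolding c(1)[OF t] vec_def by (simp add: sum.neutral)
qed

lemma R_UNIV_sum:
  assumes le: "\<And>y. y \<in> Ty \<Longrightarrow> fst y \<le> n"
  shows "R UNIV = {sum w {..n} | w. \<forall>t\<le>n. w t \<in> R {t}}" (is "_ = ?S")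
proof
  show "?S \<subseteq> R UNIV"
    using R_mono[of _ UNIV] T.stableD(1)[OF R_stable[of UNIV]] by (auto intro!: fv.subspace_sum)
  interpret hw_family "vecs (car (tens V W))" "act (tens V W) E" "act (tens V W) F" "act (tens V W) H"
    "\<Sum>p\<in>P. \<bar>pwt a b p\<bar>" "R UNIV" "om ` {y \<in> Ty. fst y \<in> UNIV}" hwv
    by (rule hw_family_R)
  have "fv.span gens \<subseteq> ?S"
  proof (rule fv.span_minimal)
    show "fv.subspace ?S"
      using subspace_sums[of "{..n}" "\<lambda>t. R {t}"] T.stableD(1)[OF R_stable] by (simp add: Ball_def)
    show "gens \<subseteq> ?S"
    proof
      fix v assume "v \<in> gens"
      then obtain y k where y: "y \<in> Ty" "v = (act (tens V W) F ^^ k) (hwv (om y))"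
        unfolding gens_def by blast
      \<comment> \<open>The family restricted to the single degree of \<open>y\<close> places the
        same highest weight vector in \<open>R {fst y}\<close>; this is where homogeneity of the
        generators enters.\<close>
      interpret y: hw_family "vecs (car (tens V W))" "act (tens V W) E" "act (tens V W) F" "act (tens V W) H"
        "\<Sum>p\<in>P. \<bar>pwt a b p\<bar>" "R {fst y}" "om ` {y' \<in> Ty. fst y' \<in> {fst y}}" hwv
        by (rule hw_family_R)
      have "hwv (om y) \<in> R {fst y}" using y(1) by (intro y.hw(1)) auto
      then have v: "v \<in> R {fst y}" unfolding y(2) by (rule T.pow_stable(2)[OF R_stable])
      have "sum (\<lambda>t. if t = fst y then v else 0) {..n} = v" using le[OF y(1)] by simp
      then show "v \<in> ?S"
        using v by (intro CollectI exI[of _ "\<lambda>t. if t = fst y then v else 0"])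
          (auto simp: fv.subspace_0[OF T.stableD(1)[OF R_stable]])
    qed
  qed
  then show "R UNIV \<subseteq> ?S" using span_gens_eq by simp
qed

lemma socle_is_dsum:
  assumes le: "\<And>y. y \<in> Ty \<Longrightarrow> fst y \<le> n"
  shows "is_dsum (socle m (tens V W))
    (\<lambda>t. if t = 0 then tens_sub (socle m V) (socle m W) else Sdef m V W U U' l l' t) n"
proof -
  have "(\<lambda>t. if t = 0 then tens_sub (socle m V) (socle m W) else Sdef m V W U U' l l' t) = (\<lambda>t. R {t})"
    by (auto simp: Y_0 Sdef_eq fun_eq_iff)
  then have "is_dsum (socle m (tens V W))
    (\<lambda>t. if t = 0 then tens_sub (socle m V) (socle m W) else Sdef m V W U U' l l' t) n
    \<longleftrightarrow> is_dsum (R UNIV) (\<lambda>t. R {t}) n" by (simp only: socle_eq)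
  also have "\<dots>"
    unfolding is_dsum_def vsum_eq vzero_eq
  proof (intro conjI allI impI)
    show "R UNIV = {sum w {..n} | w. \<forall>t\<le>n. w t \<in> R {t}}" by (rule R_UNIV_sum[OF le])
    show "w t = 0" if "(\<forall>t\<le>n. w t \<in> R {t}) \<and> sum w {..n} = 0" "t \<le> n" for w t
      by (rule R_sum_zero[of "{..n}"]) (use that in auto)
  qed
  finally show ?thesis .
qed

end

section \<open>Solving the recurrences\<close>

lemma hw_sys_swap:
  assumes "hw_sys l a \<sigma> l' b \<tau> c"
  shows "hw_sys l' b \<tau> l a \<sigma> (\<lambda>p. c (prod.swap p))"
  using assms unfolding hw_sys_def
  by (auto simp: add.commute)

lemma pdeg_swap [simp]: "pdeg (prod.swap p) = pdeg p"
  by (simp add: pdeg_def add.commute)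

lemma pwt_swap [simp]: "pwt a b (prod.swap p) = pwt b a p"
  by (simp add: pwt_def add.commute)

text \<open>Carries the classification for an increasing and a decreasing factor over to the
  opposite order of the factors.\<close>

lemma hw_types_swap:
  assumes "hw_types l a \<sigma> l' b \<tau> TYPE('a::field_char_0) Ty base om"
  shows "hw_types l' b \<tau> l a \<sigma> TYPE('a) Ty (\<lambda>y. prod.swap (base y)) om"
  unfolding hw_types_def
proof (intro conjI allI impI ballI)
  show "finite Ty" "inj_on om Ty" using assms by (auto simp: hw_types_def)
next
  fix c :: "_ \<Rightarrow> 'a" and p assume c: "hw_sys l' b \<tau> l a \<sigma> c" "c p \<noteq> 0"
  have "\<exists>k. (pdeg (prod.swap p), k) \<in> Ty \<and> c (prod.swap (base (pdeg (prod.swap p), k))) \<noteq> 0"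
    using assms hw_sys_swap[OF c(1)] c(2) unfolding hw_types_def by (metis swap_swap)
  then show "\<exists>k. (pdeg p, k) \<in> Ty \<and> c (prod.swap (base (pdeg p, k))) \<noteq> 0" by simp
next
  fix y assume "y \<in> Ty"
  then obtain c :: "_ \<Rightarrow> 'a" where c: "hw_sys l a \<sigma> l' b \<tau> c" "c (base y) \<noteq> 0"
    "\<forall>p. c p \<noteq> 0 \<longrightarrow> pdeg p = fst y \<and> pwt a b p = int (om y)"
    using assms unfolding hw_types_def by metis
  then show "\<exists>c :: _ \<Rightarrow> 'a. hw_sys l' b \<tau> l a \<sigma> c \<and> c (prod.swap (base y)) \<noteq> 0 \<and>
      (\<forall>p. c p \<noteq> 0 \<longrightarrow> pdeg p = fst y \<and> pwt b a p = int (om y))"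
    using hw_sys_swap[OF c(1)] by (intro exI[of _ "\<lambda>p. c (prod.swap p)"]) (metis pdeg_swap pwt_swap swap_swap)
qed

locale hw_solution =
  fixes l a \<sigma> l' b \<tau> and c :: "(nat \<times> nat) \<times> nat \<times> nat \<Rightarrow> 'a::field_char_0"
  assumes sys: "hw_sys l a \<sigma> l' b \<tau> c"
begin

lemma supp:
  assumes "c ((i, s), (j, q)) \<noteq> 0"
  shows "i \<le> l" "s \<le> a i" "j \<le> l'" "q \<le> b j"
proof -
  have "((i, s), (j, q)) \<in> idx l a \<times> idx l' b" using sys assms unfolding hw_sys_def by blast
  then show "i \<le> l" "s \<le> a i" "j \<le> l'" "q \<le> b j" by auto
qed

lemma E_eq:
  assumes "i \<le> l" "s \<le> a i" "j \<le> l'" "q \<le> b j"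
  shows "of_int ((int s + 1) * (int (a i) - int s)) * c ((i, Suc s), (j, q))
    + of_int ((int q + 1) * (int (b j) - int q)) * c ((i, s), (j, Suc q)) = 0"
proof -
  have "(i, s) \<in> idx l a" "(j, q) \<in> idx l' b" using assms by auto
  then have "eC a (\<lambda>p'. c (p', (j, q))) (i, s) + eC b (\<lambda>q'. c ((i, s), q')) (j, q) = 0"
    using sys unfolding hw_sys_def by blast
  then show ?thesis unfolding eC_def fst_conv snd_conv .
qed

lemma X_eq:
  assumes "i \<le> l" "s \<le> a i" "j \<le> l'" "q \<le> b j"
  shows "(if \<sigma> \<le> s then c ((Suc i, s - \<sigma>), (j, q)) else 0)
    + (if \<tau> \<le> q then c ((i, s), (Suc j, q - \<tau>)) else 0) = 0"
proof -
  have "(i, s) \<in> idx l a" "(j, q) \<in> idx l' b" using assms by auto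
  then have "xC \<sigma> (\<lambda>p'. c (p', (j, q))) (i, s) + xC \<tau> (\<lambda>q'. c ((i, s), q')) (j, q) = 0"
    using sys unfolding hw_sys_def by blast
  then show ?thesis unfolding xC_def fst_conv snd_conv .
qed

text \<open>The \<open>e\<close>-equation at ((i, s), (j, q)) has two terms, and inside the index
  range the numerical factor of the given one is nonzero. So a nonzero coefficient cannot be
  balanced by a zero one.\<close>

lemma shift_left:
  assumes "c ((i, Suc s), (j, q)) \<noteq> 0" shows "c ((i, s), (j, Suc q)) \<noteq> 0"
proof
  assume z: "c ((i, s), (j, Suc q)) = 0"
  note r = supp[OF assms]
  have "of_int ((int s + 1) * (int (a i) - int s)) * c ((i, Suc s), (j, q)) = 0"
    using E_eq[of i s j q] r z by simp
  moreover have "(int s + 1) * (int (a i) - int s) \<noteq> 0" using r by simp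
  ultimately show False using assms unfolding mult_eq_0_iff of_int_eq_0_iff by blast
qed

lemma shift_right:
  assumes "c ((i, s), (j, Suc q)) \<noteq> 0" shows "c ((i, Suc s), (j, q)) \<noteq> 0"
proof
  assume z: "c ((i, Suc s), (j, q)) = 0"
  note r = supp[OF assms]
  have "of_int ((int q + 1) * (int (b j) - int q)) * c ((i, s), (j, Suc q)) = 0"
    using E_eq[of i s j q] r z by simp
  moreover have "(int q + 1) * (int (b j) - int q) \<noteq> 0" using r by simp
  ultimately show False using assms unfolding mult_eq_0_iff of_int_eq_0_iff by blast
qed

lemma antidiagonal:
  assumes "c ((i, s), (j, q)) \<noteq> 0" "s + q = s' + q'"
  shows "c ((i, s'), (j, q')) \<noteq> 0"
proof -
  have "c ((i, 0), (j, s + q)) \<noteq> 0"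
    using assms(1)
  proof (induction s arbitrary: q)
    case (Suc s)
    then show ?case using Suc.IH[OF shift_left] by fastforce
  qed simp
  moreover have "c ((i, 0), (j, s' + q')) \<noteq> 0 \<Longrightarrow> c ((i, s'), (j, q')) \<noteq> 0" for s' q'
  proof (induction s' arbitrary: q')
    case (Suc s')
    then show ?case using Suc.IH[of "Suc q'"] shift_right by auto
  qed simp
  ultimately show ?thesis using assms(2) by simp
qed

text \<open>Both ends of the antidiagonal carry nonzero coefficients, so both must lie within the
  index range.\<close>

lemma antidiagonal_le:
  assumes "c ((i, s), (j, q)) \<noteq> 0"
  shows "s + q \<le> a i" "s + q \<le> b j"
  using supp[OF antidiagonal[OF assms, of "s + q" 0]] supp[OF antidiagonal[OF assms, of 0 "s + q"]] by auto

end

text \<open>The coefficients of the highest weight vector of weight \<open>a + b - 2k\<close> in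
  \<open>V(a) \<otimes> V(b)\<close> are those with \<open>s + q = k\<close>, for every \<open>k\<close> at once.\<close>

definition cg :: "nat \<Rightarrow> nat \<Rightarrow> nat \<Rightarrow> nat \<Rightarrow> 'a::field_char_0" where
  "cg a b s q = (-1) ^ s * fact (a - s) * fact (b - q) / (fact s * fact q)"

lemma cg_nonzero: "cg a b s q \<noteq> 0"
  by (simp add: cg_def)

lemma cg_E:
  assumes "s < a" "q < b"
  shows "of_int ((int s + 1) * (int a - int s)) * cg a b (Suc s) q
    + of_int ((int q + 1) * (int b - int q)) * (cg a b s (Suc q) :: 'a::field_char_0) = 0"
proof -
  \<comment> \<open>Writing the upper parameters as sums removes truncated subtraction from the
    factorials.\<close>
  obtain x where x: "a = Suc s + x" using assms(1) less_iff_Suc_add by auto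
  obtain y where y: "b = Suc q + y" using assms(2) less_iff_Suc_add by auto
  have fs: "(fact (Suc n) :: 'a) = of_nat (Suc n) * fact n" for n by simp
  have nz: "(of_nat (Suc n) :: 'a) \<noteq> 0" for n by (rule of_nat_neq_0)
  have 1: "cg a b (Suc s) q = (-1) ^ Suc s * fact x * (of_nat (Suc y) * fact y)
      / (of_nat (Suc s) * fact s * (fact q :: 'a))"
    unfolding cg_def x y by (simp del: of_nat_Suc add: fs)
  have 2: "cg a b s (Suc q) = (-1) ^ s * (of_nat (Suc x) * fact x) * fact y
      / (fact s * (of_nat (Suc q) * (fact q :: 'a)))"
    unfolding cg_def x y by (simp del: of_nat_Suc add: fs)
  have 3: "of_int ((int s + 1) * (int a - int s)) = (of_nat (Suc s) * of_nat (Suc x) :: 'a)"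
    "of_int ((int q + 1) * (int b - int q)) = (of_nat (Suc q) * of_nat (Suc y) :: 'a)"
    unfolding x y by (simp_all add: algebra_simps)
  show ?thesis unfolding 1 2 3 using nz[of s] nz[of q] by (simp add: field_simps del: of_nat_Suc)
qed

text \<open>The bound on k keeps the antidiagonal s + q = k inside the index range. The
  \<open>x_m\<close>-equations hold because they read only coefficients with a positive layer
  index.\<close>

lemma hw_sys_degree_0:
  assumes "k \<le> a 0" "k \<le> b 0"
  shows "hw_sys l a \<sigma> l' b \<tau>
    (\<lambda>((i, s), (j, q)). if i = 0 \<and> j = 0 \<and> s + q = k then cg (a 0) (b 0) s q else (0 :: 'a::field_char_0))"
  using assms cg_E[of _ "a 0" _ "b 0", where 'a = 'a]
  unfolding hw_sys_def by (auto simp: eC_def xC_def split del: if_split split: if_split simp del: of_int_mult)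

definition base0 :: "nat \<times> nat \<Rightarrow> (nat \<times> nat) \<times> nat \<times> nat" where
  "base0 y = ((0, 0), y)"

lemma (in hw_solution) degree_0:
  assumes "c ((0, s), (0, q)) \<noteq> 0"
  shows "s + q \<le> min (a 0) (b 0) \<and> c (base0 (0, s + q)) \<noteq> 0"
  using antidiagonal_le[OF assms] antidiagonal[OF assms, of 0 "s + q"] by (simp add: base0_def)

lemma hw_sys_degree_0_exists:
  assumes "k \<le> min (a 0) (b 0)"
  shows "\<exists>c :: _ \<Rightarrow> 'a::field_char_0. hw_sys l a \<sigma> l' b \<tau> c \<and> c (base0 (0, k)) \<noteq> 0 \<and>
    (\<forall>p. c p \<noteq> 0 \<longrightarrow> pdeg p = 0 \<and> pwt a b p = int (a 0 + b 0 - 2 * k))"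
  using hw_sys_degree_0[of k a b l \<sigma> l' \<tau>, where 'a = 'a] assms
  by (intro exI[of _ "\<lambda>((i, s), (j, q)). if i = 0 \<and> j = 0 \<and> s + q = k then cg (a 0) (b 0) s q else 0"])
    (auto simp: base0_def cg_nonzero pdeg_def pwt_def of_nat_diff split: if_splits)

section \<open>Both factors with increasing weights\<close>

locale hw_solution_up_up = hw_solution l a 0 l' b 0 c for l a l' b c +
  fixes m a0 b0 :: nat
  assumes m: "m \<ge> 1" and a: "a = (\<lambda>i. a0 + i * m)" and b: "b = (\<lambda>j. b0 + j * m)"
begin

text \<open>If \<open>s + q > 0\<close>, the \<open>e\<close>-equations on the layers \<open>(i + 1, j)\<close> and \<open>(i, j + 1)\<close> contain, up to sign, the same
  two coefficients, but their weights are different.\<close>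

lemma left_step:
  assumes nz: "c ((Suc i, s), (j, q)) \<noteq> 0"
  shows "s + q = 0" "c ((i, 0), (Suc j, 0)) \<noteq> 0"
proof -
  define k where "k = s + q"
  note r = supp[OF nz] and k_le = antidiagonal_le[OF nz, folded k_def]
  define A where "A = c ((Suc i, 0), (j, k))"
  have A: "A \<noteq> 0" unfolding A_def by (rule antidiagonal[OF nz]) (simp add: k_def)
  have "A + c ((i, 0), (Suc j, k)) = 0" using X_eq[of i 0 j k] r k_le by (simp add: A_def)
  then have A': "c ((i, 0), (Suc j, k)) = - A" by (simp add: eq_neg_iff_add_eq_0 add.commute)
  have "k = 0"
  proof (rule ccontr)
    assume "k \<noteq> 0"
    then obtain k' where k': "k = Suc k'" by (cases k) auto
    have "k \<le> a i" using antidiagonal_le(1)[of i 0 "Suc j" k] A A' by simp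
    define B where "B = c ((Suc i, Suc 0), (j, k'))"
    have "B + c ((i, Suc 0), (Suc j, k')) = 0"
      using X_eq[of i "Suc 0" j k'] r k_le \<open>k \<le> a i\<close> k' by (simp add: B_def)
    then have B': "c ((i, Suc 0), (Suc j, k')) = - B" by (simp add: eq_neg_iff_add_eq_0 add.commute)
    define y where "y = (of_int ((int k' + 1) * (int (b j) - int k')) :: 'a)"
    have e1: "of_nat (a i + m) * B + y * A = 0"
      using E_eq[of "Suc i" 0 j k'] r k_le k' by (simp add: A_def B_def y_def a add.commute add.left_commute)
    have y': "of_int ((int k' + 1) * (int (b (Suc j)) - int k')) = y + of_nat (Suc k') * of_nat m"
      by (simp add: y_def b algebra_simps)
    have "Suc j \<le> l'" using supp(3)[of i 0 "Suc j" k] A A' by simp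
    moreover have "k' \<le> b (Suc j)" using k_le k' by (simp add: b)
    ultimately have e2: "of_nat (a i) * (- B) + (y + of_nat (Suc k') * of_nat m) * (- A) = 0"
      using E_eq[of i 0 "Suc j" k', unfolded y'] r A' B' by (simp add: k')
    \<comment> \<open>Adding the two \<open>e\<close>-equations cancels everything except the
      contribution of the weight difference m, which fixes the ratio of \<open>B\<close> to
      \<open>A\<close>.\<close>
    have "of_nat m * (B - of_nat (Suc k') * A) = (of_nat (a i + m) * B + y * A)
        + (of_nat (a i) * (- B) + (y + of_nat (Suc k') * of_nat m) * (- A))"
      by (simp add: algebra_simps)
    then have "of_nat m * (B - of_nat (Suc k') * A) = 0" unfolding e1 e2 by simp
    then have B: "B = of_nat (Suc k') * A" using m by simp
    \<comment> \<open>Substituting this ratio into the first equation leaves \<open>A\<close> with a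
      positive factor, since k' < k \<le> b j.\<close>
    have "of_int ((int k' + 1) * (int (a i) + int m + int (b j) - int k')) * A = 0"
      using e1 unfolding B y_def by (simp add: algebra_simps)
    moreover have "(int k' + 1) * (int (a i) + int m + int (b j) - int k') \<noteq> 0"
      using k_le k' m by simp
    ultimately show False using A unfolding mult_eq_0_iff of_int_eq_0_iff by blast
  qed
  then show "s + q = 0" "c ((i, 0), (Suc j, 0)) \<noteq> 0" using A A' by (simp_all add: k_def)
qed

text \<open>Transfers the degree to the second factor, where l' bounds it. The same chain in the
  swapped system transfers it to the first factor and gives the bound l.\<close>

lemma chain: "c ((i, 0), (j, 0)) \<noteq> 0 \<Longrightarrow> c ((0, 0), (i + j, 0)) \<noteq> 0"
proof (induction i arbitrary: j)
  case (Suc i)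
  then show ?case using Suc.IH[of "Suc j"] left_step(2)[of i 0 j 0] by simp
qed simp

lemma swapped: "hw_solution_up_up l' b l a (\<lambda>p. c (prod.swap p)) m b0 a0"
  by unfold_locales (use hw_sys_swap[OF sys] m a b in auto)

end

lemma hw_types_up_up:
  assumes m: "m \<ge> 1"
  shows "hw_types l (\<lambda>i. a0 + i * m) 0 l' (\<lambda>j. b0 + j * m) 0 TYPE('a::field_char_0)
    ({0} \<times> {..min a0 b0} \<union> {1..min l l'} \<times> {0}) base0 (\<lambda>(t, k). a0 + b0 + t * m - 2 * k)"
    (is "hw_types l ?a 0 l' ?b 0 _ ?Ty base0 ?om")
  unfolding hw_types_def
proof (intro conjI allI impI ballI)
  show "finite ?Ty" by simp
  show "inj_on ?om ?Ty"
  proof (rule inj_onI)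
    fix y y' assume *: "y \<in> ?Ty" "y' \<in> ?Ty" "?om y = ?om y'"
    obtain t k t' k' where y: "y = (t, k)" "y' = (t', k')" by (cases y; cases y')
    \<comment> \<open>Naming the products \<open>t * m\<close> makes the comparison linear: weights
      with t \<ge> 1 exceed a0 + b0, those with t = 0 do not.\<close>
    obtain x x' where x: "t * m = x" "t' * m = x'" and
      x_iff: "x = 0 \<longleftrightarrow> t = 0" "x' = 0 \<longleftrightarrow> t' = 0" "x = x' \<longleftrightarrow> t = t'" using m by auto
    show "y = y'" using * x_iff unfolding y mem_Collect_eq Un_iff mem_Times_iff fst_conv snd_conv case_prod_conv x
      by (auto; linarith)
  qed
next
  fix c :: "(nat \<times> nat) \<times> nat \<times> nat \<Rightarrow> 'a" and p
  assume c: "hw_sys l ?a 0 l' ?b 0 c" "c p \<noteq> 0"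
  interpret hw_solution_up_up l ?a l' ?b c m a0 b0 by unfold_locales (use c m in auto)
  interpret swap: hw_solution_up_up l' ?b l ?a "\<lambda>p. c (prod.swap p)" m b0 a0 by (rule swapped)
  obtain i s j q where p: "p = ((i, s), (j, q))" by (cases p) auto
  have nz: "c ((i, s), (j, q)) \<noteq> 0" using c p by simp
  show "\<exists>k. (pdeg p, k) \<in> ?Ty \<and> c (base0 (pdeg p, k)) \<noteq> 0"
  proof (cases "i + j = 0")
    case True
    then show ?thesis using degree_0[of s q] nz by (auto simp: p pdeg_def)
  next
    case False
    have "s + q = 0"
    proof (cases i)
      case 0
      then obtain j' where "j = Suc j'" using False by (cases j) auto
      then show ?thesis using swap.left_step(1)[of j' q i s] nz by simp
    next
      case (Suc i')
      then show ?thesis using left_step(1) nz by blast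
    qed
    then have nz0: "c ((i, 0), (j, 0)) \<noteq> 0" using nz by simp
    have "c ((0, 0), (i + j, 0)) \<noteq> 0" using chain[OF nz0] .
    moreover have "c ((i + j, 0), (0, 0)) \<noteq> 0" using swap.chain[of j i] nz0 by (simp add: add.commute)
    ultimately have "i + j \<le> min l l'" "c (base0 (pdeg p, 0)) \<noteq> 0"
      using supp(3) supp(1) by (auto simp: p pdeg_def base0_def)
    then show ?thesis using False by (intro exI[of _ 0]) (auto simp: p pdeg_def)
  qed
next
  fix y assume y: "y \<in> ?Ty"
  show "\<exists>c :: _ \<Rightarrow> 'a. hw_sys l ?a 0 l' ?b 0 c \<and> c (base0 y) \<noteq> 0 \<and>
    (\<forall>p. c p \<noteq> 0 \<longrightarrow> pdeg p = fst y \<and> pwt ?a ?b p = int (?om y))"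
  proof (cases "fst y = 0")
    case True
    then obtain k where "y = (0, k)" "k \<le> min (?a 0) (?b 0)" using y by auto
    then show ?thesis using hw_sys_degree_0_exists[of k ?a ?b l 0 l' 0, where 'a = 'a] by simp
  next
    case False
    then obtain t where t: "y = (t, 0)" "1 \<le> t" "t \<le> l" "t \<le> l'" using y by auto
    \<comment> \<open>An alternating sum of tensors of highest weight vectors: \<open>e\<close>
      kills each term, and \<open>x_m\<close> maps neighbouring terms to opposite vectors. The bound
      t \<le> min l l' keeps every layer pair in range.\<close>
    define c :: "(nat \<times> nat) \<times> nat \<times> nat \<Rightarrow> 'a" where
      "c = (\<lambda>((i, s), (j, q)). if i + j = t \<and> s = 0 \<and> q = 0 then (- 1) ^ i else 0)"
    have "hw_sys l ?a 0 l' ?b 0 c"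
      using t by (auto simp: hw_sys_def c_def eC_def xC_def)
    moreover have "c (base0 y) \<noteq> 0" by (simp add: c_def base0_def t)
    moreover have "pdeg p = fst y \<and> pwt ?a ?b p = int (?om y)" if nz: "c p \<noteq> 0" for p
    proof -
      obtain i s j q where p: "p = ((i, s), (j, q))" by (cases p) auto
      have "i + j = t" "s = 0" "q = 0" using nz by (auto simp: c_def p split: if_splits)
      then show ?thesis by (auto simp: p pdeg_def pwt_def t algebra_simps)
    qed
    ultimately show ?thesis by blast
  qed
qed

section \<open>Increasing weights against decreasing weights\<close>

locale hw_solution_up_down = hw_solution l a 0 l' b m c for l a l' b m c +
  fixes a0 b0 :: nat
  assumes m: "m \<ge> 1" and a: "a = (\<lambda>i. a0 + i * m)" and b: "b = (\<lambda>j. b0 - j * m)" and le: "l' * m \<le> b0"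
begin

lemma b_Suc: "Suc j \<le> l' \<Longrightarrow> b j = b (Suc j) + m"
  using le mult_le_mono1[of "Suc j" l' m] by (simp add: b)

lemma left_step:
  assumes nz: "c ((Suc i, s), (j, q)) \<noteq> 0"
  shows "s + q = a (Suc i)" "c ((i, 0), (Suc j, a i)) \<noteq> 0"
proof -
  define k where "k = s + q"
  note r = supp[OF nz] and k_le = antidiagonal_le[OF nz, folded k_def]
  \<comment> \<open>The second term of the \<open>x_m\<close>-equation is present only if the second
    exponent is at least m. Testing where that exponent is smallest, with the first as large as
    layer i permits, forces k \<ge> a(i) + m = a(i+1); \<open>antidiagonal_le\<close> gives the
    converse.\<close>
  define s' where "s' = min k (a i)"
  have "c ((Suc i, s'), (j, k - s')) \<noteq> 0" by (rule antidiagonal[OF nz]) (simp add: k_def s'_def)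
  moreover have "c ((Suc i, s'), (j, k - s'))
      + (if m \<le> k - s' then c ((i, s'), (Suc j, k - s' - m)) else 0) = 0"
    using X_eq[of i s' j "k - s'"] r k_le by (simp add: s'_def)
  ultimately have *: "m \<le> k - s'" "c ((i, s'), (Suc j, k - s' - m)) \<noteq> 0"
    by (auto split: if_splits)
  then have "s' = a i" using m by (auto simp: s'_def)
  moreover have "k \<ge> a (Suc i)" using * \<open>s' = a i\<close> m by (simp add: a)
  then have k: "k = a (Suc i)" using k_le by simp
  ultimately have "k - s' - m = 0" by (simp add: a)
  then show "s + q = a (Suc i)" "c ((i, 0), (Suc j, a i)) \<noteq> 0"
    using antidiagonal[OF *(2), of 0 "a i"] k \<open>s' = a i\<close> by (simp_all add: k_def)
qed

text \<open>Here the \<open>x_m\<close>-equation is read in the other direction. Since the first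
  factor is not shifted, its term is always present and has to balance the given one.\<close>

lemma right_step:
  assumes nz: "c ((i, s), (Suc j, q)) \<noteq> 0"
  shows "c ((Suc i, s), (j, q + m)) \<noteq> 0"
proof
  assume "c ((Suc i, s), (j, q + m)) = 0"
  then show False
    using X_eq[of i s j "q + m"] supp[OF nz] b_Suc[of j] nz by simp
qed

lemma left_chain: "c ((i, 0), (j, a i)) \<noteq> 0 \<Longrightarrow> c ((0, 0), (i + j, a0)) \<noteq> 0"
proof (induction i arbitrary: j)
  case (Suc i)
  then show ?case using Suc.IH[of "Suc j"] left_step(2)[of i 0 j "a (Suc i)"] by simp
qed (simp add: a)

text \<open>Collecting the degree in the first factor bounds it by l, just as
  \<open>left_chain\<close>, which collects it in the second factor, leads to the bound l'.\<close>

lemma right_chain: "c ((i, s), (j, q)) \<noteq> 0 \<Longrightarrow> i + j \<le> l"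
proof (induction j arbitrary: i q)
  case 0
  then show ?case using supp(1) by simp
next
  case (Suc j)
  then show ?case using right_step by fastforce
qed

lemma degree_pos:
  assumes nz: "c ((i, s), (j, q)) \<noteq> 0" and "i + j \<ge> 1"
  shows "c ((0, 0), (i + j, a0)) \<noteq> 0"
proof (cases i)
  case 0
  then obtain j' where j: "j = Suc j'" using assms(2) by (cases j) auto
  \<comment> \<open>Even with i = 0 the antidiagonal is determined: one step into layer 1 of the
    first factor makes \<open>left_step\<close> applicable.\<close>
  have "s + (q + m) = a (Suc 0)" using left_step(1)[OF right_step[OF nz[unfolded 0 j]]] .
  then have "s + q = a0" by (simp add: a)
  then show ?thesis using antidiagonal[OF nz, of 0 a0] 0 by simp
next
  case (Suc i')
  have "s + q = a i" using left_step(1)[OF nz[unfolded Suc]] Suc by simp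
  then show ?thesis using left_chain antidiagonal[OF nz, of 0 "a i"] by simp
qed

end

lemma hw_types_up_down:
  assumes m: "m \<ge> 1" and le: "l' * m \<le> b0"
  shows "hw_types l (\<lambda>i. a0 + i * m) 0 l' (\<lambda>j. b0 - j * m) m TYPE('a::field_char_0)
    ({0} \<times> {..min a0 b0} \<union> {t. 1 \<le> t \<and> t \<le> min l l' \<and> a0 + t * m \<le> b0} \<times> {a0}) base0
    (\<lambda>(t, k). a0 + b0 - t * m - 2 * k)"
    (is "hw_types l ?a 0 l' ?b m _ ?Ty base0 ?om")
  unfolding hw_types_def
proof (intro conjI allI impI ballI)
  show "finite ?Ty" by simp
  show "inj_on ?om ?Ty"
  proof (rule inj_onI)
    fix y y' assume *: "y \<in> ?Ty" "y' \<in> ?Ty" "?om y = ?om y'"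
    obtain t k t' k' where y: "y = (t, k)" "y' = (t', k')" by (cases y; cases y')
    obtain x x' where x: "t * m = x" "t' * m = x'" and
      x_iff: "x = 0 \<longleftrightarrow> t = 0" "x' = 0 \<longleftrightarrow> t' = 0" "x = x' \<longleftrightarrow> t = t'" using m by auto
    show "y = y'" using * x_iff unfolding y mem_Collect_eq Un_iff mem_Times_iff fst_conv snd_conv case_prod_conv x
      by (auto; linarith)
  qed
next
  fix c :: "(nat \<times> nat) \<times> nat \<times> nat \<Rightarrow> 'a" and p
  assume c: "hw_sys l ?a 0 l' ?b m c" "c p \<noteq> 0"
  interpret hw_solution_up_down l ?a l' ?b m c a0 b0 by unfold_locales (use c m le in auto)
  obtain i s j q where p: "p = ((i, s), (j, q))" by (cases p) auto
  have nz: "c ((i, s), (j, q)) \<noteq> 0" using c p by simp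
  show "\<exists>k. (pdeg p, k) \<in> ?Ty \<and> c (base0 (pdeg p, k)) \<noteq> 0"
  proof (cases "i + j = 0")
    case True
    then show ?thesis using degree_0[of s q] nz by (auto simp: p pdeg_def)
  next
    case False
    then have z: "c ((0, 0), (i + j, a0)) \<noteq> 0" by (intro degree_pos[OF nz]) linarith
    have "i + j \<le> l" using right_chain[OF nz] .
    moreover have "i + j \<le> l'" using supp(3)[OF z] .
    moreover have "a0 + (i + j) * m \<le> b0"
    proof -
      have "(i + j) * m \<le> b0" using le mult_le_mono1[OF \<open>i + j \<le> l'\<close>, of m] by linarith
      moreover have "a0 \<le> b0 - (i + j) * m" using antidiagonal_le(2)[OF z] by simp
      ultimately show ?thesis by linarith
    qed
    ultimately show ?thesis using False z by (intro exI[of _ a0]) (auto simp: p pdeg_def base0_def)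
  qed
next
  fix y assume y: "y \<in> ?Ty"
  show "\<exists>c :: _ \<Rightarrow> 'a. hw_sys l ?a 0 l' ?b m c \<and> c (base0 y) \<noteq> 0 \<and>
    (\<forall>p. c p \<noteq> 0 \<longrightarrow> pdeg p = fst y \<and> pwt ?a ?b p = int (?om y))"
  proof (cases "fst y = 0")
    case True
    then obtain k where "y = (0, k)" "k \<le> min (?a 0) (?b 0)" using y by auto
    then show ?thesis using hw_sys_degree_0_exists[of k ?a ?b l 0 l' m, where 'a = 'a] by simp
  next
    case False
    then obtain t where t: "y = (t, a0)" "1 \<le> t" "t \<le> l" "t \<le> l'" "a0 + t * m \<le> b0" using y by auto
    \<comment> \<open>On each layer pair of degree t this takes the Clebsch-Gordan vector with s + q
      = a(i), whose weight b(j) - a(i) = b0 - a0 - tm is the same for all of them; the signs make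
      the layers cancel under \<open>x_m\<close>.\<close>
    define c :: "(nat \<times> nat) \<times> nat \<times> nat \<Rightarrow> 'a" where
      "c = (\<lambda>((i, s), (j, q)). if i + j = t \<and> s + q = ?a i then (- 1) ^ i * cg (?a i) (?b j) s q else 0)"
    have ab: "?a i \<le> ?b j" if "i + j = t" for i j
    proof -
      have "a0 + i * m + j * m \<le> b0" using t(5) unfolding that[symmetric] by (simp add: add_mult_distrib)
      then show ?thesis by simp
    qed
    have supp: "c p = 0" if "p \<notin> idx l ?a \<times> idx l' ?b" for p
    proof (rule ccontr)
      assume nz: "c p \<noteq> 0"
      obtain i s j q where p: "p = ((i, s), (j, q))" by (cases p) auto
      have ij: "i + j = t" "s + q = ?a i" using nz by (auto simp: c_def p split: if_splits)
      then show False using that ab[OF ij(1)] t by (simp add: p)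
    qed
    have E: "eC ?a (\<lambda>p'. c (p', (j, q))) (i, s) + eC ?b (\<lambda>q'. c ((i, s), q')) (j, q) = 0" for i s j q
    proof (cases "i + j = t \<and> Suc s + q = ?a i")
      case True
      then have "s < ?a i" "q < ?b j" using ab[of i j] by auto
      from cg_E[OF this, where 'a = 'a]
      have "(- 1) ^ i * (of_int ((int s + 1) * (int (?a i) - int s)) * cg (?a i) (?b j) (Suc s) q
        + of_int ((int q + 1) * (int (?b j) - int q)) * (cg (?a i) (?b j) s (Suc q) :: 'a)) = 0"
        by (simp only: mult_zero_right)
      then show ?thesis
        using True by (simp add: eC_def c_def algebra_simps del: of_int_mult)
    qed (auto simp: eC_def c_def)
    have X: "xC 0 (\<lambda>p'. c (p', (j, q))) (i, s) + xC m (\<lambda>q'. c ((i, s), q')) (j, q) = 0"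
      if s: "s \<le> ?a i" for i s j q
    proof (cases "Suc i + j = t \<and> s + q = ?a (Suc i)")
      case True
      then have q: "m \<le> q" "s + (q - m) = ?a i" using s by auto
      \<comment> \<open>On s + q = a(i) the factorials of a - s and q in \<open>cg\<close> cancel,
        leaving up to sign (b - q)! / s!. Both b - q and s are unchanged by the shift, so
        neighbouring layers match.\<close>
      have sub: "?a (Suc i) - s = q" "?a i - s = q - m" using True q by auto
      have "Suc j \<le> l'" using True t by simp
      then have "Suc j * m \<le> b0" using le mult_le_mono1[of "Suc j" l' m] by linarith
      then have sub': "?b (Suc j) - (q - m) = ?b j - q" using q by simp
      have "cg (?a i) (?b (Suc j)) s (q - m) = (cg (?a (Suc i)) (?b j) s q :: 'a)"
        unfolding cg_def sub sub' by simp
      then show ?thesis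
        using True q by (simp add: xC_def c_def)
    next
      case False
      moreover have "\<not> (i + Suc j = t \<and> m \<le> q \<and> s + (q - m) = ?a i)" using False by auto
      ultimately show ?thesis by (auto simp: xC_def c_def)
    qed
    have "hw_sys l ?a 0 l' ?b m c" unfolding hw_sys_def using supp E X by auto
    moreover have "c (base0 y) \<noteq> 0" by (simp add: c_def base0_def t cg_nonzero)
    moreover have "pdeg p = fst y \<and> pwt ?a ?b p = int (?om y)" if nz: "c p \<noteq> 0" for p
    proof -
      obtain i s j q where p: "p = ((i, s), (j, q))" by (cases p) auto
      have ij: "i + j = t" "s + q = ?a i" using nz by (auto simp: c_def p split: if_splits)
      have jm: "j * m \<le> b0" "t * m = i * m + j * m"
        using ab[OF ij(1)] t(5) by (auto simp: add_mult_distrib simp flip: ij(1))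
      have "pwt ?a ?b p = int (?a i) + int (?b j) - 2 * int (s + q)" by (simp add: p pwt_def)
      also have "\<dots> = int (?om y)"
        unfolding ij(2) using jm t(5) by (simp add: t(1) of_nat_diff)
      finally show ?thesis using ij by (simp add: p pdeg_def t)
    qed
    ultimately show ?thesis by blast
  qed
qed

section \<open>Both factors with decreasing weights\<close>

lemma hw_types_down_down:
  assumes m: "m \<ge> 1" and le: "l * m \<le> a0" "l' * m \<le> b0"
  shows "hw_types l (\<lambda>i. a0 - i * m) m l' (\<lambda>j. b0 - j * m) m TYPE('a::field_char_0)
    ({0} \<times> {..min a0 b0}) base0 (\<lambda>(t, k). a0 + b0 - 2 * k)"
    (is "hw_types l ?a m l' ?b m _ ?Ty base0 ?om")
  unfolding hw_types_def
proof (intro conjI allI impI ballI)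
  show "finite ?Ty" by simp
  show "inj_on ?om ?Ty" by (auto simp: inj_on_def)
next
  have no_left: "c ((Suc i, s), (j, q)) = 0"
    if "hw_sys l a m l' b m c" "a = (\<lambda>i. a0 - i * m)" "l * m \<le> a0" for l a l' b a0 i s j q and c :: "_ \<Rightarrow> 'a"
  proof (rule ccontr)
    interpret hw_solution l a m l' b m c by unfold_locales (rule that)
    assume nz: "c ((Suc i, s), (j, q)) \<noteq> 0"
    define k where "k = s + q"
    note r = supp[OF nz] and k_le = antidiagonal_le[OF nz, folded k_def]
    have "a i = a (Suc i) + m"
      using that(2,3) mult_le_mono1[OF r(1), of m] by simp
    \<comment> \<open>With second exponent 0 < m the second term of the \<open>x_m\<close>-equation
      is absent, so the end of the antidiagonal vanishes.\<close>
    then have "c ((Suc i, k), (j, 0)) = 0" using X_eq[of i "k + m" j 0] r k_le m by simp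
    then show False using antidiagonal[OF nz, of k 0] by (simp add: k_def)
  qed
  fix c :: "(nat \<times> nat) \<times> nat \<times> nat \<Rightarrow> 'a" and p
  assume c: "hw_sys l ?a m l' ?b m c" "c p \<noteq> 0"
  interpret hw_solution l ?a m l' ?b m c by unfold_locales (rule c)
  obtain i s j q where p: "p = ((i, s), (j, q))" by (cases p) auto
  have "i = 0" using no_left[OF c(1) refl le(1), of _ s j q] c(2) by (cases i) (auto simp: p)
  moreover have "j = 0" using no_left[OF hw_sys_swap[OF c(1)] refl le(2), of _ q i s] c(2)
    by (cases j) (auto simp: p)
  ultimately show "\<exists>k. (pdeg p, k) \<in> ?Ty \<and> c (base0 (pdeg p, k)) \<noteq> 0"
    using degree_0[of s q] c(2) by (auto simp: p pdeg_def)
next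
  fix y assume "y \<in> ?Ty"
  then obtain k where "y = (0, k)" "k \<le> min (?a 0) (?b 0)" by auto
  then show "\<exists>c :: _ \<Rightarrow> 'a. hw_sys l ?a m l' ?b m c \<and> c (base0 y) \<noteq> 0 \<and>
    (\<forall>p. c p \<noteq> 0 \<longrightarrow> pdeg p = fst y \<and> pwt ?a ?b p = int (?om y))"
    using hw_sys_degree_0_exists[of k ?a ?b l m l' m, where 'a = 'a] by simp
qed

section \<open>Assembly of the four cases\<close>

lemma image_Times: "g ` ({x} \<times> A) = (\<lambda>k. g (x, k)) ` A"
  by (auto simp: image_iff)

lemma image_Un_Times:
  "g ` {y \<in> {x} \<times> A \<union> B \<times> {z}. fst y \<in> UNIV} = (\<lambda>k. g (x, k)) ` A \<union> (\<lambda>t. g (t, z)) ` B"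
  by (auto simp: image_iff)

theorem theorem3p5:
  fixes m l l' a0 b0 :: nat
    and V :: "('a::field_char_0, 'i) gmod" and W :: "('a, 'j) gmod"
    and U :: "nat \<Rightarrow> ('i \<Rightarrow> 'a) set" and U' :: "nat \<Rightarrow> ('j \<Rightarrow> 'a) set"
    and upV upW :: bool
  assumes m: "1 \<le> m"
    and V: "zmod m V U a0 l upV"
    and W: "zmod m W U' b0 l' upW"
  shows
    "is_dsum (socle m (tens V W))
        (\<lambda>t. if t = 0 then tens_sub (socle m V) (socle m W) else Sdef m V W U U' l l' t) (min l l')
     \<and> (upV \<and> upW \<longrightarrow>
          (\<forall>t. 1 \<le> t \<and> t \<le> min l l' \<longrightarrow>
               sl2_iso_onto [a0 + b0 + m * t] (tens V W) (Sdef m V W U U' l l' t))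
        \<and> sl2_iso_onto
            (map (\<lambda>k. a0 + b0 - 2 * k) [0..<min a0 b0 + 1] @
             map (\<lambda>t. a0 + b0 + m * t) [1..<min l l' + 1])
            (tens V W) (socle m (tens V W)))
     \<and> (upV \<and> \<not> upW \<longrightarrow>
          (\<forall>t. 1 \<le> t \<and> t \<le> min l l' \<longrightarrow>
               (a0 > b0 - t * m \<longrightarrow> Sdef m V W U U' l l' t = {vzero})
             \<and> (a0 \<le> b0 - t * m \<longrightarrow>
                  sl2_iso_onto [b0 - a0 - t * m] (tens V W) (Sdef m V W U U' l l' t)))
        \<and> (a0 > b0 \<longrightarrow>
             sl2_iso_onto (map (\<lambda>k. a0 - b0 + 2 * k) [0..<b0 + 1])
               (tens V W) (socle m (tens V W)))
        \<and> (a0 \<le> b0 \<longrightarrow>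
             sl2_iso_onto
               (map (\<lambda>k. b0 - a0 + 2 * k) [0..<a0 + 1] @
                map (\<lambda>t. b0 - a0 - t * m) [1..<min (min l l') ((b0 - a0) div m) + 1])
               (tens V W) (socle m (tens V W))))
     \<and> (\<not> upV \<and> \<not> upW \<longrightarrow>
          (\<forall>t\<ge>1. Sdef m V W U U' l l' t = {vzero})
        \<and> sl2_iso_onto
            (map (\<lambda>k. (if a0 \<le> b0 then b0 - a0 else a0 - b0) + 2 * k) [0..<min a0 b0 + 1])
            (tens V W) (socle m (tens V W)))
     \<and> sl2_mult_free (tens V W) (socle m (tens V W))"
proof -
  obtain \<beta> where "z_basis m V U l (zweight upV a0 m) (if upV then 0 else m) \<beta>"
    using zmod_z_basis[OF V] by blast
  then interpret zV: z_basis m V U l "zweight upV a0 m" "if upV then 0 else m" \<beta> .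
  obtain \<beta>' where "z_basis m W U' l' (zweight upW b0 m) (if upW then 0 else m) \<beta>'"
    using zmod_z_basis[OF W] by blast
  then interpret zW: z_basis m W U' l' "zweight upW b0 m" "if upW then 0 else m" \<beta>' .
  interpret z_pair m V U l "zweight upV a0 m" "if upV then 0 else m" \<beta>
    W U' l' "zweight upW b0 m" "if upW then 0 else m" \<beta>' ..
  have leV: "l * m \<le> a0" if "\<not> upV" using V that by (simp add: zmod_def)
  have leW: "l' * m \<le> b0" if "\<not> upW" using W that by (simp add: zmod_def)
  have zw: "zweight True c m = (\<lambda>i. c + i * m)" "zweight False c m = (\<lambda>i. c - i * m)" for c
    by (auto simp: zweight_def)
  consider "upV" "upW" | "upV" "\<not> upW" | "\<not> upV" "upW" | "\<not> upV" "\<not> upW" by blast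
  then show ?thesis
  proof cases
    case 1
    let ?Ty = "{0} \<times> {..min a0 b0} \<union> {1..min l l'} \<times> {0}"
    let ?om = "\<lambda>(t, k). a0 + b0 + t * m - 2 * k"
    interpret typed_z_pair m V U l "zweight upV a0 m" "if upV then 0 else m" \<beta>
      W U' l' "zweight upW b0 m" "if upW then 0 else m" \<beta>' ?Ty base0 ?om
      by unfold_locales (use hw_types_up_up[OF m] 1 in \<open>simp add: zw\<close>)
    have S: "sl2_iso_onto [a0 + b0 + m * t] (tens V W) (Sdef m V W U U' l l' t)"
      if "1 \<le> t" "t \<le> min l l'" for t
      unfolding Sdef_eq
    proof (rule R_iso)
      have "{y \<in> ?Ty. fst y \<in> {t}} = {(t, 0)}" using that by auto
      then show "set [a0 + b0 + m * t] = ?om ` {y \<in> ?Ty. fst y \<in> {t}}" by (simp add: mult.commute)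
    qed simp
    have soc: "sl2_iso_onto (map (\<lambda>k. a0 + b0 - 2 * k) [0..<min a0 b0 + 1] @
        map (\<lambda>t. a0 + b0 + m * t) [1..<min l l' + 1]) (tens V W) (socle m (tens V W))"
      (is "sl2_iso_onto ?cs _ _")
      unfolding socle_eq
    proof (rule R_iso)
      have set1: "set [0..<min a0 b0 + 1] = {..min a0 b0}" and set2: "set [1..<min l l' + 1] = {1..min l l'}"
        by auto
      have ne: "a0 + b0 - 2 * k \<noteq> a0 + b0 + m * t" if "t \<in> {1..min l l'}" for k t
      proof -
        have "m * t > 0" using m that by simp
        then show ?thesis by linarith
      qed
      have inj: "inj_on (\<lambda>k. a0 + b0 - 2 * k) {..min a0 b0}" "inj_on (\<lambda>t. a0 + b0 + m * t) {1..min l l'}"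
        using m by (auto simp: inj_on_def)
      show "distinct ?cs"
        unfolding distinct_append distinct_map set_map set1 set2 using distinct_upt inj ne by blast
      have "?om ` {y \<in> ?Ty. fst y \<in> UNIV} = (\<lambda>k. ?om (0, k)) ` {..min a0 b0} \<union> (\<lambda>t. ?om (t, 0)) ` {1..min l l'}"
        unfolding image_Un_Times by simp
      then show "set ?cs = ?om ` {y \<in> ?Ty. fst y \<in> UNIV}"
        unfolding set_append set_map set1 set2 by (simp add: mult.commute)
    qed
    have "fst y \<le> min l l'" if "y \<in> ?Ty" for y using that by auto
    from socle_is_dsum[OF this] socle_mult_free S soc 1 show ?thesis by blast
  next
    case 2
    let ?Ty = "{0} \<times> {..min a0 b0} \<union> {t. 1 \<le> t \<and> t \<le> min l l' \<and> a0 + t * m \<le> b0} \<times> {a0}"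
    let ?om = "\<lambda>(t, k). a0 + b0 - t * m - 2 * k"
    interpret typed_z_pair m V U l "zweight upV a0 m" "if upV then 0 else m" \<beta>
      W U' l' "zweight upW b0 m" "if upW then 0 else m" \<beta>' ?Ty base0 ?om
      by unfold_locales (use hw_types_up_down[OF m leW] 2 in \<open>simp add: zw\<close>)
    \<comment> \<open>Makes the subtraction b0 - tm a genuine one, so that the condition on
      \<open>a0\<close> can be moved across it.\<close>
    have tm: "t * m \<le> b0" if "t \<le> min l l'" for t
      using leW[OF 2(2)] mult_le_mono1[of t l' m] that by linarith
    have S0: "Sdef m V W U U' l l' t = {vzero}" if "1 \<le> t" "t \<le> min l l'" "a0 > b0 - t * m" for t
      unfolding Sdef_eq vzero_eq by (rule R_zero) (use that in auto)
    have S: "sl2_iso_onto [b0 - a0 - t * m] (tens V W) (Sdef m V W U U' l l' t)"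
      if "1 \<le> t" "t \<le> min l l'" "a0 \<le> b0 - t * m" for t
      unfolding Sdef_eq
    proof (rule R_iso)
      have "a0 + t * m \<le> b0" using that tm[of t] by simp
      then have "{y \<in> ?Ty. fst y \<in> {t}} = {(t, a0)}" using that by auto
      then show "set [b0 - a0 - t * m] = ?om ` {y \<in> ?Ty. fst y \<in> {t}}" by simp
    qed simp
    have soc1: "sl2_iso_onto (map (\<lambda>k. a0 - b0 + 2 * k) [0..<b0 + 1]) (tens V W) (socle m (tens V W))"
      if gt: "a0 > b0"
      unfolding socle_eq
    proof (rule R_iso)
      show "distinct (map (\<lambda>k. a0 - b0 + 2 * k) [0..<b0 + 1])" by (simp add: distinct_map inj_on_def del: upt_Suc)
      have "?Ty = {0} \<times> {..b0}" using gt by auto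
      then have "?om ` {y \<in> ?Ty. fst y \<in> UNIV} = (\<lambda>k. a0 + b0 - 2 * k) ` {..b0}" by (simp add: image_Times)
      \<comment> \<open>The substitution of b0 - k for k reverses the order in which the
        Clebsch-Gordan weights are listed.\<close>
      also have "\<dots> = (\<lambda>k. a0 - b0 + 2 * k) ` {..b0}"
      proof (intro equalityI image_subsetI)
        show "a0 + b0 - 2 * k \<in> (\<lambda>k. a0 - b0 + 2 * k) ` {..b0}" if "k \<in> {..b0}" for k
          using that gt by (intro image_eqI[of _ _ "b0 - k"]) auto
        show "a0 - b0 + 2 * k \<in> (\<lambda>k. a0 + b0 - 2 * k) ` {..b0}" if "k \<in> {..b0}" for k
          using that gt by (intro image_eqI[of _ _ "b0 - k"]) auto
      qed
      finally show "set (map (\<lambda>k. a0 - b0 + 2 * k) [0..<b0 + 1]) = ?om ` {y \<in> ?Ty. fst y \<in> UNIV}"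
        by (simp add: atLeast0LessThan lessThan_Suc_atMost del: upt_Suc)
    qed
    have soc2: "sl2_iso_onto (map (\<lambda>k. b0 - a0 + 2 * k) [0..<a0 + 1] @
        map (\<lambda>t. b0 - a0 - t * m) [1..<min (min l l') ((b0 - a0) div m) + 1])
        (tens V W) (socle m (tens V W))" (is "sl2_iso_onto ?cs _ _") if le: "a0 \<le> b0"
      unfolding socle_eq
    proof (rule R_iso)
      let ?T = "{1..min (min l l') ((b0 - a0) div m)}"
      \<comment> \<open>The integer quotient is the largest t with a0 + tm \<le> b0, which turns the
        condition for a nonzero S_t into an upper bound on t.\<close>
      have T: "?T = {t. 1 \<le> t \<and> t \<le> min l l' \<and> a0 + t * m \<le> b0}"
        using m le by (auto simp: less_eq_div_iff_mult_less_eq)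
      have pos: "t * m \<ge> 1 \<and> t * m \<le> b0 - a0" if "t \<in> ?T" for t
        using that m unfolding T by auto
      have inj: "inj_on (\<lambda>t. b0 - a0 - t * m) ?T"
      proof (rule inj_onI)
        fix t t' assume "t \<in> ?T" "t' \<in> ?T" "b0 - a0 - t * m = b0 - a0 - t' * m"
        then have "t * m = t' * m" using pos[of t] pos[of t'] by linarith
        then show "t = t'" using m by simp
      qed
      have set1: "set [0..<a0 + 1] = {..a0}" and set2: "set [1..<min (min l l') ((b0 - a0) div m) + 1] = ?T"
        by auto
      have ne: "b0 - a0 + 2 * k \<noteq> b0 - a0 - t * m" if "t \<in> ?T" for k t
      proof
        assume "b0 - a0 + 2 * k = b0 - a0 - t * m"
        then show False using pos[OF that] by linarith
      qed
      have inj0: "inj_on (\<lambda>k. b0 - a0 + 2 * k) {..a0}" by (simp add: inj_on_def)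
      show "distinct ?cs"
        unfolding distinct_append distinct_map set_map set1 set2 using distinct_upt inj0 inj ne by blast
      have "?om ` {y \<in> ?Ty. fst y \<in> UNIV} = (\<lambda>k. a0 + b0 - 2 * k) ` {..a0} \<union> (\<lambda>t. a0 + b0 - t * m - 2 * a0) ` ?T"
        unfolding T image_Un_Times using le by simp
      also have "(\<lambda>k. a0 + b0 - 2 * k) ` {..a0} = (\<lambda>k. b0 - a0 + 2 * k) ` {..a0}"
      proof (intro equalityI image_subsetI)
        show "a0 + b0 - 2 * k \<in> (\<lambda>k. b0 - a0 + 2 * k) ` {..a0}" if "k \<in> {..a0}" for k
          using that le by (intro image_eqI[of _ _ "a0 - k"]) auto
        show "b0 - a0 + 2 * k \<in> (\<lambda>k. a0 + b0 - 2 * k) ` {..a0}" if "k \<in> {..a0}" for k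
          using that le by (intro image_eqI[of _ _ "a0 - k"]) auto
      qed
      also have "(\<lambda>t. a0 + b0 - t * m - 2 * a0) ` ?T = (\<lambda>t. b0 - a0 - t * m) ` ?T"
        by (intro image_cong) auto
      finally show "set ?cs = ?om ` {y \<in> ?Ty. fst y \<in> UNIV}"
        unfolding set_append set_map set1 set2 by simp
    qed
    have "fst y \<le> min l l'" if "y \<in> ?Ty" for y using that by auto
    from socle_is_dsum[OF this] socle_mult_free S0 S soc1 soc2 2 show ?thesis by blast
  next
    \<comment> \<open>Up to exchanging the factors this is the previous case; here only the
      decomposition and multiplicity freeness are claimed.\<close>
    case 3
    let ?Ty = "{0} \<times> {..min b0 a0} \<union> {t. 1 \<le> t \<and> t \<le> min l' l \<and> b0 + t * m \<le> a0} \<times> {b0}"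
    let ?om = "\<lambda>(t, k). b0 + a0 - t * m - 2 * k"
    interpret typed_z_pair m V U l "zweight upV a0 m" "if upV then 0 else m" \<beta>
      W U' l' "zweight upW b0 m" "if upW then 0 else m" \<beta>' ?Ty "\<lambda>y. prod.swap (base0 y)" ?om
      by unfold_locales (use hw_types_swap[OF hw_types_up_down[OF m leV]] 3 in \<open>simp add: zw\<close>)
    have "fst y \<le> min l l'" if "y \<in> ?Ty" for y using that by auto
    from socle_is_dsum[OF this] socle_mult_free 3 show ?thesis by blast
  next
    case 4
    let ?Ty = "{0 :: nat} \<times> {..min a0 b0}"
    let ?om = "\<lambda>(t :: nat, k). a0 + b0 - 2 * k"
    interpret typed_z_pair m V U l "zweight upV a0 m" "if upV then 0 else m" \<beta>
      W U' l' "zweight upW b0 m" "if upW then 0 else m" \<beta>' ?Ty base0 ?om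
      by unfold_locales (use hw_types_down_down[OF m leV leW] 4 in \<open>simp add: zw\<close>)
    have S0: "Sdef m V W U U' l l' t = {vzero}" if "1 \<le> t" for t
      unfolding Sdef_eq vzero_eq by (rule R_zero) (use that in auto)
    have soc: "sl2_iso_onto (map (\<lambda>k. (if a0 \<le> b0 then b0 - a0 else a0 - b0) + 2 * k) [0..<min a0 b0 + 1])
        (tens V W) (socle m (tens V W))" (is "sl2_iso_onto (map ?g _) _ _")
      unfolding socle_eq
    proof (rule R_iso)
      show "distinct (map ?g [0..<min a0 b0 + 1])" by (simp add: distinct_map inj_on_def del: upt_Suc)
      have "?om ` {y \<in> ?Ty. fst y \<in> UNIV} = (\<lambda>k. a0 + b0 - 2 * k) ` {..min a0 b0}" by (simp add: image_Times)
      also have "\<dots> = ?g ` {..min a0 b0}"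
      proof (intro equalityI image_subsetI)
        show "a0 + b0 - 2 * k \<in> ?g ` {..min a0 b0}" if "k \<in> {..min a0 b0}" for k
          using that by (intro image_eqI[of _ _ "min a0 b0 - k"]) (auto simp: min_def)
        show "?g k \<in> (\<lambda>k. a0 + b0 - 2 * k) ` {..min a0 b0}" if "k \<in> {..min a0 b0}" for k
          using that by (intro image_eqI[of _ _ "min a0 b0 - k"]) (auto simp: min_def)
      qed
      finally show "set (map ?g [0..<min a0 b0 + 1]) = ?om ` {y \<in> ?Ty. fst y \<in> UNIV}"
        by (simp add: atLeast0LessThan lessThan_Suc_atMost del: upt_Suc)
    qed
    have "fst y \<le> min l l'" if "y \<in> ?Ty" for y using that by auto
    from socle_is_dsum[OF this] socle_mult_free S0 soc 4 show ?thesis by blast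
  qed
qed

end
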